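(* Let $\ell\in\mathbb{N}$, $m\in\{1,\dots,\ell\}$, $\mathfrak{g}=\mathfrak{sl}(\ell+1,\mathbb{C})$ with the $\mathbb{Z}$-gradation determined by $\omega=\omega_m$, and $i\in\{0,1,\dots,\ell\}$. Let $L(\Lambda_i)_\mu$ be a weight subspace of the standard level $1$ $\tilde{\mathfrak{g}}$-module $L(\Lambda_i)$. Then there exists $n_0\in\mathbb{Z}$ such that for any fixed $n\le n_0$ the set of vectors $$e^n x(\pi)v_i\in L(\Lambda_i)_\mu,\qquad x(\pi)\text{ satisfies the initial conditions and the difference conditions for } W(\Lambda_i),$$ is a basis of $L(\Lambda_i)_\mu$. Moreover, for two choices of $n_1,n_2\le n_0$, the corresponding two bases are connected by a diagonal matrix.
   Context: Finite-dimensional setting. $\mathfrak{g}=\mathfrak{sl}(\ell+1,\mathbb{C})$, $\mathfrak{h}$ is a Cartan subalgebra, $R$ the root system, $\alpha_1,\dots,\alpha_\ell$ simple roots, $\langle x,y\rangle=\mathrm{tr}(xy)$ the invariant form (used to identify $\mathfrak{h}$ with $\mathfrak{h}^*$), $\omega_1,\dots,\omega_\ell$ the fundamental weights ($\langle\omega_i,\alpha_j\rangle=\delta_{ij}$), $Q$ the root lattice, $P$ the weight lattice. Fix $\omega=\omega_m$ and put $\Gamma=\{\alpha\in R\mid\langle\alpha,\omega\rangle=1\}=\{\gamma_{rs}\mid 1\le r\le m\le s\le\ell\}$ (the set of colors), where $\gamma_{rs}=\alpha_r+\cdots+\alpha_s$. Then $\mathfrak{g}=\mathfrak{g}_{-1}\oplus\mathfrak{g}_0\oplus\mathfrak{g}_1$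 is a $\mathbb{Z}$-gradation, with $\mathfrak{g}_{\pm1}=\sum_{\alpha\in\pm\Gamma}\mathfrak{g}_\alpha$ and $\mathfrak{g}_0=\mathfrak{h}\oplus\sum_{\langle\alpha,\omega\rangle=0}\mathfrak{g}_\alpha$. Affine setting. $\tilde{\mathfrak{g}}=\mathfrak{g}\otimes\mathbb{C}[t,t^{-1}]\oplus\mathbb{C}c\oplus\mathbb{C}d$ with $x(j)=x\otimes t^j$, $c$ central, $[d,x(j)]=jx(j)$, $[x(i),y(j)]=[x,y](i+j)+i\langle x,y\rangle\delta_{i+j,0}c$. $\tilde{\mathfrak{g}}_1=\mathfrak{g}_1\otimes\mathbb{C}[t,t^{-1}]$ is commutative with basis $x_\gamma(j)$, $\gamma\in\Gamma$, $j\in\mathbb{Z}$. $\Lambda_0,\dots,\Lambda_\ell$ are the fundamental weights of $\tilde{\mathfrak{g}}$ and $L(\Lambda_i)$ the corresponding integrable irreducible highest weight (standard) modules, of level $1$. A weight subspace of $L(\Lambda_i)$ is a simultaneous eigenspace for $\mathfrak{h}\oplus\mathbb{C}c\oplus\mathbb{C}d$. $W(\Lambda_i)=U(\tilde{\mathfrak{g}}_1)v_i\subset L(\Lambda_i)$, with $v_i$ the highest weight vector. Realization of $L(\Lambda_i)$. Fix a central extension of $P$ by the cyclic group $\langle e^{\pi i/(\ell+1)^2}\rangle$ of order $2(\ell+1)^2$ whose 2-cocycle $\epsilon:P\times P\to\langle e^{\pi i/(\ell+1)^2}\rangle$ satisfies $\epsilon(\alpha,\beta)/\epsilon(\beta,\alpha)=(-1)^{\langle\alpha,\beta\rangle}$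 for $\alpha,\beta\in Q$. Let $M(1)\cong S(\mathfrak{h}\otimes t^{-1}\mathbb{C}[t^{-1}])$ be the Fock module of the Heisenberg algebra $\sum_{n\ne0}\mathfrak{h}\otimes t^n\oplus\mathbb{C}c$ with $c$ acting as $1$, and $V_P=M(1)\otimes\mathbb{C}[P]$, where $\mathbb{C}[P]$ is the group algebra with basis $e^\lambda$, $\lambda\in P$; write $e^\lambda$ also for $1\otimes e^\lambda\in V_P$ and for the operator $1\otimes e^\lambda$ of multiplication by $e^\lambda$ on $V_P$. Here $h(0)e^\lambda=\langle h,\lambda\rangle e^\lambda$, $z^h e^\lambda=z^{\langle h,\lambda\rangle}e^\lambda$, $\epsilon_\lambda e^\mu=\epsilon(\lambda,\mu)e^\mu$, $E^{\pm}(h,z)=\exp\big(\sum_{k\ge1}h(\pm k)\tfrac{z^{\mp k}}{\pm k}\big)$, and $Y(e^\lambda,z)=E^-(-\lambda,z)E^+(-\lambda,z)\otimes e^\lambda z^\lambda\epsilon_\lambda$. $\tilde{\mathfrak{g}}$ acts on $V_P$ with $\sum_{j\in\mathbb{Z}}x_\alpha(j)z^{-j-1}=Y(e^\alpha,z)$ for $\alpha\in R$, $h(j)$ acting in the natural way, $c=1$, and $d$ the degree operator $\deg(h_1(-n_1)\cdots h_r(-n_r)\otimes e^\lambda)=-n_1-\cdots-n_r-\tfrac12\langle\lambda,\lambda\rangle$. Then $L(\Lambda_0)=V_Q=M(1)\otimes\mathbb{C}[Q]$ with $v_0=1=e^0$, and $L(\Lambda_j)=V_Qe^{\omega_j}$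 with $v_j=e^{\omega_j}$ for $1\le j\le\ell$. Operator $e$. $e=\prod_{\gamma\in\Gamma}e^\gamma=e^{\sum_{\gamma\in\Gamma}\gamma}=e^{(\ell+1)\omega}$, a multiplication operator on $V_P$; it is invertible and preserves each $L(\Lambda_i)$. Monomials. $\mathbb{N}=\{1,2,\dots\}$; $x(\pi)$ denotes a finite (possibly empty) product $x_{\gamma_1}(-n_1)\cdots x_{\gamma_t}(-n_t)$ with $\gamma_j\in\Gamma$, $n_j\in\mathbb{N}$. Write $x_{rs}(-n)=x_{\gamma_{rs}}(-n)$. $x(\pi)$ satisfies the initial conditions for $W(\Lambda_i)$ if it contains no factor $x_\gamma(-1)$ with $x_\gamma(-1)v_i=0$; explicitly, no factor $x_{rs}(-1)$ with $r\le i\le s$ (no restriction if $i=0$). $x(\pi)$ satisfies the difference conditions if (a) whenever $x_{rs}(-j)x_{r's'}(-j)$ divides $x(\pi)$ (two factors of equal degree), either $r<r'$ and $s>s'$, or $r>r'$ and $s<s'$ (in particular no factor is repeated); and (b) whenever $x_{rs}(-j)$ and $x_{r's'}(-j-1)$ both occur in $x(\pi)$, one has $r'>r$ or $s'<s$. "Connected by a diagonal matrix" means that, after a suitable matching of their elements, each vector of one basis is a nonzero scalar multiple of the matched vector of the other. *)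

theory Defs
  imports Complex_Main "HOL-Library.Multiset" "HOL-Library.Poly_Mapping"
begin

text \<open>
  The Cartan subalgebra of traceless diagonal matrices of size \<open>l + 1\<close>: the matrix
  \<open>diag(x\<^sub>1, \<dots>, x\<^bsub>l+1\<^esub>)\<close> is the finitely supported function \<open>k \<mapsto> x\<^sub>k\<close>.  The dual space is
  identified with it by the trace form, so roots and weights have the same type.
\<close>

type_synonym hvec = "nat \<Rightarrow>\<^sub>0 complex"

definition cartan :: "nat \<Rightarrow> hvec set" where
  "cartan l = {x. Poly_Mapping.keys x \<subseteq> {1..l+1} \<and> (\<Sum>k=1..l+1. Poly_Mapping.lookup x k) = 0}"

definition hscale :: "complex \<Rightarrow> hvec \<Rightarrow> hvec" where
  "hscale c x = Poly_Mapping.map ((*) c) x"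

definition tform :: "hvec \<Rightarrow> hvec \<Rightarrow> complex" where
  "tform x y = (\<Sum>k\<in>Poly_Mapping.keys x. Poly_Mapping.lookup x k * Poly_Mapping.lookup y k)"

definition roots :: "nat \<Rightarrow> hvec set" where
  "roots l = {Poly_Mapping.single a 1 - Poly_Mapping.single b 1 | a b.
                a \<in> {1..l+1} \<and> b \<in> {1..l+1} \<and> a \<noteq> b}"

definition simple_root :: "nat \<Rightarrow> hvec" where
  "simple_root i = Poly_Mapping.single i 1 - Poly_Mapping.single (Suc i) 1"

text \<open>Here \<open>fund_weight l 0 = 0\<close>, which makes \<open>\<Lambda>\<^sub>0\<close> uniform with the other \<open>\<Lambda>\<^sub>i\<close> below.\<close>

definition fund_weight :: "nat \<Rightarrow> nat \<Rightarrow> hvec" where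
  "fund_weight l i =
     (\<Sum>k=1..i. Poly_Mapping.single k 1)
     - (\<Sum>k=1..l+1. Poly_Mapping.single k (of_nat i / of_nat (l+1)))"

definition root_lattice :: "nat \<Rightarrow> hvec set" where
  "root_lattice l = {(\<Sum>i=1..l. hscale (of_int (c i)) (simple_root i)) | c :: nat \<Rightarrow> int. True}"

definition weight_lattice :: "nat \<Rightarrow> hvec set" where
  "weight_lattice l = {(\<Sum>i=1..l. hscale (of_int (c i)) (fund_weight l i)) | c :: nat \<Rightarrow> int. True}"

definition colors :: "nat \<Rightarrow> nat \<Rightarrow> hvec set" where
  "colors l m = {\<alpha> \<in> roots l. tform \<alpha> (fund_weight l m) = 1}"

definition color :: "nat \<Rightarrow> nat \<Rightarrow> hvec" where
  "color r s = (\<Sum>k=r..s. simple_root k)"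

lemma tform_superset:
  assumes "finite A" "Poly_Mapping.keys x \<subseteq> A"
  shows "tform x y = (\<Sum>k\<in>A. Poly_Mapping.lookup x k * Poly_Mapping.lookup y k)"
  unfolding tform_def using assms by (intro sum.mono_neutral_left) (auto simp: in_keys_iff)

lemma tform_root:
  assumes "a \<noteq> b"
  shows "tform (Poly_Mapping.single a 1 - Poly_Mapping.single b 1) x
           = Poly_Mapping.lookup x a - Poly_Mapping.lookup x b"
  using assms
  by (subst tform_superset[of "{a, b}"])
     (auto simp: lookup_minus lookup_single when_def dest: keys_diff[THEN subsetD] split: if_splits)

lemma lookup_fund_weight:
  "Poly_Mapping.lookup (fund_weight l i) k =
     (if k \<in> {1..i} then 1 else 0) - (if k \<in> {1..l+1} then of_nat i / of_nat (l+1) else 0)"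
  unfolding fund_weight_def lookup_minus lookup_sum lookup_single
  by (simp add: when_def)

lemma tform_simple_root_fund_weight:
  assumes "i \<in> {1..l}" "j \<in> {1..l}"
  shows "tform (simple_root j) (fund_weight l i) = (if i = j then 1 else 0)"
  using assms unfolding simple_root_def
  by (subst tform_root) (auto simp: lookup_fund_weight)

lemma color_eq:
  assumes "r \<le> s"
  shows "color r s = Poly_Mapping.single r 1 - Poly_Mapping.single (Suc s) 1"
  using assms unfolding color_def simple_root_def
  by (induction s rule: dec_induct) auto

lemma colors_eq:
  assumes "m \<in> {1..l}"
  shows "colors l m = {color r s | r s. 1 \<le> r \<and> r \<le> m \<and> m \<le> s \<and> s \<le> l}"
proof (intro equalityI subsetI)
  fix x assume "x \<in> colors l m"
  then obtain a b where ab: "x = Poly_Mapping.single a 1 - Poly_Mapping.single b 1"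
      "a \<in> {1..l+1}" "b \<in> {1..l+1}" "a \<noteq> b" "tform x (fund_weight l m) = 1"
    unfolding colors_def roots_def by blast
  have "Poly_Mapping.lookup (fund_weight l m) a - Poly_Mapping.lookup (fund_weight l m) b = 1"
    using ab tform_root by metis
  hence "a \<le> m" "m < b"
    using ab assms by (auto simp: lookup_fund_weight split: if_splits)
  hence "x = color a (b - 1) \<and> 1 \<le> a \<and> a \<le> m \<and> m \<le> b - 1 \<and> b - 1 \<le> l"
    using ab by (auto simp: color_eq)
  thus "x \<in> {color r s | r s. 1 \<le> r \<and> r \<le> m \<and> m \<le> s \<and> s \<le> l}"
    by blast
next
  fix x assume "x \<in> {color r s | r s. 1 \<le> r \<and> r \<le> m \<and> m \<le> s \<and> s \<le> l}"
  then obtain r s where rs: "x = color r s" "1 \<le> r" "r \<le> m" "m \<le> s" "s \<le> l"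
    by blast
  have x: "x = Poly_Mapping.single r 1 - Poly_Mapping.single (Suc s) 1"
    using rs by (simp add: color_eq)
  have "x \<in> roots l"
    unfolding roots_def x using rs by force
  moreover have "tform x (fund_weight l m) = 1"
    using rs assms unfolding x by (subst tform_root) (auto simp: lookup_fund_weight)
  ultimately show "x \<in> colors l m"
    by (simp add: colors_def)
qed

text \<open>
  A 2-cocycle (trivial action) of the weight lattice with values in the cyclic group of order
  \<open>2(l+1)\<^sup>2\<close>, with prescribed commutator on the root lattice.  It is not assumed normalized.
\<close>

definition cocycle :: "nat \<Rightarrow> (hvec \<Rightarrow> hvec \<Rightarrow> complex) \<Rightarrow> bool" where
  "cocycle l \<epsilon> \<longleftrightarrow>
     (\<forall>a\<in>weight_lattice l. \<forall>b\<in>weight_lattice l. \<exists>k::nat. \<epsilon> a b = cis (pi / real ((l+1)^2)) ^ k) \<and>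
     (\<forall>a\<in>weight_lattice l. \<forall>b\<in>weight_lattice l. \<forall>c\<in>weight_lattice l.
        \<epsilon> a b * \<epsilon> (a + b) c = \<epsilon> b c * \<epsilon> a (b + c)) \<and>
     (\<forall>a\<in>root_lattice l. \<forall>b\<in>root_lattice l. \<forall>n::int.
        tform a b = of_int n \<longrightarrow> \<epsilon> a b / \<epsilon> b a = (-1) powi n)"

text \<open>
  The symmetric algebra of \<open>\<hh> \<otimes> t\<^sup>-\<^sup>1 \<complex>[t\<^sup>-\<^sup>1]\<close> is the polynomial ring in the variables
  \<open>\<alpha>\<^sub>i(-n)\<close>, \<open>1 \<le> i \<le> l\<close>, \<open>n \<ge> 1\<close>, where \<open>\<alpha>\<^sub>i(-n)\<close> is the variable with index \<open>(i, n)\<close>; a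
  polynomial is a finitely supported function on exponent vectors.  The space \<open>M(1) \<otimes> \<complex>[P]\<close> is
  the group algebra of \<open>P\<close> with coefficients in that ring: \<open>f \<otimes> e\<^sup>\<kappa>\<close> is
  \<open>single \<kappa> f\<close>.  The types are too large; \<open>fock_module\<close> and \<open>lattice_module\<close> cut out the spaces.
\<close>

type_synonym fock = "((nat \<times> nat) \<Rightarrow>\<^sub>0 nat) \<Rightarrow>\<^sub>0 complex"
type_synonym vspace = "hvec \<Rightarrow>\<^sub>0 fock"

definition fock_module :: "nat \<Rightarrow> fock set" where
  "fock_module l = {p. \<forall>u\<in>Poly_Mapping.keys p. Poly_Mapping.keys u \<subseteq> {1..l} \<times> {1..}}"

definition lattice_module :: "nat \<Rightarrow> hvec set \<Rightarrow> vspace set" where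
  "lattice_module l S =
     {v. Poly_Mapping.keys v \<subseteq> S \<and> (\<forall>\<kappa>. Poly_Mapping.lookup v \<kappa> \<in> fock_module l)}"

definition fscale :: "complex \<Rightarrow> fock \<Rightarrow> fock" where
  "fscale c p = Poly_Mapping.single 0 c * p"

definition vscale :: "complex \<Rightarrow> vspace \<Rightarrow> vspace" where
  "vscale c v = Poly_Mapping.single 0 (Poly_Mapping.single 0 c) * v"

global_interpretation VP: vector_space vscale
  by unfold_locales
     (simp_all add: vscale_def algebra_simps single_add mult_single flip: mult.assoc)

definition emult :: "hvec \<Rightarrow> vspace \<Rightarrow> vspace" where
  "emult \<kappa> v = Poly_Mapping.single \<kappa> 1 * v"

definition fderiv :: "nat \<times> nat \<Rightarrow> fock \<Rightarrow> fock" where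
  "fderiv x p = (\<Sum>u\<in>Poly_Mapping.keys p.
     Poly_Mapping.single (u - Poly_Mapping.single x 1) (of_nat (Poly_Mapping.lookup u x) * Poly_Mapping.lookup p u))"

text \<open>
  The operator \<open>h(n)\<close>.  For \<open>n < 0\<close> it is multiplication by
  \<open>h(n) = \<Sum>\<^sub>i \<langle>h, \<omega>\<^sub>i\<rangle> \<alpha>\<^sub>i(n)\<close>; for \<open>n > 0\<close> it is the derivation with
  \<open>\<alpha>\<^sub>i(-k) \<mapsto> n \<delta>\<^bsub>n,k\<^esub> \<langle>h, \<alpha>\<^sub>i\<rangle>\<close> (the central element acts as \<open>1\<close>).
\<close>

definition heis :: "nat \<Rightarrow> hvec \<Rightarrow> int \<Rightarrow> vspace \<Rightarrow> vspace" where
  "heis l h n v =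
     (if n < 0 then
        Poly_Mapping.single 0
          (\<Sum>i=1..l. Poly_Mapping.single (Poly_Mapping.single (i, nat (- n)) 1)
                       (tform h (fund_weight l i))) * v
      else if n = 0 then
        Poly_Mapping.mapp (\<lambda>\<kappa> p. fscale (tform h \<kappa>) p) v
      else
        Poly_Mapping.map
          (\<lambda>p. \<Sum>i=1..l. fscale (of_int n * tform h (simple_root i)) (fderiv (i, nat n) p)) v)"

definition deg_op :: "vspace \<Rightarrow> vspace" where
  "deg_op v = (\<Sum>\<kappa>\<in>Poly_Mapping.keys v. \<Sum>u\<in>Poly_Mapping.keys (Poly_Mapping.lookup v \<kappa>).
     vscale (- (\<Sum>(i, n)\<in>Poly_Mapping.keys u. of_nat (Poly_Mapping.lookup u (i, n) * n)) - tform \<kappa> \<kappa> / 2)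
       (Poly_Mapping.single \<kappa> (Poly_Mapping.single u (Poly_Mapping.lookup (Poly_Mapping.lookup v \<kappa>) u))))"

text \<open>
  \<open>exp_coeff A a\<close> is the coefficient of \<open>z\<^sup>a\<close> in the exponential of the formal operator series
  \<open>\<Sum>\<^bsub>k\<ge>1\<^esub> A\<^sub>k z\<^sup>k\<close>; its \<open>n\<close>-th power only contributes for \<open>n \<le> a\<close>.
\<close>

fun power_coeff :: "(nat \<Rightarrow> vspace \<Rightarrow> vspace) \<Rightarrow> nat \<Rightarrow> nat \<Rightarrow> vspace \<Rightarrow> vspace" where
  "power_coeff A 0 a v = (if a = 0 then v else 0)"
| "power_coeff A (Suc n) a v = (\<Sum>k=1..a. A k (power_coeff A n (a - k) v))"

definition exp_coeff :: "(nat \<Rightarrow> vspace \<Rightarrow> vspace) \<Rightarrow> nat \<Rightarrow> vspace \<Rightarrow> vspace" where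
  "exp_coeff A a v = (\<Sum>n\<le>a. vscale (1 / fact n) (power_coeff A n a v))"

text \<open>The coefficients of \<open>z\<^sup>a\<close> in \<open>E\<^sup>-(h, z)\<close> and of \<open>z\<^sup>-\<^sup>b\<close> in \<open>E\<^sup>+(h, z)\<close>.\<close>

definition E_minus :: "nat \<Rightarrow> hvec \<Rightarrow> nat \<Rightarrow> vspace \<Rightarrow> vspace" where
  "E_minus l h = exp_coeff (\<lambda>k v. vscale (- 1 / of_nat k) (heis l h (- int k) v))"

definition E_plus :: "nat \<Rightarrow> hvec \<Rightarrow> nat \<Rightarrow> vspace \<Rightarrow> vspace" where
  "E_plus l h = exp_coeff (\<lambda>k v. vscale (1 / of_nat k) (heis l h (int k) v))"

text \<open>
  The coefficient of \<open>z\<^sup>q\<close> in \<open>Y(e\<^sup>\<kappa>, z) = E\<^sup>-(-\<kappa>, z) E\<^sup>+(-\<kappa>, z) \<otimes> e\<^sup>\<kappa> z\<^sup>\<kappa> \<epsilon>\<^sub>\<kappa>\<close>.  On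
  \<open>M(1) \<otimes> e\<^sup>\<nu>\<close> the term indexed by \<open>(a, b)\<close> carries \<open>z\<close> to the power \<open>a - b + \<langle>\<kappa>, \<nu>\<rangle>\<close>.
  Since \<open>E_plus l h b\<close> kills a given vector for large \<open>b\<close>, and \<open>b\<close> determines \<open>a\<close>, only finitely
  many terms are nonzero.
\<close>

definition Y_coeff ::
  "nat \<Rightarrow> (hvec \<Rightarrow> hvec \<Rightarrow> complex) \<Rightarrow> hvec \<Rightarrow> complex \<Rightarrow> vspace \<Rightarrow> vspace" where
  "Y_coeff l \<epsilon> \<kappa> q v = (\<Sum>\<nu>\<in>Poly_Mapping.keys v.
     Sum_any (\<lambda>(a, b).
       if of_nat a - of_nat b + tform \<kappa> \<nu> = q
       then E_minus l (- \<kappa>) a (E_plus l (- \<kappa>) b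
              (emult \<kappa> (vscale (\<epsilon> \<kappa> \<nu>) (Poly_Mapping.single \<nu> (Poly_Mapping.lookup v \<nu>)))))
       else 0))"

definition x_op ::
  "nat \<Rightarrow> (hvec \<Rightarrow> hvec \<Rightarrow> complex) \<Rightarrow> hvec \<Rightarrow> int \<Rightarrow> vspace \<Rightarrow> vspace" where
  "x_op l \<epsilon> \<alpha> j = Y_coeff l \<epsilon> \<alpha> (of_int (- j - 1))"

text \<open>The realization of \<open>L(\<Lambda>\<^sub>i)\<close> as \<open>V\<^sub>Q e\<^bsup>\<omega>\<^sub>i\<^esup>\<close>, with highest weight vector \<open>e\<^bsup>\<omega>\<^sub>i\<^esup>\<close>.\<close>

definition L_module :: "nat \<Rightarrow> nat \<Rightarrow> vspace set" where
  "L_module l i = emult (fund_weight l i) ` lattice_module l (root_lattice l)"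

definition hw_vector :: "nat \<Rightarrow> nat \<Rightarrow> vspace" where
  "hw_vector l i = Poly_Mapping.single (fund_weight l i) 1"

text \<open>\<open>(h, a, b)\<close> stands for \<open>h + a c + b d\<close>, and \<open>c\<close> acts as the identity.\<close>

definition cartan_act :: "nat \<Rightarrow> hvec \<times> complex \<times> complex \<Rightarrow> vspace \<Rightarrow> vspace" where
  "cartan_act l = (\<lambda>(h, a, b) v. heis l h 0 v + vscale a v + vscale b (deg_op v))"

definition weight_subspace ::
  "nat \<Rightarrow> nat \<Rightarrow> (hvec \<times> complex \<times> complex \<Rightarrow> complex) \<Rightarrow> vspace set" where
  "weight_subspace l i \<mu> =
     {v \<in> L_module l i. \<forall>x \<in> cartan l \<times> UNIV. cartan_act l x v = vscale (\<mu> x) v}"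

text \<open>The operator \<open>e\<^sup>n\<close>, where \<open>e\<close> is multiplication by \<open>e\<^sup>\<beta>\<close> with \<open>\<beta>\<close> the sum of all colors.\<close>

definition e_power :: "nat \<Rightarrow> nat \<Rightarrow> int \<Rightarrow> vspace \<Rightarrow> vspace" where
  "e_power l m n = emult (hscale (of_int n) (\<Sum>\<gamma>\<in>colors l m. \<gamma>))"

text \<open>
  A monomial is a multiset of triples, \<open>(r, s, n)\<close> standing for the factor \<open>x\<^bsub>rs\<^esub>(-n)\<close>.  The factors
  commute on \<open>V\<^sub>P\<close>, so they may be applied in the order of any enumeration of the multiset.
\<close>

type_synonym monomial = "(nat \<times> nat \<times> nat) multiset"

definition is_monomial :: "nat \<Rightarrow> nat \<Rightarrow> monomial \<Rightarrow> bool" where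
  "is_monomial l m \<pi> \<longleftrightarrow>
     (\<forall>(r, s, n) \<in># \<pi>. 1 \<le> r \<and> r \<le> m \<and> m \<le> s \<and> s \<le> l \<and> 1 \<le> n)"

definition mon_op ::
  "nat \<Rightarrow> (hvec \<Rightarrow> hvec \<Rightarrow> complex) \<Rightarrow> monomial \<Rightarrow> vspace \<Rightarrow> vspace" where
  "mon_op l \<epsilon> \<pi> =
     foldr (\<lambda>(r, s, n). x_op l \<epsilon> (color r s) (- int n)) (SOME xs. mset xs = \<pi>)"

definition initial_conditions ::
  "nat \<Rightarrow> (hvec \<Rightarrow> hvec \<Rightarrow> complex) \<Rightarrow> nat \<Rightarrow> monomial \<Rightarrow> bool" where
  "initial_conditions l \<epsilon> i \<pi> \<longleftrightarrow>
     (\<forall>r s. (r, s, 1) \<in># \<pi> \<longrightarrow> x_op l \<epsilon> (color r s) (-1) (hw_vector l i) \<noteq> 0)"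

definition difference_conditions :: "monomial \<Rightarrow> bool" where
  "difference_conditions \<pi> \<longleftrightarrow>
     (\<forall>r s r' s' j. {#(r, s, j), (r', s', j)#} \<subseteq># \<pi> \<longrightarrow> r < r' \<and> s > s' \<or> r > r' \<and> s < s') \<and>
     (\<forall>r s r' s' j. (r, s, j) \<in># \<pi> \<and> (r', s', j + 1) \<in># \<pi> \<longrightarrow> r' > r \<or> s' < s)"

definition mon_vector ::
  "nat \<Rightarrow> nat \<Rightarrow> (hvec \<Rightarrow> hvec \<Rightarrow> complex) \<Rightarrow> nat \<Rightarrow> int \<Rightarrow> monomial \<Rightarrow> vspace" where
  "mon_vector l m \<epsilon> i n \<pi> = e_power l m n (mon_op l \<epsilon> \<pi> (hw_vector l i))"

definition basis_index ::
  "nat \<Rightarrow> nat \<Rightarrow> (hvec \<Rightarrow> hvec \<Rightarrow> complex) \<Rightarrow> nat \<Rightarrow> (hvec \<times> complex \<times> complex \<Rightarrow> complex)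
     \<Rightarrow> int \<Rightarrow> monomial set" where
  "basis_index l m \<epsilon> i \<mu> n =
     {\<pi>. is_monomial l m \<pi> \<and> initial_conditions l \<epsilon> i \<pi> \<and> difference_conditions \<pi> \<and>
         mon_vector l m \<epsilon> i n \<pi> \<in> weight_subspace l i \<mu>}"

definition is_basis_family :: "('a \<Rightarrow> vspace) \<Rightarrow> 'a set \<Rightarrow> vspace set \<Rightarrow> bool" where
  "is_basis_family f I U \<longleftrightarrow>
     inj_on f I \<and> VP.independent (f ` I) \<and> VP.span (f ` I) = U"

definition diagonally_connected ::
  "('a \<Rightarrow> vspace) \<Rightarrow> 'a set \<Rightarrow> ('b \<Rightarrow> vspace) \<Rightarrow> 'b set \<Rightarrow> bool" where
  "diagonally_connected f I g J \<longleftrightarrow>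
     (\<exists>\<sigma>. bij_betw \<sigma> I J \<and> (\<forall>x\<in>I. \<exists>c. c \<noteq> 0 \<and> g (\<sigma> x) = vscale c (f x)))"

end

theory Submission
  imports Defs
begin

text \<open>
  The color \<open>\<gamma>\<^bsub>rs\<^esub>\<close> is \<open>\<epsilon>\<^sub>r - \<epsilon>\<^bsub>s+1\<^esub>\<close>, and in the boson-fermion correspondence
  \<open>x\<^bsub>rs\<^esub>(z)\<close> is a product of two fermions, one for the letter \<open>r\<close> and one for the letter \<open>s + 1\<close>.
  Because \<open>r \<le> m < s + 1\<close>, all these fermions anticommute, so \<open>x(\<pi>)v\<^sub>i\<close> is an ordinary antisymmetric
  expression.  The proof keeps this picture but stays on the bosonic side.

  Up to a cocycle factor, the operator \<open>x\<^sub>\<gamma>(-n)\<close> acts on \<open>f \<otimes> e\<^sup>\<kappa>\<close> by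
  \<open>\<Sum>\<^sub>b S\<^sub>\<gamma>(A + b) E\<^sub>b f\<close> with \<open>A = n - 1 - \<langle>\<gamma>, \<kappa>\<rangle>\<close> (lemma \<open>x_op_single\<close>), where \<open>S\<^sub>\<gamma>\<close> are the
  coefficients of \<open>E\<^sup>-(-\<gamma>, z)\<close> and \<open>E\<^sub>b\<close> lowers the degree by \<open>b\<close>, with \<open>E\<^sub>0\<close> the identity.  Since
  \<open>\<langle>\<gamma>, \<gamma>'\<rangle> \<ge> 0\<close> for colors, exchanging two of them produces the polynomial \<open>(z - w)\<^sup>c\<close>; its sign is
  cancelled by the cocycle, and the operators commute.  The factors of a monomial may therefore be
  applied in the order of a list whose head is its largest factor.  The initial conditions are the
  difference conditions relative to a virtual factor \<open>(i, i, 0)\<close>, and a monomial satisfies all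
  conditions iff consecutive entries of the list are related by \<open>precedes\<close>.

  For linear independence, a substitution of power sums for the \<open>\<alpha>\<^sub>k(-n)\<close>, into polynomials in
  complete symmetric functions \<open>h\<^bsub>c,n\<^esub>\<close>, one alphabet for each letter \<open>c\<close>, turns the coefficient
  \<open>S\<^bsub>rs\<^esub>(n)\<close> for \<open>\<gamma>\<^bsub>rs\<^esub>\<close> into
  \<open>\<Sum>\<^bsub>p+q=n\<^esub> h\<^bsub>r,p\<^esub> h\<^bsub>s+1,q\<^esub>\<close> (lemma \<open>insertion_schur\<close>).  Split the degree of each factor of an
  admissible list into a minimal height for the letter \<open>r\<close> and the remaining height for \<open>s + 1\<close>.  These
  heights determine a monomial in the \<open>h\<^bsub>c,p\<^esub>\<close>.  Looking at the outermost factor only, one sees that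
  this monomial occurs in the vector of another list with the same letters only if that list is
  lexicographically smaller (lemma \<open>leading_coefficient_triangular\<close>).  Hence the vectors of admissible
  lists of a given weight are independent (lemma \<open>list_poly_independent\<close>).

  The rest is a count.  A homogeneous part of the Fock ring has one basis vector for
  every \<open>l\<close>-tuple of partitions.  When every letter occurs at least \<open>d\<close> times, every \<open>(l+1)\<close>-tuple of
  partitions of total size \<open>d\<close> comes from an admissible list together with one partition, which
  measures by how much the heights of the letters \<open>r\<close> exceed the minimal ones (lemma \<open>ex_excited_monomial\<close>).  So the number
  of admissible lists, convolved with the number of partitions, is at least the number of
  \<open>l\<close>-tuples convolved with the number of partitions; by independence no term of the first sum exceeds
  the corresponding term of the second, so they agree (lemma \<open>card_admissible_lists\<close>).  Applying \<open>e\<^sup>n\<close>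
  with \<open>n\<close> very negative makes all letters frequent.

  For different values of \<open>n\<close>, the bases are compared one step at a time.  The vector
  \<open>e v\<^sub>i\<close> is proportional to \<open>x(\<pi>\<^sub>0)v\<^sub>i\<close> for an admissible
  \<open>\<pi>\<^sub>0\<close>, and \<open>e x\<^sub>\<gamma>(-n)\<close> is proportional to \<open>x\<^sub>\<gamma>(-n-l-1) e\<close>.  Raising all degrees of \<open>\<pi>\<close> by \<open>l + 1\<close> and
  appending \<open>\<pi>\<^sub>0\<close> gives an admissible monomial for \<open>n - 1\<close> with a proportional vector.
\<close>

section \<open>Scalars in the Fock ring\<close>

type_synonym exponent = "(nat \<times> nat) \<Rightarrow>\<^sub>0 nat"
type_synonym particle = "nat \<times> nat \<times> nat"

abbreviation "single \<equiv> Poly_Mapping.single"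
abbreviation "lookup \<equiv> Poly_Mapping.lookup"
abbreviation "keys \<equiv> Poly_Mapping.keys"

text \<open>
  Additive statements about polynomials need only be checked on monomials.
\<close>

lemma poly_mapping_additive_induct [case_names single add]:
  fixes p :: "'a \<Rightarrow>\<^sub>0 'b::comm_monoid_add"
  assumes "\<And>u c. P (single u c)" and "\<And>p q. P p \<Longrightarrow> P q \<Longrightarrow> P (p + q)"
  shows "P p"
proof (induction p rule: update_induct)
  case const
  have "P (single undefined 0)" by (rule assms)
  then show ?case by simp
next
  case (update f a b)
  have "Poly_Mapping.update a b f = f + single a b"
    using update by (intro poly_mapping_eqI) (auto simp: lookup_add lookup_update lookup_single when_def in_keys_iff)
  then show ?case using assms update by simp
qed

definition cst :: "complex \<Rightarrow> fock" where "cst c = single 0 c"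

lemma cst_simps [simp]:
  "cst 0 = 0" "cst 1 = 1" "cst (of_nat n) = of_nat n" "cst (- a) = - cst a"
  "cst a * cst b = cst (a * b)" "cst a + cst b = cst (a + b)"
  by (simp_all add: cst_def mult_single single_add single_uminus)

lemma cst_sum: "(\<Sum>x\<in>X. cst (g x)) = cst (sum g X)"
  by (induction X rule: infinite_finite_induct) simp_all

lemma cst_mult_left: "cst a * (cst b * f) = cst (a * b) * f"
  by (simp flip: mult.assoc)

lemma lookup_cst_mult [simp]: "lookup (cst c * f) u = c * lookup f u"
  unfolding cst_def mult_map_scale_conv_mult[symmetric]
  by (simp add: Poly_Mapping.map.rep_eq when_def)

lemma cst_mult_eq_0_iff: "cst c * f = 0 \<longleftrightarrow> c = 0 \<or> f = 0"
proof -
  have "f = 0" if "c \<noteq> 0" "cst c * f = 0"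
  proof -
    have "cst (1 / c) * (cst c * f) = 0" using that by simp
    then show ?thesis using that(1) by (simp only: cst_mult_left) simp
  qed
  then show ?thesis by auto
qed

text \<open>
  The coefficients of an exponential series are determined by recursions of the form
  \<open>a X\<^sub>a = \<dots>\<close>; this division makes them usable.
\<close>

lemma of_nat_fock_cancel:
  fixes x y :: fock
  assumes "of_nat a * x = of_nat a * y" "a > 0"
  shows "x = y"
proof -
  have "cst (1 / of_nat a) * (cst (of_nat a) * x) = cst (1 / of_nat a) * (cst (of_nat a) * y)"
    using assms by simp
  then show ?thesis using assms(2) by (simp only: cst_mult_left) simp
qed

lemma vscale_single: "vscale c (single \<kappa> f) = single \<kappa> (cst c * f)"
  by (simp add: vscale_def mult_single cst_def)

lemma emult_single: "emult \<kappa> (single \<nu> f) = single (\<kappa> + \<nu>) f"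
  by (simp add: emult_def mult_single)

lemma single_sum: "single \<kappa> (\<Sum>x\<in>X. f x) = (\<Sum>x\<in>X. single \<kappa> (f x))"
  by (induction X rule: infinite_finite_induct) (simp_all add: single_add)

section \<open>Creation polynomials and annihilation derivations\<close>

lemma fderiv_superset:
  assumes "finite A" "keys p \<subseteq> A"
  shows "fderiv x p = (\<Sum>u\<in>A. single (u - single x 1) (of_nat (lookup u x) * lookup p u))"
  unfolding fderiv_def using assms by (intro sum.mono_neutral_left) (auto simp: in_keys_iff)

lemma fderiv_single: "fderiv x (single u c) = single (u - single x 1) (of_nat (lookup u x) * c)"
  by (subst fderiv_superset[of "{u}"]) (auto simp: lookup_single)

lemma fderiv_0 [simp]: "fderiv x 0 = 0"
  by (simp add: fderiv_def)

lemma fderiv_add: "fderiv x (p + q) = fderiv x p + fderiv x q"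
proof -
  have "finite (keys p \<union> keys q)" by simp
  note * = fderiv_superset[OF this, of _ x]
  show ?thesis
    by (subst (1 2 3) *)
       (use keys_add[of p q] in \<open>auto simp: lookup_add ring_distribs single_add sum.distrib\<close>)
qed

lemma fderiv_sum: "fderiv x (sum f X) = (\<Sum>i\<in>X. fderiv x (f i))"
  by (induction X rule: infinite_finite_induct) (simp_all add: fderiv_add)

lemma fderiv_mult: "fderiv x (p * q) = fderiv x p * q + p * fderiv x q"
proof (induction p rule: poly_mapping_additive_induct)
  case (single u c)
  show ?case
  proof (induction q rule: poly_mapping_additive_induct)
    case (single v d)
    have "single (u + v - single x 1) (of_nat (lookup u x) * (c * d)) =
          single (u - single x 1 + v) (of_nat (lookup u x) * (c * d))" for u v :: "exponent"
    proof (cases "lookup u x = 0")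
      case False
      then have "u + v - single x 1 = u - single x 1 + v"
        by (intro poly_mapping_eqI) (auto simp: lookup_add lookup_minus lookup_single when_def)
      then show ?thesis by simp
    qed simp
    from this[of u v] this[of v u] show ?case
      by (simp add: fderiv_single mult_single lookup_add ring_distribs single_add add.commute mult_ac)
  qed (simp add: fderiv_add ring_distribs)
qed (simp add: fderiv_add ring_distribs)

lemma fderiv_commute: "fderiv x (fderiv y p) = fderiv y (fderiv x p)"
proof (cases "x = y")
  case False
  show ?thesis
  proof (induction p rule: poly_mapping_additive_induct)
    case (single u c)
    have "u - single x 1 - single y 1 = u - single y 1 - single x 1"
      by (intro poly_mapping_eqI) (simp add: lookup_minus)
    then show ?case using False
      by (simp add: fderiv_single lookup_minus lookup_single mult_ac)
  qed (simp add: fderiv_add)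
qed simp

lemma fderiv_cst [simp]: "fderiv x (cst c) = 0"
  by (simp add: cst_def fderiv_single)

text \<open>
  The polynomial \<open>h(-k)\<close>.
\<close>

definition creation :: "nat \<Rightarrow> hvec \<Rightarrow> nat \<Rightarrow> fock" where
  "creation l h k = (\<Sum>i=1..l. single (single (i, k) 1) (tform h (fund_weight l i)))"

text \<open>
  The derivation \<open>h(k)\<close>, \<open>k > 0\<close>, at central charge \<open>1\<close>.
\<close>

definition annih :: "nat \<Rightarrow> hvec \<Rightarrow> nat \<Rightarrow> fock \<Rightarrow> fock" where
  "annih l h k f = (\<Sum>i=1..l. cst (of_nat k * tform h (simple_root i)) * fderiv (i, k) f)"

lemma annih_add: "annih l h k (f + g) = annih l h k f + annih l h k g"
  by (simp add: annih_def fderiv_add ring_distribs sum.distrib)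

lemma annih_0 [simp]: "annih l h k 0 = 0"
  by (simp add: annih_def)

lemma annih_sum: "annih l h k (sum f X) = (\<Sum>i\<in>X. annih l h k (f i))"
  by (induction X rule: infinite_finite_induct) (simp_all add: annih_add)

lemma annih_mult: "annih l h k (f * g) = annih l h k f * g + f * annih l h k g"
  by (simp add: annih_def fderiv_mult ring_distribs sum.distrib sum_distrib_left sum_distrib_right mult_ac)

lemma annih_cst [simp]: "annih l h k (cst c) = 0"
  by (simp add: annih_def)

lemma annih_cst_mult: "annih l h k (cst c * f) = cst c * annih l h k f"
  by (simp add: annih_mult)

lemma annih_of_nat_mult: "annih l h k (of_nat n * f) = of_nat n * annih l h k f"
  using annih_cst_mult[of l h k "of_nat n" f] by simp

lemma annih_commute: "annih l h k (annih l h' k' f) = annih l h' k' (annih l h k f)"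
proof -
  have *: "annih l h k (annih l h' k' f) = (\<Sum>i=1..l. \<Sum>j=1..l.
     cst (of_nat k * tform h (simple_root i)) * (cst (of_nat k' * tform h' (simple_root j)) * fderiv (i, k) (fderiv (j, k') f)))"
    for h k h' k'
    by (simp add: annih_def fderiv_sum fderiv_mult sum_distrib_left)
  show ?thesis
    unfolding *[of h k h' k'] *[of h' k' h k]
    by (subst sum.swap) (simp add: fderiv_commute[of "(_, k)"] mult_ac)
qed

lemma heis_neg_single:
  assumes "k > 0"
  shows "heis l h (- int k) (single \<kappa> f) = single \<kappa> (creation l h k * f)"
  using assms by (simp add: heis_def creation_def mult_single)

lemma heis_pos_single:
  assumes "k > 0"
  shows "heis l h (int k) (single \<kappa> f) = single \<kappa> (annih l h k f)"
  using assms by (simp add: heis_def annih_def fscale_def cst_def map_single)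

section \<open>Exponentials of operator series\<close>

text \<open>
  Copies of \<^const>\<open>power_coeff\<close> and \<^const>\<open>exp_coeff\<close> acting on the Fock
  ring: the oscillators that occur in \<open>E\<^sup>\<plusminus>\<close> do not move the lattice
  component of a vector.
\<close>

fun exp_power :: "(nat \<Rightarrow> fock \<Rightarrow> fock) \<Rightarrow> nat \<Rightarrow> nat \<Rightarrow> fock \<Rightarrow> fock" where
  "exp_power B 0 a f = (if a = 0 then f else 0)"
| "exp_power B (Suc n) a f = (\<Sum>k=1..a. B k (exp_power B n (a - k) f))"

definition exp_series :: "(nat \<Rightarrow> fock \<Rightarrow> fock) \<Rightarrow> nat \<Rightarrow> fock \<Rightarrow> fock" where
  "exp_series B a f = (\<Sum>n\<le>a. cst (1 / fact n) * exp_power B n a f)"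

lemma exp_coeff_single:
  assumes "\<And>k f. k > 0 \<Longrightarrow> A k (single \<kappa> f) = single \<kappa> (B k f)"
  shows "exp_coeff A a (single \<kappa> f) = single \<kappa> (exp_series B a f)"
proof -
  have "power_coeff A n a (single \<kappa> f) = single \<kappa> (exp_power B n a f)" for n a
    by (induction n arbitrary: a) (simp_all add: assms single_sum)
  then show ?thesis
    by (simp add: exp_coeff_def exp_series_def single_sum vscale_single)
qed

lemma exp_power_eq_0: "(\<And>k. B k 0 = 0) \<Longrightarrow> a < n \<Longrightarrow> exp_power B n a f = 0"
  by (induction n arbitrary: a) (auto intro!: sum.neutral)

lemma exp_series_0 [simp]: "exp_series B 0 f = f"
  by (simp add: exp_series_def)

lemma sum_swap_triangle:
  fixes g :: "nat \<Rightarrow> nat \<Rightarrow> 'a::comm_monoid_add"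
  shows "(\<Sum>k=1..a. \<Sum>j=1..a-k. g k j) = (\<Sum>j=1..a. \<Sum>k=1..a-j. g k j)"
  unfolding sum.Sigma[OF finite_atLeastAtMost ballI[OF finite_atLeastAtMost]]
  by (rule sum.reindex_bij_witness[of _ "\<lambda>(j,k). (k,j)" "\<lambda>(j,k). (k,j)"]) auto

text \<open>
  The derivative of \<open>B(z)\<^sup>n\<^sup>+\<^sup>1\<close> is
  \<open>(n + 1) B'(z) B(z)\<^sup>n\<close>, as commutativity of the operators allows the differentiated
  factor to be moved to the front.
\<close>

lemma exp_power_rec:
  assumes add: "\<And>k f g. B k (f + g) = B k f + B k g"
    and scale: "\<And>k n f. B k (of_nat n * f) = of_nat n * B k f"
    and comm: "\<And>k j f. B k (B j f) = B j (B k f)"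
  shows "of_nat a * exp_power B (Suc n) a f = of_nat (Suc n) * (\<Sum>k=1..a. of_nat k * B k (exp_power B n (a - k) f))"
proof (induction n arbitrary: a)
  case 0
  have *: "(\<Sum>k=1..a. g k * B k (if a - k = 0 then f else 0)) = g a * (if a = 0 then 0 else B a f)"
    for g :: "nat \<Rightarrow> fock"
  proof -
    have "B k 0 = 0" for k using scale[of k 0 0] by simp
    then have "(\<Sum>k=1..a. g k * B k (if a - k = 0 then f else 0)) =
      (\<Sum>k\<in>{1..a}. if k = a then g k * B k f else 0)"
      by (intro sum.cong) auto
    then show ?thesis by auto
  qed
  show ?case using *[of "\<lambda>_. 1"] *[of of_nat] by simp
next
  case (Suc n)
  have B0: "B k 0 = 0" for k using scale[of k 0 0] by simp
  have Bsum: "B k (sum g X) = (\<Sum>x\<in>X. B k (g x))" for k g and X :: "nat set"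
    by (induction X rule: infinite_finite_induct) (simp_all add: add B0)
  have "of_nat a * exp_power B (Suc (Suc n)) a f = (\<Sum>k=1..a. of_nat k * B k (exp_power B (Suc n) (a - k) f) +
         B k (of_nat (a - k) * exp_power B (Suc n) (a - k) f))"
  proof -
    have "of_nat a * B k g = of_nat k * B k g + B k (of_nat (a - k) * g)" if "k \<in> {1..a}" for k g
    proof -
      have "(of_nat a :: fock) = of_nat k + of_nat (a - k)"
        using that by (simp flip: of_nat_add)
      then show ?thesis by (simp add: scale ring_distribs)
    qed
    then show ?thesis
      unfolding exp_power.simps(2)[of B "Suc n"] sum_distrib_left by (intro sum.cong refl)
  qed
  also have "\<dots> = (\<Sum>k=1..a. of_nat k * B k (exp_power B (Suc n) (a - k) f)) +
     (\<Sum>k=1..a. of_nat (Suc n) * (\<Sum>j=1..a - k. of_nat j * B k (B j (exp_power B n (a - k - j) f))))"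
    by (simp only: Suc.IH sum.distrib Bsum scale)
  also have "(\<Sum>k=1..a. of_nat (Suc n) * (\<Sum>j=1..a - k. of_nat j * B k (B j (exp_power B n (a - k - j) f))))
     = of_nat (Suc n) * (\<Sum>j=1..a. \<Sum>k=1..a - j. of_nat j * B j (B k (exp_power B n (a - j - k) f)))"
  proof -
    have "(\<Sum>k=1..a. \<Sum>j=1..a - k. of_nat j * B k (B j (exp_power B n (a - k - j) f)))
        = (\<Sum>j=1..a. \<Sum>k=1..a - j. of_nat j * B j (B k (exp_power B n (a - j - k) f)))"
      by (subst sum_swap_triangle) (intro sum.cong refl, subst comm, simp add: add.commute)
    then show ?thesis by (simp only: sum_distrib_left[symmetric])
  qed
  also have "\<dots> = of_nat (Suc n) * (\<Sum>j=1..a. of_nat j * B j (exp_power B (Suc n) (a - j) f))"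
    by (simp add: Bsum sum_distrib_left add.commute mult_ac)
  finally show ?case by (simp add: algebra_simps)
qed

text \<open>
  The differential equation \<open>z F'(z) = z B'(z) F(z)\<close> of \<open>F = exp B\<close>. It
  characterizes the exponential (lemma \<open>recursion_unique\<close>), and every later identity between
  exponentials is proved by checking this recursion instead of expanding the series.
\<close>

lemma exp_series_rec:
  assumes add: "\<And>k f g. B k (f + g) = B k f + B k g"
    and scale: "\<And>k c f. B k (cst c * f) = cst c * B k f"
    and comm: "\<And>k j f. B k (B j f) = B j (B k f)"
  shows "of_nat a * exp_series B a f = (\<Sum>k=1..a. of_nat k * B k (exp_series B (a - k) f))"
proof (cases a)
  case (Suc a')
  have scale': "B k (of_nat n * f) = of_nat n * B k f" for k n f
    using scale[of k "of_nat n" f] by simp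
  have B0: "B k 0 = 0" for k using scale[of k 0 0] by simp
  have Bsum: "B k (sum g X) = (\<Sum>x\<in>X. B k (g x))" for k g and X :: "nat set"
    by (induction X rule: infinite_finite_induct) (simp_all add: add B0)
  have "of_nat a * exp_series B a f = (\<Sum>n\<le>a'. cst (1 / fact (Suc n)) * (of_nat a * exp_power B (Suc n) a f))"
    unfolding exp_series_def Suc sum_distrib_left by (subst sum.atMost_Suc_shift) (simp add: mult_ac del: exp_power.simps(2))
  also have "\<dots> = (\<Sum>n\<le>a'. cst (1 / fact n) * (\<Sum>k=1..a. of_nat k * B k (exp_power B n (a - k) f)))"
  proof (intro sum.cong refl)
    fix n
    have "cst (1 / fact (Suc n)) * (of_nat (Suc n) * g) = cst (1 / fact n) * g" for g
    proof -
      have "of_nat (Suc n) * g = cst (of_nat (Suc n)) * g" by (simp only: cst_simps)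
      then show ?thesis by (simp only: cst_mult_left) (simp add: field_simps del: of_nat_Suc cst_simps)
    qed
    then show "cst (1 / fact (Suc n)) * (of_nat a * exp_power B (Suc n) a f) = cst (1 / fact n) * (\<Sum>k=1..a. of_nat k * B k (exp_power B n (a - k) f))"
      by (subst exp_power_rec[OF add scale' comm])
  qed
  also have "\<dots> = (\<Sum>k=1..a. of_nat k * B k (\<Sum>n\<le>a'. cst (1 / fact n) * exp_power B n (a - k) f))"
    unfolding sum_distrib_left Bsum by (subst sum.swap) (simp add: scale mult_ac)
  also have "\<dots> = (\<Sum>k=1..a. of_nat k * B k (exp_series B (a - k) f))"
  proof (intro sum.cong refl arg_cong2[where f = "(*)"] arg_cong2[where f = B])
    fix k assume "k \<in> {1..a}"
    then show "(\<Sum>n\<le>a'. cst (1 / fact n) * exp_power B n (a - k) f) = exp_series B (a - k) f"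
      unfolding exp_series_def using Suc B0 by (intro sum.mono_neutral_right) (auto simp: exp_power_eq_0)
  qed
  finally show ?thesis .
qed simp

text \<open>
  Both rearrangements sum over all triples with total \<open>a\<close> whose first entry is positive;
  they express the Leibniz rule for a convolution.
\<close>

lemma sum_convolution_left:
  fixes g :: "nat \<Rightarrow> nat \<Rightarrow> nat \<Rightarrow> 'a::comm_monoid_add"
  shows "(\<Sum>j\<le>a. \<Sum>k=1..j. g k (j - k) (a - j)) = (\<Sum>k=1..a. \<Sum>j\<le>a-k. g k j (a - k - j))"
  unfolding sum.Sigma[OF finite_atMost ballI[OF finite_atLeastAtMost]] sum.Sigma[OF finite_atLeastAtMost ballI[OF finite_atMost]]
  by (rule sum.reindex_bij_witness[of _ "\<lambda>(k,j). (j+k,k)" "\<lambda>(j,k). (k,j-k)"]) auto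

lemma sum_convolution_right:
  fixes g :: "nat \<Rightarrow> nat \<Rightarrow> nat \<Rightarrow> 'a::comm_monoid_add"
  shows "(\<Sum>j\<le>a. \<Sum>k=1..a-j. g k j (a - j - k)) = (\<Sum>k=1..a. \<Sum>j\<le>a-k. g k j (a - k - j))"
  unfolding sum.Sigma[OF finite_atMost ballI[OF finite_atLeastAtMost]] sum.Sigma[OF finite_atLeastAtMost ballI[OF finite_atMost]]
  by (rule sum.reindex_bij_witness[of _ "\<lambda>(k,j). (j,k)" "\<lambda>(j,k). (k,j)"]) (auto simp: add.commute)

lemma of_nat_mult_convolution:
  fixes F G :: "nat \<Rightarrow> fock"
  shows "of_nat a * (\<Sum>j\<le>a. F j * G (a - j)) =
    (\<Sum>j\<le>a. (of_nat j * F j) * G (a - j)) + (\<Sum>j\<le>a. F j * (of_nat (a - j) * G (a - j)))"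
  unfolding sum_distrib_left sum.distrib[symmetric]
proof (intro sum.cong refl)
  fix j assume "j \<in> {..a}"
  then have "(of_nat a :: fock) = of_nat j + of_nat (a - j)"
    by (simp flip: of_nat_add)
  then show "of_nat a * (F j * G (a - j)) = of_nat j * F j * G (a - j) + F j * (of_nat (a - j) * G (a - j))"
    by (simp only: ring_distribs mult_ac)
qed

lemma recursion_unique:
  fixes X Y :: "nat \<Rightarrow> fock"
  assumes "X 0 = Y 0"
    and "\<And>a. a > 0 \<Longrightarrow> of_nat a * X a = (\<Sum>k=1..a. T k (X (a - k)))"
    and "\<And>a. a > 0 \<Longrightarrow> of_nat a * Y a = (\<Sum>k=1..a. T k (Y (a - k)))"
  shows "X a = Y a"
proof (induction a rule: less_induct)
  case (less a)
  show ?case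
  proof (cases "a = 0")
    case False
    have "of_nat a * X a = of_nat a * Y a"
    proof -
      have "of_nat a * X a = (\<Sum>k=1..a. T k (X (a - k)))"
        using False by (intro assms(2)) simp
      also have "\<dots> = (\<Sum>k=1..a. T k (Y (a - k)))"
        using less False by (intro sum.cong) auto
      also have "\<dots> = of_nat a * Y a"
        using False by (intro assms(3)[symmetric]) simp
      finally show ?thesis .
    qed
    then show ?thesis using False of_nat_fock_cancel by blast
  qed (use assms(1) in simp)
qed


lemma tform_uminus: "tform (- x) y = - tform x y"
  by (simp add: tform_def sum_negf)

lemma creation_uminus: "creation l (- h) k = - creation l h k"
  by (simp add: creation_def tform_uminus single_uminus sum_negf)

lemma annih_uminus: "annih l (- h) k f = - annih l h k f"
  by (simp add: annih_def tform_uminus sum_negf)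

lemma annih_minus: "annih l \<gamma> k (- f) = - annih l \<gamma> k f"
  using annih_cst_mult[of l \<gamma> k "-1" f] by simp

text \<open>
  The coefficient of \<open>z\<^sup>n\<close> in
  \<open>E\<^sup>-(-\<gamma>, z) = exp (\<Sum>\<^sub>k \<gamma>(-k) z\<^sup>k / k)\<close>, an elementary
  Schur polynomial in the \<open>\<gamma>(-k)\<close>.
\<close>

definition schur :: "nat \<Rightarrow> hvec \<Rightarrow> nat \<Rightarrow> fock" where
  "schur l \<gamma> n = exp_series (\<lambda>k f. cst (1 / of_nat k) * (creation l \<gamma> k * f)) n 1"

text \<open>
  The coefficient of \<open>z\<^sup>-\<^sup>b\<close> in \<open>E\<^sup>+(-\<gamma>, z)\<close>.
\<close>

definition annih_exp :: "nat \<Rightarrow> hvec \<Rightarrow> nat \<Rightarrow> fock \<Rightarrow> fock" where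
  "annih_exp l \<gamma> = exp_series (\<lambda>k f. cst (- 1 / of_nat k) * annih l \<gamma> k f)"

lemma of_nat_cst_inverse: "k > 0 \<Longrightarrow> of_nat k * (cst (c / of_nat k) * f) = cst c * f"
  by (simp flip: cst_simps(3) add: cst_mult_left)

lemma schur_0 [simp]: "schur l \<gamma> 0 = 1"
  by (simp add: schur_def)

lemma exp_series_creation_rec:
  "of_nat a * exp_series (\<lambda>k f. cst (1 / of_nat k) * (creation l \<gamma> k * f)) a f
     = (\<Sum>k=1..a. creation l \<gamma> k * exp_series (\<lambda>k f. cst (1 / of_nat k) * (creation l \<gamma> k * f)) (a - k) f)"
proof (subst exp_series_rec)
  show "(\<Sum>k=1..a. of_nat k * (cst (1 / of_nat k) * (creation l \<gamma> k *
          exp_series (\<lambda>k f. cst (1 / of_nat k) * (creation l \<gamma> k * f)) (a - k) f))) =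
        (\<Sum>k=1..a. creation l \<gamma> k * exp_series (\<lambda>k f. cst (1 / of_nat k) * (creation l \<gamma> k * f)) (a - k) f)"
    by (intro sum.cong refl) (subst of_nat_cst_inverse; simp)
qed (simp_all only: ring_distribs mult_ac)

lemma schur_rec: "of_nat n * schur l \<gamma> n = (\<Sum>k=1..n. creation l \<gamma> k * schur l \<gamma> (n - k))"
  unfolding schur_def by (rule exp_series_creation_rec)

lemma exp_series_creation: "exp_series (\<lambda>k f. cst (1 / of_nat k) * (creation l \<gamma> k * f)) n f = schur l \<gamma> n * f"
proof (rule recursion_unique[where a = n and T = "\<lambda>k g. creation l \<gamma> k * g"])
  show "of_nat a * (schur l \<gamma> a * f) = (\<Sum>k=1..a. creation l \<gamma> k * (schur l \<gamma> (a - k) * f))" for a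
    unfolding mult.assoc[symmetric] sum_distrib_right[symmetric] by (simp only: schur_rec)
qed (simp_all only: exp_series_creation_rec exp_series_0 schur_0 mult_1)

lemma annih_exp_rec:
  "of_nat b * annih_exp l \<gamma> b f = (\<Sum>k=1..b. - annih l \<gamma> k (annih_exp l \<gamma> (b - k) f))"
  unfolding annih_exp_def
proof (subst exp_series_rec)
  show "(\<Sum>k=1..b. of_nat k * (cst (- 1 / of_nat k) * annih l \<gamma> k
          (exp_series (\<lambda>k f. cst (- 1 / of_nat k) * annih l \<gamma> k f) (b - k) f))) =
        (\<Sum>k=1..b. - annih l \<gamma> k (exp_series (\<lambda>k f. cst (- 1 / of_nat k) * annih l \<gamma> k f) (b - k) f))"
    by (intro sum.cong refl) (subst of_nat_cst_inverse; simp)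
qed (simp_all add: ring_distribs annih_add annih_cst_mult cst_mult_left annih_commute annih_minus mult.commute[where 'a = complex])

lemma annih_exp_0 [simp]: "annih_exp l \<gamma> 0 f = f"
  by (simp add: annih_exp_def)

lemma E_minus_single: "E_minus l (- \<gamma>) a (single \<kappa> f) = single \<kappa> (schur l \<gamma> a * f)"
  unfolding E_minus_def exp_series_creation[symmetric]
  by (rule exp_coeff_single) (simp add: heis_neg_single vscale_single creation_uminus)

lemma E_plus_single: "E_plus l (- \<gamma>) b (single \<kappa> f) = single \<kappa> (annih_exp l \<gamma> b f)"
  unfolding E_plus_def annih_exp_def
  by (rule exp_coeff_single) (simp add: heis_pos_single vscale_single annih_uminus)

lemma annih_exp_add: "annih_exp l \<gamma> b (f + g) = annih_exp l \<gamma> b f + annih_exp l \<gamma> b g"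
  by (rule recursion_unique[where a = b and T = "\<lambda>k g. - annih l \<gamma> k g"])
     (simp_all only: annih_exp_0 annih_exp_rec ring_distribs annih_add minus_add_distrib sum.distrib)

lemma annih_exp_zero [simp]: "annih_exp l \<gamma> b 0 = 0"
  using annih_exp_add[of l \<gamma> b 0 0] by simp

lemma annih_exp_sum: "annih_exp l \<gamma> b (sum f X) = (\<Sum>i\<in>X. annih_exp l \<gamma> b (f i))"
  by (induction X rule: infinite_finite_induct) (simp_all add: annih_exp_add)

lemma annih_exp_cst_mult: "annih_exp l \<gamma> b (cst c * f) = cst c * annih_exp l \<gamma> b f"
proof (rule recursion_unique[where a = b and T = "\<lambda>k g. - annih l \<gamma> k g"])
  fix a
  have "of_nat a * (cst c * annih_exp l \<gamma> a f) = cst c * (of_nat a * annih_exp l \<gamma> a f)"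
    by (simp only: mult_ac)
  then show "of_nat a * (cst c * annih_exp l \<gamma> a f) = (\<Sum>k=1..a. - annih l \<gamma> k (cst c * annih_exp l \<gamma> (a - k) f))"
    by (simp only: annih_exp_rec annih_cst_mult sum_distrib_left mult_minus_right)
qed (simp_all only: annih_exp_0 annih_exp_rec)

lemma annih_exp_uminus: "annih_exp l \<gamma> b (- f) = - annih_exp l \<gamma> b f"
  using annih_exp_cst_mult[of l \<gamma> b "-1" f] by simp

lemma annih_exp_of_nat_mult: "annih_exp l \<gamma> b (of_nat n * f) = of_nat n * annih_exp l \<gamma> b f"
  using annih_exp_cst_mult[of l \<gamma> b "of_nat n" f] by simp



lemma annih_annih_exp: "annih l h k (annih_exp l \<gamma> b f) = annih_exp l \<gamma> b (annih l h k f)"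
proof (rule recursion_unique[where a = b and T = "\<lambda>k g. - annih l \<gamma> k g"])
  fix a
  show "of_nat a * annih l h k (annih_exp l \<gamma> a f)
      = (\<Sum>j=1..a. - annih l \<gamma> j (annih l h k (annih_exp l \<gamma> (a - j) f)))"
    by (simp only: annih_of_nat_mult[symmetric] annih_exp_rec annih_sum annih_minus annih_commute[of l h k])
qed (simp_all only: annih_exp_0 annih_exp_rec)

lemma annih_exp_commute: "annih_exp l h b (annih_exp l h' b' f) = annih_exp l h' b' (annih_exp l h b f)"
proof (rule recursion_unique[where a = b and T = "\<lambda>k g. - annih l h k g"])
  fix a
  show "of_nat a * annih_exp l h' b' (annih_exp l h a f)
      = (\<Sum>k=1..a. - annih l h k (annih_exp l h' b' (annih_exp l h (a - k) f)))"
    by (simp only: annih_exp_of_nat_mult[of l h' b' a, symmetric] annih_exp_rec annih_exp_sum annih_exp_uminus annih_annih_exp)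
qed (simp_all only: annih_exp_0 annih_exp_rec)

text \<open>
  The exponential of a derivation is a ring homomorphism.
\<close>

lemma annih_exp_mult: "annih_exp l \<gamma> b (f * g) = (\<Sum>j\<le>b. annih_exp l \<gamma> j f * annih_exp l \<gamma> (b - j) g)"
proof (rule recursion_unique[where a = b and T = "\<lambda>k g. - annih l \<gamma> k g"])
  fix a :: nat
  let ?F = "\<lambda>j. annih_exp l \<gamma> j f" and ?G = "\<lambda>j. annih_exp l \<gamma> j g" and ?D = "annih l \<gamma>"
  have "of_nat a * (\<Sum>j\<le>a. ?F j * ?G (a - j)) =
        (\<Sum>j\<le>a. (of_nat j * ?F j) * ?G (a - j)) + (\<Sum>j\<le>a. ?F j * (of_nat (a - j) * ?G (a - j)))"
    by (rule of_nat_mult_convolution)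
  also have "(\<Sum>j\<le>a. (of_nat j * ?F j) * ?G (a - j)) = (\<Sum>j\<le>a. \<Sum>k=1..j. - (?D k (?F (j - k)) * ?G (a - j)))"
    unfolding annih_exp_rec by (simp add: sum_distrib_right sum_negf)
  also have "\<dots> = (\<Sum>k=1..a. \<Sum>j\<le>a-k. - (?D k (?F j) * ?G (a - k - j)))"
    by (rule sum_convolution_left)
  also have "(\<Sum>j\<le>a. ?F j * (of_nat (a - j) * ?G (a - j))) = (\<Sum>j\<le>a. \<Sum>k=1..a-j. - (?F j * ?D k (?G (a - j - k))))"
    unfolding annih_exp_rec by (simp add: sum_distrib_left sum_negf)
  also have "\<dots> = (\<Sum>k=1..a. \<Sum>j\<le>a-k. - (?F j * ?D k (?G (a - k - j))))"
    by (rule sum_convolution_right)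
  finally show "of_nat a * (\<Sum>j\<le>a. ?F j * ?G (a - j)) = (\<Sum>k=1..a. - ?D k (\<Sum>j\<le>a - k. ?F j * ?G (a - k - j)))"
    by (simp add: annih_sum annih_mult sum.distrib sum_negf sum_subtractf)
qed (simp_all only: annih_exp_0 annih_exp_rec atMost_0 sum.insert finite.emptyI sum.empty, simp)

section \<open>Moving annihilation exponentials past creation exponentials\<close>

text \<open>
  On colors this is the trace form; the expression is what the derivation \<open>h(k)\<close> applied to
  the polynomial \<open>h'(-k)\<close> yields.
\<close>

definition pairing :: "nat \<Rightarrow> hvec \<Rightarrow> hvec \<Rightarrow> complex" where
  "pairing l h h' = (\<Sum>i=1..l. tform h (simple_root i) * tform h' (fund_weight l i))"

lemma annih_creation:
  "annih l h k (creation l h' j) = (if j = k then cst (of_nat k * pairing l h h') else 0)"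
proof -
  have *: "fderiv (i, k) (creation l h' j) = (if j = k then cst (tform h' (fund_weight l i)) else 0)"
    if "i \<in> {1..l}" for i
  proof -
    have "fderiv (i, k) (single (single (i', j) 1) c) = (if j = k \<and> i' = i then cst c else 0)" for i' c
      by (auto simp: fderiv_single lookup_single cst_def when_def)
    then show ?thesis
      using that by (simp add: creation_def fderiv_sum del: fderiv_single)
  qed
  have "annih l h k (creation l h' j) =
     (\<Sum>i=1..l. cst (of_nat k * tform h (simple_root i)) * (if j = k then cst (tform h' (fund_weight l i)) else 0))"
    unfolding annih_def by (intro sum.cong refl) (simp add: *)
  then show ?thesis
    by (auto simp: pairing_def sum_distrib_left mult_ac cst_sum)
qed

text \<open>
  Integer indices keep shifts such as \<open>n - k\<close> free of truncation.
\<close>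

definition schurz :: "nat \<Rightarrow> hvec \<Rightarrow> int \<Rightarrow> fock" where
  "schurz l \<gamma> n = (if n < 0 then 0 else schur l \<gamma> (nat n))"

text \<open>
  \<open>h(k)\<close> multiplies \<open>exp (\<Sum>\<^sub>k \<gamma>(-k) z\<^sup>k / k)\<close> by
  \<open>\<langle>h, \<gamma>\<rangle> z\<^sup>k\<close>, since it does so to the exponent.
\<close>

lemma annih_schur:
  assumes "k > 0"
  shows "annih l h k (schur l \<gamma> n) = cst (pairing l h \<gamma>) * schurz l \<gamma> (int n - int k)"
proof (induction n rule: less_induct)
  case (less n)
  let ?c = "pairing l h \<gamma>"
  show ?case
  proof (cases "n = 0")
    case True
    then show ?thesis using assms annih_cst[of l h k 1] by (simp add: schurz_def del: annih_cst)
  next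
    case False
    have "of_nat n * annih l h k (schur l \<gamma> n) =
        (\<Sum>j=1..n. annih l h k (creation l \<gamma> j) * schur l \<gamma> (n - j) + creation l \<gamma> j * annih l h k (schur l \<gamma> (n - j)))"
      by (simp only: annih_of_nat_mult[symmetric] schur_rec annih_sum annih_mult)
    also have "\<dots> = (\<Sum>j=1..n. (if j = k then cst (of_nat k * ?c) * schur l \<gamma> (n - k) else 0))
        + (\<Sum>j=1..n. creation l \<gamma> j * (cst ?c * schurz l \<gamma> (int (n - j) - int k)))"
      unfolding sum.distrib[symmetric]
      by (intro sum.cong refl arg_cong2[where f = "(+)"] arg_cong2[where f = "(*)"])
         (simp_all add: annih_creation less.IH)
    also have "(\<Sum>j=1..n. creation l \<gamma> j * (cst ?c * schurz l \<gamma> (int (n - j) - int k)))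
        = cst ?c * (if k \<le> n then of_nat (n - k) * schur l \<gamma> (n - k) else 0)"
    proof (cases "k \<le> n")
      case True
      have *: "nat (int (n - j) - int k) = n - k - j" for j
        by linarith
      have "(\<Sum>j=1..n. creation l \<gamma> j * (cst ?c * schurz l \<gamma> (int (n - j) - int k))) =
            (\<Sum>j=1..n-k. creation l \<gamma> j * (cst ?c * schur l \<gamma> (n - k - j)))"
        using True by (intro sum.mono_neutral_cong_right)
           (auto simp: schurz_def * simp del: of_nat_diff)
      then show ?thesis using True by (simp only: schur_rec sum_distrib_left mult_ac if_True)
    qed (auto simp: schurz_def intro!: sum.neutral)
    also have "(\<Sum>j=1..n. (if j = k then cst (of_nat k * ?c) * schur l \<gamma> (n - k) else 0))
        = cst ?c * (if k \<le> n then of_nat k * schur l \<gamma> (n - k) else 0)"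
      using assms by (auto simp: cst_mult_left mult_ac simp flip: cst_simps(3))
    also have "cst ?c * (if k \<le> n then of_nat k * schur l \<gamma> (n - k) else 0) +
               cst ?c * (if k \<le> n then of_nat (n - k) * schur l \<gamma> (n - k) else 0) =
               of_nat n * (cst ?c * schurz l \<gamma> (int n - int k))"
      by (auto simp: schurz_def of_nat_diff algebra_simps nat_diff_distrib')
    finally show ?thesis using False of_nat_fock_cancel by blast
  qed
qed

lemma annih_schurz:
  assumes "k > 0"
  shows "annih l h k (schurz l \<gamma> n) = cst (pairing l h \<gamma>) * schurz l \<gamma> (n - int k)"
  using assms annih_schur[OF assms, of l h \<gamma> "nat n"] by (auto simp: schurz_def)

text \<open>
  The differential equation of \<open>(1 - x)\<^sup>c\<close>.
\<close>

lemma alternating_binomial_rec: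
  "of_nat b * ((-1) ^ b * of_nat (c choose b)) = - (of_nat c * (\<Sum>k=1..b. (-1) ^ (b - k) * of_nat (c choose (b - k))) :: complex)"
proof -
  have *: "of_nat b * ((-1) ^ b * of_nat (c choose b)) = - (of_nat c * (\<Sum>j<b. (-1) ^ j * of_nat (c choose j)) :: complex)"
  proof (induction b)
    case (Suc b)
    have "Suc b * (c choose Suc b) + b * (c choose b) = c * (c choose b)"
    proof (cases c)
      case (Suc c')
      then show ?thesis
        using Suc_times_binomial[of b c'] binomial_absorb_comp[of c b]
          distrib_right[of "c - b" b "c choose b"]
        by (cases "b \<le> c") (auto simp: binomial_eq_0 simp del: binomial_Suc_Suc)
    qed (cases b; simp)
    then have "of_nat (Suc b) * of_nat (c choose Suc b) + of_nat b * of_nat (c choose b) = (of_nat c * of_nat (c choose b) :: complex)"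
      by (metis of_nat_add of_nat_mult)
    then have *: "of_nat (Suc b) * of_nat (c choose Suc b) = (of_nat c * of_nat (c choose b) - of_nat b * of_nat (c choose b) :: complex)"
      by (simp only: eq_diff_eq)
    have "of_nat (Suc b) * ((-1) ^ Suc b * of_nat (c choose Suc b)) =
       - ((-1) ^ b * (of_nat (Suc b) * of_nat (c choose Suc b)) :: complex)"
      by (simp only: power_Suc mult_minus_left mult_minus_right mult_1 mult_ac)
    also have "\<dots> = of_nat b * ((-1) ^ b * of_nat (c choose b)) - of_nat c * ((-1) ^ b * of_nat (c choose b))"
      unfolding * by (simp add: right_diff_distrib mult.left_commute)
    finally have "of_nat (Suc b) * ((-1) ^ Suc b * of_nat (c choose Suc b)) =
       of_nat b * ((-1) ^ b * of_nat (c choose b)) - of_nat c * ((-1) ^ b * of_nat (c choose b) :: complex)" .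
    then show ?case unfolding Suc.IH by (simp add: algebra_simps)
  qed simp
  have "(\<Sum>k=1..b. (-1) ^ (b - k) * of_nat (c choose (b - k))) = (\<Sum>j<b. (-1) ^ j * of_nat (c choose j) :: complex)"
    by (rule sum.reindex_bij_witness[of _ "\<lambda>j. b - j" "\<lambda>k. b - k"]) auto
  with * show ?thesis by simp
qed

text \<open>
  The exchange relation
  \<open>E\<^sup>+(-h, z) E\<^sup>-(-\<gamma>, w) = (1 - w/z)\<^sup>c E\<^sup>-(-\<gamma>, w) E\<^sup>+(-h, z)\<close>,
  read off at the factor \<open>E\<^sup>-\<close>.
\<close>

lemma annih_exp_schurz:
  assumes "pairing l h \<gamma> = of_nat c"
  shows "annih_exp l h b (schurz l \<gamma> n) = cst ((-1) ^ b * of_nat (c choose b)) * schurz l \<gamma> (n - int b)"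
proof (rule recursion_unique[where a = b and T = "\<lambda>k g. - annih l h k g"])
  fix a :: nat assume "a > 0"
  let ?d = "\<lambda>j. (-1) ^ j * of_nat (c choose j) :: complex"
  have "- annih l h k (cst (?d (a - k)) * schurz l \<gamma> (n - int (a - k))) = cst (- (of_nat c * ?d (a - k))) * schurz l \<gamma> (n - int a)"
    if "k \<in> {1..a}" for k
  proof -
    have "annih l h k (schurz l \<gamma> (n - int (a - k))) = cst (of_nat c) * schurz l \<gamma> (n - int a)"
      using that by (subst annih_schurz) (auto simp: assms of_nat_diff)
    then show ?thesis
      by (simp only: annih_cst_mult cst_mult_left cst_simps(4) mult_minus_left mult.commute[where 'a = complex])
  qed
  then have "(\<Sum>k=1..a. - annih l h k (cst (?d (a - k)) * schurz l \<gamma> (n - int (a - k)))) =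
     (\<Sum>k=1..a. cst (- (of_nat c * ?d (a - k))) * schurz l \<gamma> (n - int a))"
    by (intro sum.cong) auto
  also have "\<dots> = cst (- (of_nat c * (\<Sum>k=1..a. ?d (a - k)))) * schurz l \<gamma> (n - int a)"
    unfolding sum_distrib_right[symmetric]
    by (simp add: cst_sum sum_distrib_left sum_negf del: cst_simps(4))
  also have "\<dots> = of_nat a * (cst (?d a) * schurz l \<gamma> (n - int a))"
    unfolding alternating_binomial_rec[symmetric]
    by (simp only: cst_mult_left flip: cst_simps(3))
  finally show "of_nat a * (cst (?d a) * schurz l \<gamma> (n - int a)) =
     (\<Sum>k=1..a. - annih l h k (cst (?d (a - k)) * schurz l \<gamma> (n - int (a - k))))" by simp
qed (simp_all only: annih_exp_0 annih_exp_rec, simp)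


section \<open>The grading of the Fock ring\<close>

definition weight :: "exponent \<Rightarrow> nat" where
  "weight u = (\<Sum>x\<in>keys u. lookup u x * snd x)"

lemma weight_superset: "finite A \<Longrightarrow> keys u \<subseteq> A \<Longrightarrow> weight u = (\<Sum>x\<in>A. lookup u x * snd x)"
  unfolding weight_def by (intro sum.mono_neutral_left) (auto simp: in_keys_iff)

lemma weight_add: "weight (u + v) = weight u + weight v"
proof -
  have "finite (keys u \<union> keys v)" by simp
  note * = weight_superset[OF this]
  show ?thesis
    by (subst (1 2 3) *) (use keys_add[of u v] in \<open>auto simp: lookup_add ring_distribs sum.distrib\<close>)
qed

lemma weight_0 [simp]: "weight 0 = 0"
  by (simp add: weight_def)

lemma weight_single [simp]: "weight (single x c) = c * snd x"
  by (subst weight_superset[of "{x}"]) (auto simp: lookup_single)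

text \<open>
  The degree is an integer, so that lowering it needs no case distinction: the parts of negative degree
  are zero.
\<close>

definition homog :: "nat \<Rightarrow> int \<Rightarrow> fock set" where
  "homog l d = {f \<in> fock_module l. \<forall>u\<in>keys f. int (weight u) = d}"

lemma homog_iff: "f \<in> homog l d \<longleftrightarrow> (\<forall>u\<in>keys f. keys u \<subseteq> {1..l} \<times> {1..} \<and> int (weight u) = d)"
  by (auto simp: homog_def fock_module_def)

lemma homog_0 [simp]: "0 \<in> homog l d"
  by (simp add: homog_iff)

lemma homog_add: "f \<in> homog l d \<Longrightarrow> g \<in> homog l d \<Longrightarrow> f + g \<in> homog l d"
  using keys_add[of f g] by (auto simp: homog_iff)

lemma homog_sum: "(\<And>x. x \<in> X \<Longrightarrow> f x \<in> homog l d) \<Longrightarrow> sum f X \<in> homog l d"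
  by (induction X rule: infinite_finite_induct) (auto intro: homog_add)

lemma homog_cst_mult: "f \<in> homog l d \<Longrightarrow> cst c * f \<in> homog l d"
  by (auto simp: homog_iff in_keys_iff)

lemma homog_uminus: "f \<in> homog l d \<Longrightarrow> - f \<in> homog l d"
  using homog_cst_mult[of f l d "-1"] by simp

lemma homog_mult:
  assumes "f \<in> homog l d" "g \<in> homog l e"
  shows "f * g \<in> homog l (d + e)"
  unfolding homog_iff
proof
  fix w assume "w \<in> keys (f * g)"
  then obtain u v where "w = u + v" "u \<in> keys f" "v \<in> keys g"
    using keys_mult[of f g] by blast
  then show "keys w \<subseteq> {1..l} \<times> {1..} \<and> int (weight w) = d + e"
    using assms keys_add[of u v] by (fastforce simp: homog_iff weight_add)
qed

lemma homog_neg: "f \<in> homog l d \<Longrightarrow> d < 0 \<Longrightarrow> f = 0"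
  by (metis homog_iff keys_eq_empty ex_in_conv not_less of_nat_0_le_iff)

lemma homog_of_nat_mult_cancel:
  assumes "of_nat n * f \<in> homog l d" "n > 0"
  shows "f \<in> homog l d"
proof -
  have "f = cst (1 / of_nat n) * (cst (of_nat n) * f)"
    using assms(2) by (simp only: cst_mult_left) simp
  then show ?thesis using assms(1) homog_cst_mult by (metis cst_simps(3))
qed

lemma homog_one: "1 \<in> homog l 0"
  by (simp add: homog_iff)

lemma homog_creation: "k > 0 \<Longrightarrow> creation l h k \<in> homog l (int k)"
  unfolding creation_def by (rule homog_sum) (auto simp: homog_iff)

lemma homog_schur: "schur l \<gamma> n \<in> homog l (int n)"
proof (induction n rule: less_induct)
  case (less n)
  show ?case
  proof (cases "n = 0")
    case False
    have "of_nat n * schur l \<gamma> n \<in> homog l (int n)"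
      unfolding schur_rec
    proof (rule homog_sum)
      fix k assume "k \<in> {1..n}"
      then have "creation l \<gamma> k * schur l \<gamma> (n - k) \<in> homog l (int k + int (n - k))"
        by (intro homog_mult homog_creation less.IH) (use \<open>k \<in> {1..n}\<close> in auto)
      then show "creation l \<gamma> k * schur l \<gamma> (n - k) \<in> homog l (int n)"
        using \<open>k \<in> {1..n}\<close> by simp
    qed
    then show ?thesis using False homog_of_nat_mult_cancel by blast
  qed (simp add: homog_one)
qed

lemma homog_schurz: "schurz l \<gamma> n \<in> homog l n"
  using homog_schur[of l \<gamma> "nat n"] by (auto simp: schurz_def)

lemma homog_fderiv:
  assumes "f \<in> homog l d"
  shows "fderiv (i, k) f \<in> homog l (d - int k)"
  unfolding fderiv_def
proof (rule homog_sum)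
  fix u assume u: "u \<in> keys f"
  show "single (u - single (i, k) 1) (of_nat (lookup u (i, k)) * lookup f u) \<in> homog l (d - int k)"
  proof (cases "lookup u (i, k) = 0")
    case False
    have "u = (u - single (i, k) 1) + single (i, k) 1"
      using False by (intro poly_mapping_eqI) (auto simp: lookup_add lookup_minus lookup_single when_def)
    then have "weight u = weight (u - single (i, k) 1) + k"
      by (metis weight_add weight_single mult_1 snd_conv)
    moreover have "keys (u - single (i, k) 1) \<subseteq> keys u"
      by (auto simp: in_keys_iff lookup_minus)
    ultimately show ?thesis using assms u by (auto simp: homog_iff)
  qed simp
qed

lemma homog_annih: "f \<in> homog l d \<Longrightarrow> annih l h k f \<in> homog l (d - int k)"
  unfolding annih_def by (intro homog_sum homog_cst_mult homog_fderiv)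

lemma homog_annih_exp:
  assumes "f \<in> homog l d"
  shows "annih_exp l \<gamma> b f \<in> homog l (d - int b)"
proof (induction b rule: less_induct)
  case (less b)
  show ?case
  proof (cases "b = 0")
    case False
    have "of_nat b * annih_exp l \<gamma> b f \<in> homog l (d - int b)"
      unfolding annih_exp_rec
    proof (intro homog_sum homog_uminus)
      fix k assume "k \<in> {1..b}"
      then have "annih l \<gamma> k (annih_exp l \<gamma> (b - k) f) \<in> homog l (d - int (b - k) - int k)"
        by (intro homog_annih less.IH) (use \<open>k \<in> {1..b}\<close> in auto)
      then show "annih l \<gamma> k (annih_exp l \<gamma> (b - k) f) \<in> homog l (d - int b)"
        using \<open>k \<in> {1..b}\<close> by (simp add: of_nat_diff algebra_simps)
    qed
    then show ?thesis using False homog_of_nat_mult_cancel by blast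
  qed (use assms in simp)
qed

lemma annih_exp_eq_0:
  assumes "f \<in> homog l d" "int b > d"
  shows "annih_exp l \<gamma> b f = 0"
  using homog_neg[OF homog_annih_exp[OF assms(1)]] assms(2) by auto

section \<open>Coefficients of vertex operators and their commutation\<close>

text \<open>
  The part of \<open>Y(e\<^sup>\<gamma>, z)\<close> acting on the Fock ring. The index \<open>A\<close>
  is the amount by which the degree rises; \<open>N\<close> cuts off a sum whose terms vanish beyond the
  degree of \<open>f\<close> (lemma \<open>vertex_bound\<close>).
\<close>

definition vertex :: "nat \<Rightarrow> hvec \<Rightarrow> nat \<Rightarrow> int \<Rightarrow> fock \<Rightarrow> fock" where
  "vertex l \<gamma> N A f = (\<Sum>b\<le>N. schurz l \<gamma> (A + int b) * annih_exp l \<gamma> b f)"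

lemma homog_vertex: "f \<in> homog l d \<Longrightarrow> vertex l \<gamma> N A f \<in> homog l (d + A)"
  unfolding vertex_def
proof (rule homog_sum)
  fix b assume "f \<in> homog l d"
  then have "schurz l \<gamma> (A + int b) * annih_exp l \<gamma> b f \<in> homog l ((A + int b) + (d - int b))"
    by (intro homog_mult homog_schurz homog_annih_exp)
  then show "schurz l \<gamma> (A + int b) * annih_exp l \<gamma> b f \<in> homog l (d + A)"
    by (simp add: algebra_simps)
qed

lemma vertex_bound:
  assumes "f \<in> homog l d" "d \<le> int N" "d \<le> int N'"
  shows "vertex l \<gamma> N A f = vertex l \<gamma> N' A f"
proof -
  have *: "vertex l \<gamma> N A f = vertex l \<gamma> (nat d) A f" if "d \<le> int N" for N
  proof -
    have "annih_exp l \<gamma> i f = 0" if "\<not> i \<le> nat d" for i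
      using that by (intro annih_exp_eq_0[OF assms(1)]) linarith
    then show ?thesis
      unfolding vertex_def using that by (intro sum.mono_neutral_right) (auto simp: nat_le_iff)
  qed
  show ?thesis using *[OF assms(2)] *[OF assms(3)] by simp
qed

lemma vertex_cst_mult: "vertex l \<gamma> N A (cst c * f) = cst c * vertex l \<gamma> N A f"
  by (simp add: vertex_def annih_exp_cst_mult sum_distrib_left mult.left_commute[of _ "cst c"])

lemma vertex_0 [simp]: "vertex l \<gamma> N A 0 = 0"
  by (simp add: vertex_def)

text \<open>
  On \<open>f \<otimes> e\<^sup>\<kappa>\<close> the factor \<open>z\<^sup>\<gamma>\<close> contributes
  \<open>z\<^bsup>\<langle>\<gamma>,\<kappa>\<rangle>\<^esup>\<close>, so the pair \<open>(a, b)\<close>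
  of indices is determined by \<open>b\<close>.
\<close>

lemma x_op_single:
  assumes "tform \<gamma> \<kappa> = of_int z" "f \<in> homog l d" "d \<le> int N"
  shows "x_op l \<epsilon> \<gamma> j (single \<kappa> f) =
     single (\<gamma> + \<kappa>) (cst (\<epsilon> \<gamma> \<kappa>) * vertex l \<gamma> N (- j - 1 - z) f)"
proof (cases "f = 0")
  case True
  then show ?thesis by (simp add: x_op_def Y_coeff_def)
next
  case False
  define q where "q = - j - 1"
  let ?g = "\<lambda>(a, b). if of_nat a - of_nat b + tform \<gamma> \<kappa> = of_int q
       then E_minus l (- \<gamma>) a (E_plus l (- \<gamma>) b (emult \<gamma> (vscale (\<epsilon> \<gamma> \<kappa>) (single \<kappa> f)))) else 0"
  have g: "?g (a, b) = (if int a = q - z + int b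
       then single (\<gamma> + \<kappa>) (cst (\<epsilon> \<gamma> \<kappa>) * (schur l \<gamma> a * annih_exp l \<gamma> b f)) else 0)" for a b
  proof -
    have "(of_nat a - of_nat b + tform \<gamma> \<kappa> = of_int q) \<longleftrightarrow> (of_int (int a - int b + z) = (of_int q :: complex))"
      by (simp add: assms(1))
    also have "\<dots> \<longleftrightarrow> int a = q - z + int b"
      unfolding of_int_eq_iff by auto
    finally show ?thesis
      by (simp add: vscale_single emult_single E_plus_single E_minus_single annih_exp_cst_mult
          mult.left_commute[of _ "cst (\<epsilon> \<gamma> \<kappa>)"])
  qed
  \<comment> \<open>Negative indices are truncated to \<open>0\<close> here; the corresponding terms vanish on both sides.\<close>
  let ?h = "\<lambda>b. (nat (q - z + int b), b)"
  have "?g (a, b) = 0" if "(a, b) \<notin> ?h ` {..N}" for a b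
  proof (cases "int a = q - z + int b")
    case True
    then have "(a, b) = ?h b" by auto
    then have "b > N" using that by auto
    then show ?thesis using annih_exp_eq_0[OF assms(2), of b \<gamma>] assms(3) unfolding g by simp
  qed (unfold g, simp)
  then have "{x. ?g x \<noteq> 0} \<subseteq> ?h ` {..N}" by fastforce
  then have s: "Sum_any ?g = sum ?g (?h ` {..N})"
    by (intro Sum_any.expand_superset) auto
  have "x_op l \<epsilon> \<gamma> j (single \<kappa> f) = Sum_any ?g"
    using False unfolding x_op_def Y_coeff_def q_def
    by (simp only: keys_single if_False sum.insert finite.emptyI empty_iff not_False_eq_True sum.empty
        add_0_right lookup_single_eq)
  also have "\<dots> = sum ?g (?h ` {..N})" by (rule s)
  also have "\<dots> = (\<Sum>b\<le>N. ?g (?h b))"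
    by (subst sum.reindex) (auto intro: inj_onI)
  also have "\<dots> = (\<Sum>b\<le>N. single (\<gamma> + \<kappa>) (cst (\<epsilon> \<gamma> \<kappa>) * (schurz l \<gamma> (q - z + int b) * annih_exp l \<gamma> b f)))"
    unfolding g by (intro sum.cong) (auto simp: schurz_def)
  finally show ?thesis
    by (simp add: q_def vertex_def single_sum sum_distrib_left)
qed

text \<open>
  Normal ordering: after \<open>E\<^sup>+\<close> has been moved to the right, the product of the two
  operators differs from the normally ordered one by \<open>(1 - w/z)\<^sup>c\<close>.
\<close>

lemma vertex_vertex:
  assumes p: "pairing l \<gamma> \<gamma>' = of_nat c" and f: "f \<in> homog l d" "d \<le> int N" "d + A' \<le> int M"
  shows "vertex l \<gamma> M A (vertex l \<gamma>' N A' f) =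
    (\<Sum>j\<le>c. cst ((-1) ^ j * of_nat (c choose j)) *
       (\<Sum>b\<le>N. \<Sum>b'\<le>N. schurz l \<gamma> (A + int j + int b) * (schurz l \<gamma>' (A' - int j + int b') *
          annih_exp l \<gamma> b (annih_exp l \<gamma>' b' f))))"
proof -
  define g where "g = (\<lambda>j b. schurz l \<gamma> (A + int j + int b) *
    (\<Sum>b'\<le>N. cst ((-1) ^ j * of_nat (c choose j)) * schurz l \<gamma>' (A' - int j + int b') * annih_exp l \<gamma> b (annih_exp l \<gamma>' b' f)))"
  have g0: "g j b = 0" if "j > c \<or> b > N" for j b
  proof -
    have "annih_exp l \<gamma> b (annih_exp l \<gamma>' b' f) = 0" if "b > N" for b'
      using that f by (intro annih_exp_eq_0[OF homog_annih_exp[OF f(1)]]) auto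
    then show ?thesis using that by (auto simp: g_def binomial_eq_0)
  qed
  \<comment> \<open>The bound must reach \<open>b + j\<close> for all \<open>b \<le> N\<close> and \<open>j \<le> c\<close>; larger bounds are harmless.\<close>
  define K where "K = M + (c + N)"
  have "vertex l \<gamma> M A (vertex l \<gamma>' N A' f) = vertex l \<gamma> K A (vertex l \<gamma>' N A' f)"
    using f by (intro vertex_bound[OF homog_vertex[OF f(1)]]) (auto simp: K_def)
  also have "\<dots> = (\<Sum>b\<le>K. \<Sum>j\<le>b. g j (b - j))"
    unfolding vertex_def g_def
    apply (intro sum.cong refl)
    apply (subst annih_exp_sum)
    apply (subst annih_exp_mult)
    apply (subst annih_exp_schurz[OF p])
    apply (subst sum.swap)
    apply (simp add: sum_distrib_left of_nat_diff algebra_simps)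
    done
  also have "\<dots> = (\<Sum>(b,j)\<in>(SIGMA b:{..K}. {..b}). g j (b - j))"
    by (subst sum.Sigma) auto
  also have "\<dots> = (\<Sum>(b,j)\<in>(\<lambda>(j,b). (b+j,j)) ` ({..c} \<times> {..N}). g j (b - j))"
  proof (intro sum.mono_neutral_right ballI)
    fix x assume x: "x \<in> (SIGMA b:{..K}. {..b}) - (\<lambda>(j, b). (b + j, j)) ` ({..c} \<times> {..N})"
    obtain b j where bj: "x = (b, j)" by force
    then have "j \<le> b" using x by auto
    then have "x = (\<lambda>(j, b). (b + j, j)) (j, b - j)" using bj by auto
    then have "j > c \<or> b - j > N" using x by fastforce
    then show "(case x of (b, j) \<Rightarrow> g j (b - j)) = 0" using g0 bj by simp
  qed (auto simp: K_def)
  also have "\<dots> = (\<Sum>(j,b)\<in>{..c} \<times> {..N}. g j b)"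
    by (subst sum.reindex) (auto intro!: inj_onI sum.cong)
  also have "\<dots> = (\<Sum>j\<le>c. \<Sum>b\<le>N. g j b)"
    by (simp add: sum.cartesian_product)
  finally show ?thesis
    by (simp add: g_def sum_distrib_left mult_ac)
qed

text \<open>
  The normally ordered product is symmetric, and
  \<open>z\<^sup>c (1 - w/z)\<^sup>c = (z - w)\<^sup>c\<close> changes by \<open>(-1)\<^sup>c\<close>
  when \<open>z\<close> and \<open>w\<close> are exchanged.
\<close>

lemma vertex_commute:
  assumes p: "pairing l \<gamma> \<gamma>' = of_nat c" "pairing l \<gamma>' \<gamma> = of_nat c"
    and f: "f \<in> homog l d" "d \<le> int N" "d + A' \<le> int M" "d + A \<le> int M"
  shows "vertex l \<gamma> M (A - int c) (vertex l \<gamma>' N A' f) =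
         cst ((-1) ^ c) * vertex l \<gamma>' M (A' - int c) (vertex l \<gamma> N A f)"
proof -
  define G where "G = (\<lambda>X Y. (\<Sum>b\<le>N. \<Sum>b'\<le>N. schurz l \<gamma> (X + int b) * (schurz l \<gamma>' (Y + int b') *
          annih_exp l \<gamma> b (annih_exp l \<gamma>' b' f))))"
  have "vertex l \<gamma> M (A - int c) (vertex l \<gamma>' N A' f) =
    (\<Sum>j\<le>c. cst ((-1) ^ j * of_nat (c choose j)) * G (A - int c + int j) (A' - int j))"
    unfolding G_def by (rule vertex_vertex[OF p(1) f(1,2,3)])
  also have "\<dots> = (\<Sum>j\<le>c. cst ((-1) ^ (c - j) * of_nat (c choose j)) * G (A - int j) (A' - int c + int j))"
    by (rule sum.reindex_bij_witness[of _ "\<lambda>j. c - j" "\<lambda>j. c - j"])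
       (auto simp: binomial_symmetric[symmetric] of_nat_diff algebra_simps)
  also have "\<dots> = cst ((-1) ^ c) * (\<Sum>j\<le>c. cst ((-1) ^ j * of_nat (c choose j)) * G (A - int j) (A' - int c + int j))"
  proof -
    have "(-1 :: complex) ^ (c - j) = (-1) ^ c * (-1) ^ j" if "j \<le> c" for j :: nat
    proof -
      have "(-1 :: complex) ^ c = (-1) ^ (c - j) * (-1) ^ j" and "(-1 :: complex) ^ j * (-1) ^ j = 1"
        using that by (simp_all flip: power_add power_mult_distrib)
      then show ?thesis by (simp only: mult.assoc mult_1_right)
    qed
    then show ?thesis
      by (simp add: sum_distrib_left cst_mult_left mult.assoc del: cst_simps(4))
  qed
  also have "(\<Sum>j\<le>c. cst ((-1) ^ j * of_nat (c choose j)) * G (A - int j) (A' - int c + int j)) =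
      vertex l \<gamma>' M (A' - int c) (vertex l \<gamma> N A f)"
    unfolding vertex_vertex[OF p(2) f(1,2,4)] G_def
    by (subst (2) sum.swap) (simp add: annih_exp_commute[of l \<gamma>'] mult_ac)
  finally show ?thesis .
qed


section \<open>Weight lattice, root lattice and colors\<close>

lemma lookup_hscale [simp]: "lookup (hscale c x) k = c * lookup x k"
  by (simp add: hscale_def Poly_Mapping.map.rep_eq when_def)

lemma lookup_color: "r \<le> s \<Longrightarrow> lookup (color r s) k = (if k = r then 1 else 0) - (if k = Suc s then 1 else 0)"
  by (simp add: color_eq lookup_minus lookup_single when_def)

lemma tform_color: "r \<le> s \<Longrightarrow> tform (color r s) \<kappa> = lookup \<kappa> r - lookup \<kappa> (Suc s)"
  by (simp add: color_eq tform_root)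

definition integer_span :: "nat \<Rightarrow> (nat \<Rightarrow> hvec) \<Rightarrow> hvec set" where
  "integer_span l b = {(\<Sum>i=1..l. hscale (of_int (c i)) (b i)) | c :: nat \<Rightarrow> int. True}"

lemma weight_lattice_eq: "weight_lattice l = integer_span l (fund_weight l)"
  by (simp add: weight_lattice_def integer_span_def)

lemma root_lattice_eq: "root_lattice l = integer_span l simple_root"
  by (simp add: root_lattice_def integer_span_def)

lemma integer_span_add:
  assumes "x \<in> integer_span l b" "y \<in> integer_span l b"
  shows "x + y \<in> integer_span l b"
proof -
  obtain c d where "x = (\<Sum>i=1..l. hscale (of_int (c i)) (b i))" "y = (\<Sum>i=1..l. hscale (of_int (d i)) (b i))"
    using assms unfolding integer_span_def by blast
  then have "x + y = (\<Sum>i=1..l. hscale (of_int (c i + d i)) (b i))"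
    by (intro poly_mapping_eqI) (simp add: lookup_add lookup_sum ring_distribs sum.distrib)
  then show ?thesis unfolding integer_span_def by (auto intro!: exI[of _ "\<lambda>i. c i + d i"])
qed

lemma integer_span_scale:
  assumes "x \<in> integer_span l b"
  shows "hscale (of_int k) x \<in> integer_span l b"
proof -
  obtain c where "x = (\<Sum>i=1..l. hscale (of_int (c i)) (b i))"
    using assms unfolding integer_span_def by blast
  then have "hscale (of_int k) x = (\<Sum>i=1..l. hscale (of_int (k * c i)) (b i))"
    by (intro poly_mapping_eqI) (simp add: lookup_sum sum_distrib_left mult.assoc)
  then show ?thesis unfolding integer_span_def by (auto intro!: exI[of _ "\<lambda>i. k * c i"])
qed

lemma integer_span_zero: "0 \<in> integer_span l b"
  unfolding integer_span_def
  by (auto intro!: exI[of _ "\<lambda>_. 0"] poly_mapping_eqI simp: lookup_sum)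

lemma integer_span_sum: "(\<And>x. x \<in> X \<Longrightarrow> f x \<in> integer_span l b) \<Longrightarrow> sum f X \<in> integer_span l b"
  by (induction X rule: infinite_finite_induct) (auto intro: integer_span_zero integer_span_add)

lemmas weight_lattice_closed =
  integer_span_zero[of l "fund_weight l" for l, folded weight_lattice_eq]
  integer_span_add[where b = "fund_weight l" and l = l for l, folded weight_lattice_eq]
  integer_span_scale[where b = "fund_weight l" and l = l for l, folded weight_lattice_eq]
  integer_span_sum[where b = "fund_weight l" and l = l for l, folded weight_lattice_eq]

lemmas root_lattice_closed =
  integer_span_add[where b = simple_root, folded root_lattice_eq]
  integer_span_scale[where b = simple_root, folded root_lattice_eq]

lemma fund_weight_in_weight_lattice:
  assumes "i \<le> Suc l"
  shows "fund_weight l i \<in> weight_lattice l"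
proof -
  consider "i = 0" | "i = Suc l" | "i \<in> {1..l}" using assms by force
  then show ?thesis
  proof cases
    case 3
    have "fund_weight l i = (\<Sum>j=1..l. hscale (of_int (if j = i then 1 else 0)) (fund_weight l j))"
      using 3 by (intro poly_mapping_eqI) (auto simp: lookup_sum if_distrib[of "\<lambda>x. x * _"] if_distrib[of of_int] cong: if_cong)
    then show ?thesis unfolding weight_lattice_def by (auto intro!: exI[of _ "\<lambda>j. if j = i then 1 else 0"])
  next
    case 1
    then have "fund_weight l i = 0" by (intro poly_mapping_eqI) (simp add: lookup_fund_weight)
    then show ?thesis by (simp add: weight_lattice_closed(1))
  next
    case 2
    then have "fund_weight l i = 0" by (intro poly_mapping_eqI) (simp add: lookup_fund_weight del: of_nat_Suc)
    then show ?thesis by (simp add: weight_lattice_closed(1))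
  qed
qed

text \<open>
  \<open>\<alpha>\<^sub>i = 2\<omega>\<^sub>i - \<omega>\<^bsub>i-1\<^esub> - \<omega>\<^bsub>i+1\<^esub>\<close>,
  where \<open>\<omega>\<^sub>0 = \<omega>\<^bsub>l+1\<^esub> = 0\<close>.
\<close>

lemma simple_root_in_weight_lattice:
  assumes "i \<in> {1..l}"
  shows "simple_root i \<in> weight_lattice l"
proof -
  have *: "simple_root i = fund_weight l i + fund_weight l i + hscale (of_int (-1)) (fund_weight l (i - 1)) + hscale (of_int (-1)) (fund_weight l (Suc i))"
    (is "_ = ?r")
  proof (rule poly_mapping_eqI)
    fix k
    show "lookup (simple_root i) k = lookup ?r k"
      unfolding simple_root_def lookup_add lookup_hscale lookup_minus lookup_single lookup_fund_weight when_def
      using assms by (auto simp: diff_divide_distrib add_divide_distrib)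
  qed
  show ?thesis
    unfolding * using assms
    by (intro weight_lattice_closed(2) weight_lattice_closed(3) fund_weight_in_weight_lattice) auto
qed

lemma root_lattice_subset: "root_lattice l \<subseteq> weight_lattice l"
  unfolding root_lattice_def
  by (auto intro!: weight_lattice_closed(4) weight_lattice_closed(3) simple_root_in_weight_lattice)

lemma color_in_root_lattice:
  assumes "1 \<le> r" "r \<le> s" "s \<le> l"
  shows "color r s \<in> root_lattice l"
proof -
  have "color r s = (\<Sum>i=1..l. hscale (of_int (if i \<in> {r..s} then 1 else 0)) (simple_root i))"
  proof -
    have "(\<Sum>i=1..l. hscale (of_int (if i \<in> {r..s} then 1 else 0)) (simple_root i)) =
          (\<Sum>i\<in>{r..s}. hscale 1 (simple_root i))"
      using assms by (intro sum.mono_neutral_cong_right) (auto intro!: poly_mapping_eqI)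
    also have "\<dots> = color r s"
      unfolding color_def by (intro sum.cong poly_mapping_eqI) auto
    finally show ?thesis ..
  qed
  then show ?thesis unfolding root_lattice_def by (auto intro!: exI[of _ "\<lambda>i. if i \<in> {r..s} then 1 else 0"])
qed

lemma weight_lattice_integral:
  assumes "\<kappa> \<in> weight_lattice l" "a \<in> {1..l+1}" "b \<in> {1..l+1}"
  shows "lookup \<kappa> a - lookup \<kappa> b \<in> \<int>"
proof -
  obtain c where c: "\<kappa> = (\<Sum>i=1..l. hscale (of_int (c i)) (fund_weight l i))"
    using assms unfolding weight_lattice_def by blast
  have "lookup \<kappa> a - lookup \<kappa> b = (\<Sum>i=1..l. of_int (c i) * (lookup (fund_weight l i) a - lookup (fund_weight l i) b))"
    unfolding c by (simp add: lookup_sum sum_subtractf right_diff_distrib)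
  also have "\<dots> \<in> \<int>"
    using assms(2,3) by (intro Ints_sum Ints_mult) (auto simp: lookup_fund_weight)
  finally show ?thesis .
qed

lemma cocycle_nonzero:
  assumes "cocycle l \<epsilon>" "a \<in> weight_lattice l" "b \<in> weight_lattice l"
  shows "\<epsilon> a b \<noteq> 0"
  using assms unfolding cocycle_def by (metis cis_neq_zero power_not_zero)

definition color_range :: "nat \<Rightarrow> nat \<Rightarrow> particle \<Rightarrow> bool" where
  "color_range l m = (\<lambda>(r, s, n). 1 \<le> r \<and> r \<le> m \<and> m \<le> s \<and> s \<le> l)"

lemma pairing_color:
  assumes "1 \<le> r" "r \<le> m" "m \<le> s" "s \<le> l" "1 \<le> r'" "r' \<le> m" "m \<le> s'" "s' \<le> l"
  shows "pairing l (color r s) (color r' s') = of_nat ((if r = r' then 1 else 0) + (if s = s' then 1 else 0))"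
proof -
  have "pairing l (color r s) (color r' s') =
     (\<Sum>i=r'..s'. lookup (simple_root i) r - lookup (simple_root i) (Suc s))"
    unfolding pairing_def using assms
    by (intro sum.mono_neutral_cong_right) (auto simp: tform_color lookup_fund_weight)
  also have "\<dots> = (\<Sum>i=r'..s'. (if i = r then 1 else 0) - (if i = r - 1 then 1 else 0) - ((if i = Suc s then 1 else 0) - (if i = s then 1 else 0)))"
    using assms by (intro sum.cong) (auto simp: simple_root_def lookup_minus lookup_single when_def)
  also have "\<dots> = of_nat ((if r = r' then 1 else 0) + (if s = s' then 1 else 0))"
    using assms by (auto simp: sum_subtractf)
  finally show ?thesis .
qed

lemma tform_color_color:
  assumes "1 \<le> r" "r \<le> m" "m \<le> s" "1 \<le> r'" "r' \<le> m" "m \<le> s'"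
  shows "tform (color r s) (color r' s') = of_nat ((if r = r' then 1 else 0) + (if s = s' then 1 else 0))"
  using assms by (auto simp: tform_color lookup_color)

text \<open>
  The sign \<open>(-1)\<^sup>c\<close> from exchanging the variables cancels against the commutator of
  the cocycle.
\<close>

lemma x_op_commute:
  assumes \<epsilon>: "cocycle l \<epsilon>" and \<kappa>: "\<kappa> \<in> weight_lattice l" and f: "f \<in> homog l d"
    and rs: "1 \<le> r" "r \<le> m" "m \<le> s" "s \<le> l" and rs': "1 \<le> r'" "r' \<le> m" "m \<le> s'" "s' \<le> l"
  shows "x_op l \<epsilon> (color r s) j (x_op l \<epsilon> (color r' s') j' (single \<kappa> f)) =
         x_op l \<epsilon> (color r' s') j' (x_op l \<epsilon> (color r s) j (single \<kappa> f))"
proof -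
  let ?g = "color r s" and ?g' = "color r' s'"
  define c where "c = (if r = r' then 1 else 0) + (if s = s' then 1 else (0::nat))"
  have "?g \<in> root_lattice l" "?g' \<in> root_lattice l"
    using rs rs' by (auto intro!: color_in_root_lattice)
  then have lat: "?g \<in> weight_lattice l" "?g' \<in> weight_lattice l"
    using root_lattice_subset by auto
  obtain z where z: "tform ?g \<kappa> = of_int z"
    using weight_lattice_integral[OF \<kappa>, of r "Suc s"] rs by (auto simp: tform_color elim: Ints_cases)
  obtain z' where z': "tform ?g' \<kappa> = of_int z'"
    using weight_lattice_integral[OF \<kappa>, of r' "Suc s'"] rs' by (auto simp: tform_color elim: Ints_cases)
  have c: "tform ?g ?g' = of_nat c" "tform ?g' ?g = of_nat c"
    using rs rs' by (auto simp: tform_color_color[where m = m] c_def)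
  have p: "pairing l ?g ?g' = of_nat c" "pairing l ?g' ?g = of_nat c"
    using rs rs' by (auto simp: pairing_color[where m = m] c_def)
  have zz: "tform ?g (?g' + \<kappa>) = of_int (z + int c)" "tform ?g' (?g + \<kappa>) = of_int (z' + int c)"
    using c z z' rs rs' by (simp_all add: tform_color lookup_add algebra_simps)
  define A A' where "A = - j - 1 - z" and "A' = - j' - 1 - z'"
  define M where "M = nat \<bar>d\<bar> + nat \<bar>A\<bar> + nat \<bar>A'\<bar>"
  have M: "d \<le> int M" "d + A \<le> int M" "d + A' \<le> int M" by (auto simp: M_def)
  have L: "x_op l \<epsilon> ?g j (x_op l \<epsilon> ?g' j' (single \<kappa> f)) = single (?g + (?g' + \<kappa>))
      (cst (\<epsilon> ?g (?g' + \<kappa>) * \<epsilon> ?g' \<kappa>) * vertex l ?g M (A - int c) (vertex l ?g' M A' f))"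
    unfolding x_op_single[OF z' f M(1)] A'_def[symmetric]
    by (subst x_op_single[OF zz(1) homog_cst_mult[OF homog_vertex[OF f]] M(3)])
       (simp add: A_def vertex_cst_mult cst_mult_left algebra_simps)
  have R: "x_op l \<epsilon> ?g' j' (x_op l \<epsilon> ?g j (single \<kappa> f)) = single (?g' + (?g + \<kappa>))
      (cst (\<epsilon> ?g' (?g + \<kappa>) * \<epsilon> ?g \<kappa>) * vertex l ?g' M (A' - int c) (vertex l ?g M A f))"
    unfolding x_op_single[OF z f M(1)] A_def[symmetric]
    by (subst x_op_single[OF zz(2) homog_cst_mult[OF homog_vertex[OF f]] M(2)])
       (simp add: A'_def vertex_cst_mult cst_mult_left algebra_simps)
  have "\<epsilon> ?g (?g' + \<kappa>) * \<epsilon> ?g' \<kappa> * (-1) ^ c = \<epsilon> ?g' (?g + \<kappa>) * \<epsilon> ?g \<kappa>"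
  proof -
    have "tform ?g ?g' = of_int k \<longrightarrow> \<epsilon> ?g ?g' / \<epsilon> ?g' ?g = (-1) powi k" for k
      using \<epsilon> \<open>?g \<in> root_lattice l\<close> \<open>?g' \<in> root_lattice l\<close> unfolding cocycle_def by blast
    from this[of "int c"] have "\<epsilon> ?g ?g' / \<epsilon> ?g' ?g = (-1) powi (int c)"
      using c(1) by simp
    then have e: "\<epsilon> ?g ?g' = (-1) ^ c * \<epsilon> ?g' ?g"
      using cocycle_nonzero[OF \<epsilon> lat(2,1)] by (simp add: field_simps)
    have "\<epsilon> ?g ?g' * \<epsilon> (?g + ?g') \<kappa> = \<epsilon> ?g' \<kappa> * \<epsilon> ?g (?g' + \<kappa>)"
         "\<epsilon> ?g' ?g * \<epsilon> (?g + ?g') \<kappa> = \<epsilon> ?g \<kappa> * \<epsilon> ?g' (?g + \<kappa>)"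
      using \<epsilon> lat \<kappa> unfolding cocycle_def by (simp, metis add.commute)
    then have "\<epsilon> ?g' \<kappa> * \<epsilon> ?g (?g' + \<kappa>) = (-1) ^ c * (\<epsilon> ?g \<kappa> * \<epsilon> ?g' (?g + \<kappa>))"
      using e by (metis mult.assoc)
    then have "(-1) ^ c * (\<epsilon> ?g' \<kappa> * \<epsilon> ?g (?g' + \<kappa>)) = ((-1) ^ c * (-1) ^ c) * (\<epsilon> ?g \<kappa> * \<epsilon> ?g' (?g + \<kappa>))"
      by simp
    also have "(-1) ^ c * (-1) ^ c = (1::complex)" by (simp flip: power_mult_distrib)
    finally show ?thesis by (simp add: mult_ac)
  qed
  then show ?thesis
    unfolding L R vertex_commute[OF p f M(1,3,2)]
    by (simp only: cst_mult_left add.left_commute)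
qed

section \<open>Monomials acting on the highest weight vector\<close>

abbreviation x_factor :: "nat \<Rightarrow> (hvec \<Rightarrow> hvec \<Rightarrow> complex) \<Rightarrow> particle \<Rightarrow> vspace \<Rightarrow> vspace" where
  "x_factor l \<epsilon> \<equiv> (\<lambda>(r, s, n). x_op l \<epsilon> (color r s) (- int n))"

lemma foldr_commute_on:
  assumes "mset xs = mset ys" "set xs \<subseteq> S" "v \<in> R"
    and closed: "\<And>x v. x \<in> S \<Longrightarrow> v \<in> R \<Longrightarrow> F x v \<in> R"
    and comm: "\<And>x y v. x \<in> S \<Longrightarrow> y \<in> S \<Longrightarrow> v \<in> R \<Longrightarrow> F x (F y v) = F y (F x v)"
  shows "foldr F xs v = foldr F ys v"
  using assms(1,2)
proof (induction xs arbitrary: ys)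
  case (Cons x xs)
  have foldr_R: "foldr F zs v \<in> R" if "set zs \<subseteq> S" for zs
    using that by (induction zs) (auto intro: closed \<open>v \<in> R\<close>)
  have "x \<in> set ys" using Cons.prems(1) by (metis list.set_intros(1) set_mset_mset)
  then obtain y1 y2 where ys: "ys = y1 @ x # y2" by (metis split_list)
  have S: "set ys \<subseteq> S" using Cons.prems by (metis set_mset_mset)
  have "foldr F (y1 @ x # y2) v = F x (foldr F (y1 @ y2) v)" if "set (y1 @ x # y2) \<subseteq> S" for y1
    using that
  proof (induction y1)
    case (Cons y y1)
    have "foldr F (y1 @ y2) v \<in> R" using Cons.prems by (intro foldr_R) auto
    then show ?case using Cons comm[of y x "foldr F (y1 @ y2) v"] by simp
  qed simp
  moreover have "mset xs = mset (y1 @ y2)" using Cons.prems(1) ys by simp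
  ultimately show ?case using Cons.IH[of "y1 @ y2"] S Cons.prems(2) ys by simp
qed simp

text \<open>
  The enumeration chosen in \<^const>\<open>mon_op\<close> does not matter, because the factors commute
  on all vectors that can arise from the highest weight vector.
\<close>

lemma mon_op_mset:
  assumes "cocycle l \<epsilon>" "\<forall>x\<in>set xs. color_range l m x" "i \<le> l"
  shows "mon_op l \<epsilon> (mset xs) (hw_vector l i) = foldr (x_factor l \<epsilon>) xs (hw_vector l i)"
proof -
  have "mset (SOME ys. mset ys = mset xs) = mset xs" by (rule someI) simp
  moreover have "foldr (x_factor l \<epsilon>) xs (hw_vector l i) = foldr (x_factor l \<epsilon>) ys (hw_vector l i)"
    if "mset xs = mset ys" for ys
    using that
  proof (rule foldr_commute_on[where S = "{x. color_range l m x}"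
        and R = "{single \<kappa> f | \<kappa> f d. \<kappa> \<in> weight_lattice l \<and> f \<in> homog l d}"])
    show "hw_vector l i \<in> {single \<kappa> f | \<kappa> f d. \<kappa> \<in> weight_lattice l \<and> f \<in> homog l d}"
      using assms(3) homog_one fund_weight_in_weight_lattice[of i l] by (auto simp: hw_vector_def)
  next
    fix x v assume x: "x \<in> {x. color_range l m x}"
      and "v \<in> {single \<kappa> f | \<kappa> f d. \<kappa> \<in> weight_lattice l \<and> f \<in> homog l d}"
    then obtain \<kappa> f d where v: "v = single \<kappa> f" "\<kappa> \<in> weight_lattice l" "f \<in> homog l d" by blast
    obtain r s n where rsn: "x = (r, s, n)" by (metis prod_cases3)
    have rs: "1 \<le> r" "r \<le> m" "m \<le> s" "s \<le> l" using x rsn by (auto simp: color_range_def)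
    then obtain z where z: "tform (color r s) \<kappa> = of_int z"
      using weight_lattice_integral[OF v(2), of r "Suc s"] by (auto simp: tform_color elim: Ints_cases)
    have "color r s + \<kappa> \<in> weight_lattice l"
      using rs v root_lattice_subset color_in_root_lattice[of r s l] by (auto intro!: weight_lattice_closed(2))
    moreover have "x_factor l \<epsilon> x v = single (color r s + \<kappa>) (cst (\<epsilon> (color r s) \<kappa>) * vertex l (color r s) (nat d) (- (- int n) - 1 - z) f)"
      unfolding v(1) rsn prod.case by (rule x_op_single[OF z v(3)]) simp
    ultimately show "x_factor l \<epsilon> x v \<in> {single \<kappa> f | \<kappa> f d. \<kappa> \<in> weight_lattice l \<and> f \<in> homog l d}"
      using homog_cst_mult[OF homog_vertex[OF v(3)]] by blast
  next
    fix x y v assume x: "x \<in> {x. color_range l m x}" "y \<in> {x. color_range l m x}"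
      and "v \<in> {single \<kappa> f | \<kappa> f d. \<kappa> \<in> weight_lattice l \<and> f \<in> homog l d}"
    then obtain \<kappa> f d where v: "v = single \<kappa> f" "\<kappa> \<in> weight_lattice l" "f \<in> homog l d" by blast
    show "x_factor l \<epsilon> x (x_factor l \<epsilon> y v) = x_factor l \<epsilon> y (x_factor l \<epsilon> x v)"
      using x unfolding v(1) by (auto simp: color_range_def intro: x_op_commute[OF assms(1) v(2,3)])
  qed (use assms(2) in auto)
  ultimately show ?thesis unfolding mon_op_def by metis
qed

text \<open>
  The pairing of a color with the lattice weight of a list counts occurrences of its letters. The highest
  weight \<open>\<omega>\<^sub>i\<close> contributes one further occurrence of \<open>r\<close> if
  \<open>r \<le> i\<close>, and of \<open>s\<close> if \<open>i \<le> s\<close>; the latter is shifted by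
  one, which absorbs the \<open>-1\<close> in
  \<open>n - 1 - \<langle>\<gamma>, \<kappa>\<rangle>\<close>.
\<close>

definition rcount :: "nat \<Rightarrow> nat \<Rightarrow> particle list \<Rightarrow> nat" where
  "rcount i r xs = (if r \<le> i then 1 else 0) + count_list (map fst xs) r"

definition scount :: "nat \<Rightarrow> nat \<Rightarrow> particle list \<Rightarrow> nat" where
  "scount i s xs = (if i \<le> s then 1 else 0) + count_list (map (fst \<circ> snd) xs) s"

text \<open>
  The amount by which the outermost factor raises the polynomial degree.
\<close>

definition gap :: "nat \<Rightarrow> particle \<Rightarrow> particle list \<Rightarrow> int" where
  "gap i = (\<lambda>(r, s, n) xs. int n - int (rcount i r xs) - int (scount i s xs))"

fun list_degree :: "nat \<Rightarrow> particle list \<Rightarrow> int" where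
  "list_degree i [] = 0"
| "list_degree i (x # xs) = list_degree i xs + gap i x xs"

fun list_weight :: "nat \<Rightarrow> nat \<Rightarrow> particle list \<Rightarrow> hvec" where
  "list_weight l i [] = fund_weight l i"
| "list_weight l i ((r, s, n) # xs) = color r s + list_weight l i xs"

text \<open>
  The Fock component of \<open>x(\<pi>)v\<^sub>i\<close> without the nonzero cocycle factors; the head of
  the list is the outermost operator.
\<close>

fun list_poly :: "nat \<Rightarrow> nat \<Rightarrow> particle list \<Rightarrow> fock" where
  "list_poly l i [] = 1"
| "list_poly l i ((r, s, n) # xs) = vertex l (color r s) (nat (list_degree i xs)) (gap i (r, s, n) xs) (list_poly l i xs)"

lemma homog_list_poly: "list_poly l i xs \<in> homog l (list_degree i xs)"
  by (induction xs rule: list_poly.induct) (auto intro: homog_one homog_vertex)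

lemma lookup_list_weight:
  assumes "\<forall>x\<in>set xs. color_range l m x"
  shows "lookup (list_weight l i xs) k = lookup (fund_weight l i) k + of_nat (count_list (map fst xs) k)
     - of_nat (count_list (map (Suc \<circ> fst \<circ> snd) xs) k)"
  using assms
proof (induction xs)
  case (Cons x xs)
  obtain r s n where x: "x = (r, s, n)" by (metis prod_cases3)
  then have "r \<le> s" using Cons.prems by (auto simp: color_range_def)
  then show ?case using Cons x by (auto simp: lookup_add lookup_color)
qed simp

lemma count_list_map_inj: "inj f \<Longrightarrow> count_list (map f xs) (f x) = count_list xs x"
  by (induction xs) (auto dest: injD)

lemma tform_color_list_weight:
  assumes xs: "\<forall>x\<in>set xs. color_range l m x" and rs: "1 \<le> r" "r \<le> m" "m \<le> s" "s \<le> l"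
  shows "tform (color r s) (list_weight l i xs) = of_int (int (rcount i r xs) + int (scount i s xs) - 1)"
proof -
  have "count_list (map (Suc \<circ> fst \<circ> snd) xs) r = 0" "count_list (map fst xs) (Suc s) = 0"
    using xs rs by (force simp: count_list_0_iff color_range_def)+
  moreover have "count_list (map (Suc \<circ> fst \<circ> snd) xs) (Suc s) = count_list (map (fst \<circ> snd) xs) s"
    using count_list_map_inj[of Suc "map (fst \<circ> snd) xs" s] by (simp add: comp_assoc)
  ultimately show ?thesis
    using rs by (auto simp: tform_color lookup_list_weight[OF xs] lookup_fund_weight rcount_def scount_def)
qed

lemma list_weight_in_weight_lattice:
  assumes "\<forall>x\<in>set xs. color_range l m x" "i \<le> l"
  shows "list_weight l i xs \<in> weight_lattice l"
  using assms
proof (induction xs)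
  case (Cons x xs)
  obtain r s n where x: "x = (r, s, n)" by (metis prod_cases3)
  then show ?case using Cons color_in_root_lattice[of r s l] root_lattice_subset
    by (auto simp: color_range_def intro!: weight_lattice_closed(2))
qed (simp add: fund_weight_in_weight_lattice)

lemma foldr_x_factor:
  assumes "cocycle l \<epsilon>" "\<forall>x\<in>set xs. color_range l m x" "i \<le> l"
  shows "\<exists>c. c \<noteq> 0 \<and> foldr (x_factor l \<epsilon>) xs (hw_vector l i) = single (list_weight l i xs) (cst c * list_poly l i xs)"
  using assms(2)
proof (induction xs)
  case Nil
  then show ?case by (auto simp: hw_vector_def intro!: exI[of _ 1])
next
  case (Cons x xs)
  obtain r s n where x: "x = (r, s, n)" by (metis prod_cases3)
  obtain c where c: "c \<noteq> 0" "foldr (x_factor l \<epsilon>) xs (hw_vector l i) = single (list_weight l i xs) (cst c * list_poly l i xs)"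
    using Cons by auto
  have rs: "1 \<le> r" "r \<le> m" "m \<le> s" "s \<le> l" and xs: "\<forall>x\<in>set xs. color_range l m x"
    using Cons.prems x by (auto simp: color_range_def)
  let ?e = "\<epsilon> (color r s) (list_weight l i xs)"
  have "?e \<noteq> 0"
    using rs color_in_root_lattice[of r s l] root_lattice_subset
    by (intro cocycle_nonzero[OF assms(1)] list_weight_in_weight_lattice[OF xs assms(3)]) auto
  moreover have op: "x_op l \<epsilon> (color r s) (- int n) (single (list_weight l i xs) (cst c * list_poly l i xs)) =
     single (color r s + list_weight l i xs) (cst ?e * vertex l (color r s) (nat (list_degree i xs))
       (- (- int n) - 1 - (int (rcount i r xs) + int (scount i s xs) - 1)) (cst c * list_poly l i xs))"
    by (rule x_op_single[OF tform_color_list_weight[OF xs rs] homog_cst_mult[OF homog_list_poly]]) simp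
  moreover have "- (- int n) - 1 - (int (rcount i r xs) + int (scount i s xs) - 1) = gap i (r, s, n) xs"
    by (simp add: gap_def)
  then have "foldr (x_factor l \<epsilon>) (x # xs) (hw_vector l i) = single (list_weight l i (x # xs)) (cst (?e * c) * list_poly l i (x # xs))"
    using op by (simp add: x c(2) vertex_cst_mult cst_mult_left)
  ultimately show ?case using c(1) by (metis mult_eq_0_iff)
qed


section \<open>Substitution homomorphisms of the Fock ring\<close>

definition mon_insertion :: "(nat \<times> nat \<Rightarrow> fock) \<Rightarrow> exponent \<Rightarrow> fock" where
  "mon_insertion \<theta> u = (\<Prod>x\<in>keys u. \<theta> x ^ lookup u x)"

definition insertion :: "(nat \<times> nat \<Rightarrow> fock) \<Rightarrow> fock \<Rightarrow> fock" where
  "insertion \<theta> f = (\<Sum>u\<in>keys f. cst (lookup f u) * mon_insertion \<theta> u)"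

lemma mon_insertion_superset: "finite A \<Longrightarrow> keys u \<subseteq> A \<Longrightarrow> mon_insertion \<theta> u = (\<Prod>x\<in>A. \<theta> x ^ lookup u x)"
  unfolding mon_insertion_def by (intro prod.mono_neutral_left) (auto simp: in_keys_iff)

lemma mon_insertion_add: "mon_insertion \<theta> (u + v) = mon_insertion \<theta> u * mon_insertion \<theta> v"
proof -
  have "finite (keys u \<union> keys v)" by simp
  note * = mon_insertion_superset[OF this]
  show ?thesis
    by (subst (1 2 3) *) (use keys_add[of u v] in \<open>auto simp: lookup_add power_add prod.distrib\<close>)
qed

lemma mon_insertion_0 [simp]: "mon_insertion \<theta> 0 = 1"
  by (simp add: mon_insertion_def)

lemma mon_insertion_single [simp]: "mon_insertion \<theta> (single x (Suc 0)) = \<theta> x"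
  by (simp add: mon_insertion_def)

lemma insertion_superset: "finite A \<Longrightarrow> keys f \<subseteq> A \<Longrightarrow> insertion \<theta> f = (\<Sum>u\<in>A. cst (lookup f u) * mon_insertion \<theta> u)"
  unfolding insertion_def by (intro sum.mono_neutral_left) (auto simp: in_keys_iff)

lemma insertion_single: "insertion \<theta> (single u c) = cst c * mon_insertion \<theta> u"
  by (subst insertion_superset[of "{u}"]) (auto simp: lookup_single)

lemma insertion_add: "insertion \<theta> (f + g) = insertion \<theta> f + insertion \<theta> g"
proof -
  have "finite (keys f \<union> keys g)" by simp
  note * = insertion_superset[OF this]
  show ?thesis
    by (subst (1 2 3) *)
       (use keys_add[of f g] in \<open>auto simp: lookup_add ring_distribs sum.distrib simp flip: cst_simps(6)\<close>)
qed

lemma insertion_0 [simp]: "insertion \<theta> 0 = 0"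
  by (simp add: insertion_def)

lemma insertion_sum: "insertion \<theta> (sum f X) = (\<Sum>x\<in>X. insertion \<theta> (f x))"
  by (induction X rule: infinite_finite_induct) (simp_all add: insertion_add)

lemma insertion_mult: "insertion \<theta> (f * g) = insertion \<theta> f * insertion \<theta> g"
proof (induction f rule: poly_mapping_additive_induct)
  case (single u c)
  show ?case
  proof (induction g rule: poly_mapping_additive_induct)
    case (single v d)
    show ?case by (simp add: mult_single insertion_single mon_insertion_add mult_ac flip: cst_simps(5))
  qed (simp add: insertion_add ring_distribs)
qed (simp add: insertion_add ring_distribs)

lemma insertion_cst [simp]: "insertion \<theta> (cst c) = cst c"
  by (simp add: cst_def[of c] insertion_single)

lemma insertion_one [simp]: "insertion \<theta> 1 = 1"
  using insertion_cst[of \<theta> 1] by simp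

lemma insertion_of_nat [simp]: "insertion \<theta> (of_nat n) = of_nat n"
  using insertion_cst[of \<theta> "of_nat n"] by simp

section \<open>One alphabet for every letter\<close>

text \<open>
  The exponent of the complete symmetric function \<open>h\<^bsub>c,p\<^esub>\<close>; these are the
  variables of the target ring, and \<open>h\<^bsub>c,0\<^esub> = 1\<close>.
\<close>

definition h_exponent :: "nat \<Rightarrow> nat \<Rightarrow> exponent" where
  "h_exponent c p = (if p = 0 then 0 else single (c, p) 1)"

definition h_var :: "nat \<Rightarrow> nat \<Rightarrow> fock" where
  "h_var c p = single (h_exponent c p) 1"

text \<open>
  Newton's identities, solved for the power sums.
\<close>

fun power_sum :: "nat \<Rightarrow> nat \<Rightarrow> fock" where
  "power_sum c n = of_nat n * h_var c n - (\<Sum>k\<in>{1..<n}. power_sum c k * h_var c (n - k))"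

declare power_sum.simps [simp del]

lemma h_var_0 [simp]: "h_var c 0 = 1"
  by (simp add: h_var_def h_exponent_def)

lemma newton: "of_nat n * h_var c n = (\<Sum>k=1..n. power_sum c k * h_var c (n - k))"
proof (cases "n = 0")
  case False
  then have "{1..n} = insert n {1..<n}" by auto
  then have "(\<Sum>k=1..n. power_sum c k * h_var c (n - k)) = power_sum c n + (\<Sum>k\<in>{1..<n}. power_sum c k * h_var c (n - k))"
    by simp
  then show ?thesis by (subst (asm) power_sum.simps[of c n]) simp
qed simp

text \<open>
  With \<open>p\<^bsub>k,n\<^esub>\<close> the power sums, \<open>\<alpha>\<^sub>k(-n)\<close> goes to
  \<open>\<tau>\<^sub>k p\<^bsub>k,n\<^esub> - \<tau>\<^bsub>k+1\<^esub> p\<^bsub>k+1,n\<^esub>\<close>,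
  where \<open>\<tau>\<^sub>k = 1\<close> for \<open>k \<le> m\<close> and
  \<open>\<tau>\<^sub>k = -1\<close> otherwise. The signs make both letters of a color contribute with a
  plus sign.
\<close>

definition split_var :: "nat \<Rightarrow> nat \<times> nat \<Rightarrow> fock" where
  "split_var m = (\<lambda>(k, n). (if k \<le> m then power_sum k n else - power_sum k n)
     - (if Suc k \<le> m then power_sum (Suc k) n else - power_sum (Suc k) n))"

lemma insertion_creation:
  assumes "1 \<le> r" "r \<le> m" "m \<le> s" "s \<le> l"
  shows "insertion (split_var m) (creation l (color r s) k) = power_sum r k + power_sum (Suc s) k"
proof -
  let ?t = "\<lambda>i. if i \<le> m then power_sum i k else - power_sum i k"
  have "insertion (split_var m) (creation l (color r s) k) =
     (\<Sum>i=1..l. cst (tform (color r s) (fund_weight l i)) * split_var m (i, k))"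
    by (simp add: creation_def insertion_sum insertion_single)
  also have "\<dots> = (\<Sum>i=r..s. split_var m (i, k))"
    using assms by (intro sum.mono_neutral_cong_right) (auto simp: tform_color lookup_fund_weight)
  also have "\<dots> = (\<Sum>i=r..s. ?t i - ?t (Suc i))"
    by (intro sum.cong) (simp_all add: split_var_def)
  also have "\<dots> = ?t r - ?t (Suc s)"
    using assms sum_Suc_diff[of r s "\<lambda>i. - ?t i"] by simp
  finally show ?thesis using assms by simp
qed

text \<open>
  The image of \<open>\<gamma>\<^bsub>rs\<^esub>(-k)\<close> is
  \<open>p\<^bsub>r,k\<^esub> + p\<^bsub>s+1,k\<^esub>\<close>, so the exponential becomes the product of
  the generating functions of the \<open>h\<^bsub>r,p\<^esub>\<close> and of the
  \<open>h\<^bsub>s+1,q\<^esub>\<close>. This separates the two letters of a color.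
\<close>

lemma insertion_schur:
  assumes rs: "1 \<le> r" "r \<le> m" "m \<le> s" "s \<le> l"
  shows "insertion (split_var m) (schur l (color r s) n) = (\<Sum>p\<le>n. h_var r p * h_var (Suc s) (n - p))"
proof (rule recursion_unique[where a = n and T = "\<lambda>k g. (power_sum r k + power_sum (Suc s) k) * g"])
  fix a :: nat
  have "of_nat a * insertion (split_var m) (schur l (color r s) a) = insertion (split_var m) (of_nat a * schur l (color r s) a)"
    by (simp add: insertion_mult)
  then show "of_nat a * insertion (split_var m) (schur l (color r s) a) =
      (\<Sum>k=1..a. (power_sum r k + power_sum (Suc s) k) * insertion (split_var m) (schur l (color r s) (a - k)))"
    by (simp add: schur_rec insertion_sum insertion_mult insertion_creation[OF rs])
  let ?F = "h_var r" and ?G = "h_var (Suc s)"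
  have "of_nat a * (\<Sum>j\<le>a. ?F j * ?G (a - j)) =
        (\<Sum>j\<le>a. (of_nat j * ?F j) * ?G (a - j)) + (\<Sum>j\<le>a. ?F j * (of_nat (a - j) * ?G (a - j)))"
    by (rule of_nat_mult_convolution)
  also have "(\<Sum>j\<le>a. (of_nat j * ?F j) * ?G (a - j)) = (\<Sum>j\<le>a. \<Sum>k=1..j. power_sum r k * (?F (j - k) * ?G (a - j)))"
    unfolding newton by (simp add: sum_distrib_right mult.assoc)
  also have "\<dots> = (\<Sum>k=1..a. \<Sum>j\<le>a-k. power_sum r k * (?F j * ?G (a - k - j)))"
    by (rule sum_convolution_left)
  also have "(\<Sum>j\<le>a. ?F j * (of_nat (a - j) * ?G (a - j))) = (\<Sum>j\<le>a. \<Sum>k=1..a-j. power_sum (Suc s) k * (?F j * ?G (a - j - k)))"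
    unfolding newton by (simp add: sum_distrib_left mult.left_commute)
  also have "\<dots> = (\<Sum>k=1..a. \<Sum>j\<le>a-k. power_sum (Suc s) k * (?F j * ?G (a - k - j)))"
    by (rule sum_convolution_right)
  finally show "of_nat a * (\<Sum>j\<le>a. ?F j * ?G (a - j)) =
     (\<Sum>k=1..a. (power_sum r k + power_sum (Suc s) k) * (\<Sum>j\<le>a - k. ?F j * ?G (a - k - j)))"
    by (simp add: sum_distrib_left sum.distrib ring_distribs)
qed simp

lemma lookup_single_mult_add:
  fixes g :: "'a::cancel_comm_monoid_add \<Rightarrow>\<^sub>0 'b::semiring_0"
  shows "lookup (single e c * g) (e + w) = c * lookup g w"
proof (induction g rule: poly_mapping_additive_induct)
  case (single v d)
  then show ?case by (simp add: mult_single lookup_single when_def)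
qed (simp add: ring_distribs lookup_add)

lemma lookup_h_var_h_var_nonzero:
  assumes "lookup (h_var a p * h_var b q * g) u \<noteq> 0"
  shows "(p = 0 \<or> (a, p) \<in> keys u) \<and> (q = 0 \<or> (b, q) \<in> keys u)"
proof -
  have "u \<in> keys (single (h_exponent a p + h_exponent b q) 1 * g)"
    using assms by (simp add: h_var_def mult_single in_keys_iff)
  then obtain v where "u = h_exponent a p + h_exponent b q + v"
    using keys_mult[of "single (h_exponent a p + h_exponent b q) (1::complex)" g] by auto
  then show ?thesis by (auto simp: in_keys_iff lookup_add lookup_single h_exponent_def)
qed

lemma lookup_h_var_h_var: "lookup (h_var a p * h_var b q * g) (h_exponent a p + h_exponent b q + w) = lookup g w"
  unfolding h_var_def mult_single by (subst lookup_single_mult_add) simp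

section \<open>Words with heights\<close>

text \<open>
  Letters \<open>r\<close> are ranked by \<open>r\<close> and letters \<open>s + 1\<close> by
  \<open>-s - 1\<close> (\<open>neg_rank\<close> below), so that both halves of the difference conditions
  read: the height grows by at least one unless the rank of the letter grows.
\<close>

definition descent :: "(nat \<Rightarrow> int) \<Rightarrow> nat \<Rightarrow> nat \<Rightarrow> nat" where
  "descent rk c c' = (if rk c' \<le> rk c then 1 else 0)"

text \<open>
  A word is a list of letters with heights, largest first; below its last entry stands a virtual letter
  \<open>a0\<close> of height \<open>0\<close>.
\<close>

definition word_top :: "nat \<Rightarrow> (nat \<times> nat) list \<Rightarrow> nat \<times> nat" where
  "word_top a0 w = (case w of [] \<Rightarrow> (a0, 0) | x # _ \<Rightarrow> x)"

text \<open>
  Equivalently, the pairs of height and rank decrease strictly in the lexicographic order and stay above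
  that of the virtual letter. Such a word is a set of fermion modes.
\<close>

fun valid_word :: "(nat \<Rightarrow> int) \<Rightarrow> nat \<Rightarrow> (nat \<times> nat) list \<Rightarrow> bool" where
  "valid_word rk a0 [] = True"
| "valid_word rk a0 ((c, h) # w) = (snd (word_top a0 w) + descent rk (fst (word_top a0 w)) c \<le> h \<and> valid_word rk a0 w)"

definition word_count :: "(nat \<Rightarrow> int) \<Rightarrow> nat \<Rightarrow> nat \<Rightarrow> (nat \<times> nat) list \<Rightarrow> nat" where
  "word_count rk a0 c w = descent rk a0 c + count_list (map fst w) c"

text \<open>
  Among equal letters the heights are distinct; subtracting the ground state heights
  \<open>word_count\<close> turns them into the parts of a partition.
\<close>

fun word_monomial :: "(nat \<Rightarrow> int) \<Rightarrow> nat \<Rightarrow> (nat \<times> nat) list \<Rightarrow> exponent" where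
  "word_monomial rk a0 [] = 0"
| "word_monomial rk a0 ((c, h) # w) = h_exponent c (h - word_count rk a0 c w) + word_monomial rk a0 w"

lemma word_top_simps [simp]: "word_top a0 [] = (a0, 0)" "word_top a0 (x # w) = x"
  by (simp_all add: word_top_def)

lemma keys_h_exponent: "(c, p) \<in> keys (h_exponent c' p') \<longleftrightarrow> c = c' \<and> p = p' \<and> p \<noteq> 0"
  by (auto simp: h_exponent_def)

lemma keys_add_nat: "keys (u + v) = keys u \<union> keys (v :: 'a \<Rightarrow>\<^sub>0 nat)"
  by (auto simp: in_keys_iff lookup_add)

text \<open>
  The top entry bounds every part, for each letter \<open>c\<close> after adding the height that a top
  occurrence of \<open>c\<close> has in the ground state. A missing part \<open>p = 0\<close> is included
  because \<open>h\<^bsub>c,0\<^esub> = 1\<close> cannot be seen in a monomial.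
\<close>

lemma word_monomial_bound:
  assumes "valid_word rk a0 w" "p = 0 \<or> (c, p) \<in> keys (word_monomial rk a0 w)"
  shows "p + word_count rk a0 c w \<le> snd (word_top a0 w) + descent rk (fst (word_top a0 w)) c"
  using assms
proof (induction w arbitrary: c p)
  case Nil
  then show ?case by (simp add: word_count_def)
next
  case (Cons x w)
  obtain c0 h0 where x: "x = (c0, h0)" by force
  have v: "valid_word rk a0 w" "snd (word_top a0 w) + descent rk (fst (word_top a0 w)) c0 \<le> h0"
    using Cons.prems x by auto
  have IH: "p + word_count rk a0 c w \<le> snd (word_top a0 w) + descent rk (fst (word_top a0 w)) c"
    if "p = 0 \<or> (c, p) \<in> keys (word_monomial rk a0 w)" for c p
    using Cons.IH[OF v(1) that] .
  consider "c = c0" "p = h0 - word_count rk a0 c0 w" | "p = 0 \<or> (c, p) \<in> keys (word_monomial rk a0 w)"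
    using Cons.prems(2) x by (auto simp: keys_add_nat keys_h_exponent)
  then show ?case
  proof cases
    case 1
    have "0 + word_count rk a0 c0 w \<le> h0" using IH[of 0 c0] v(2) by simp
    then show ?thesis using 1 x by (simp add: word_count_def descent_def)
  next
    case 2
    note i = IH[OF 2]
    show ?thesis
    proof (cases "c = c0")
      case True
      then show ?thesis using i v(2) x by (simp add: word_count_def descent_def)
    next
      case False
      then show ?thesis using i v(2) x by (auto simp: word_count_def descent_def split: if_splits)
    qed
  qed
qed

lemma word_count_le: "valid_word rk a0 w \<Longrightarrow> word_count rk a0 c w \<le> snd (word_top a0 w) + descent rk (fst (word_top a0 w)) c"
  using word_monomial_bound[of rk a0 w 0 c] by simp

lemma keys_word_monomial: "(c, p) \<in> keys (word_monomial rk a0 w) \<Longrightarrow> c \<in> fst ` set w"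
  by (induction w) (auto simp: keys_add_nat keys_h_exponent)

section \<open>Leading coefficients and linear independence\<close>

definition list_top :: "nat \<Rightarrow> particle list \<Rightarrow> particle" where
  "list_top i xs = (case xs of [] \<Rightarrow> (i, i, 0) | x # _ \<Rightarrow> x)"

lemma list_top_simps [simp]: "list_top i [] = (i, i, 0)" "list_top i (x # xs) = x"
  by (simp_all add: list_top_def)

text \<open>
  The difference conditions for two factors of which the second is the larger one: each letter costs one
  degree unless it moves in the direction of nesting, \<open>r\<close> up and \<open>s\<close> down. In
  equal degrees both must move, in adjacent degrees at least one.
\<close>

definition precedes :: "particle \<Rightarrow> particle \<Rightarrow> bool" where
  "precedes = (\<lambda>(r, s, n) (r', s', n'). n + (if r' \<le> r then 1 else 0) + (if s \<le> s' then 1 else 0) \<le> n')"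

text \<open>
  The virtual factor \<open>(i, i, 0)\<close> below the list encodes the initial conditions:
  \<open>(r, s, 1)\<close> may not be the lowest factor, and hence may not occur, if
  \<open>r \<le> i \<le> s\<close>.
\<close>

fun admissible :: "nat \<Rightarrow> nat \<Rightarrow> nat \<Rightarrow> particle list \<Rightarrow> bool" where
  "admissible l m i [] = True"
| "admissible l m i (x # xs) = (color_range l m x \<and> precedes (list_top i xs) x \<and> admissible l m i xs)"

text \<open>
  The smallest possible height of the top letter \<open>r\<close>. The words \<open>min_psi_word\<close>
  and \<open>phi_word\<close> distribute the degree of each factor over its two letters so that the
  letters \<open>r\<close> are as low as possible.
\<close>

fun min_height :: "nat \<Rightarrow> particle list \<Rightarrow> nat" where
  "min_height i [] = 0"
| "min_height i (x # xs) = min_height i xs + descent int (fst (list_top i xs)) (fst x)"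

fun min_psi_word :: "nat \<Rightarrow> particle list \<Rightarrow> (nat \<times> nat) list" where
  "min_psi_word i [] = []"
| "min_psi_word i (x # xs) = (fst x, min_height i (x # xs)) # min_psi_word i xs"

fun phi_word :: "nat \<Rightarrow> particle list \<Rightarrow> (nat \<times> nat) list" where
  "phi_word i [] = []"
| "phi_word i (x # xs) = (Suc (fst (snd x)), snd (snd x) - min_height i (x # xs)) # phi_word i xs"

abbreviation neg_rank :: "nat \<Rightarrow> int" where "neg_rank \<equiv> \<lambda>c. - int c"

definition leading_monomial :: "nat \<Rightarrow> particle list \<Rightarrow> exponent" where
  "leading_monomial i xs = word_monomial int i (min_psi_word i xs) + word_monomial neg_rank (Suc i) (phi_word i xs)"

lemma admissible_color_range: "admissible l m i xs \<Longrightarrow> \<forall>x\<in>set xs. color_range l m x"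
  by (induction xs) auto

lemma word_top_min_psi_word: "word_top i (min_psi_word i xs) = (fst (list_top i xs), min_height i xs)"
  by (cases xs) auto

lemma word_top_phi_word: "word_top (Suc i) (phi_word i xs) = (Suc (fst (snd (list_top i xs))), snd (snd (list_top i xs)) - min_height i xs)"
  by (cases xs) auto

lemma valid_word_min_psi_word: "valid_word int i (min_psi_word i xs)"
  by (induction xs) (auto simp: word_top_min_psi_word)

lemma min_height_le: "admissible l m i xs \<Longrightarrow> min_height i xs \<le> snd (snd (list_top i xs))"
  by (induction xs) (auto simp: precedes_def descent_def split: prod.splits)

lemma valid_word_phi_word: "admissible l m i xs \<Longrightarrow> valid_word neg_rank (Suc i) (phi_word i xs)"
proof (induction xs)
  case (Cons x xs)
  then have "min_height i xs \<le> snd (snd (list_top i xs))" using min_height_le by auto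
  then show ?case using Cons by (auto simp: word_top_phi_word precedes_def descent_def split: prod.splits)
qed simp

lemma rcount_eq: "rcount i r xs = word_count int i r (min_psi_word i xs)"
proof -
  have "map fst (min_psi_word i xs) = map fst xs" by (induction xs) auto
  then show ?thesis by (simp add: rcount_def word_count_def descent_def)
qed

lemma scount_eq: "scount i s xs = word_count neg_rank (Suc i) (Suc s) (phi_word i xs)"
proof -
  have "map fst (phi_word i xs) = map Suc (map (fst \<circ> snd) xs)" by (induction xs) auto
  then show ?thesis
    by (simp add: scount_def word_count_def descent_def count_list_map_inj del: map_map)
qed

lemma keys_leading_monomial:
  assumes "admissible l m i xs" "(c, p) \<in> keys (leading_monomial i xs)"
  shows "c \<le> m \<Longrightarrow> (c, p) \<in> keys (word_monomial int i (min_psi_word i xs))"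
    and "m < c \<Longrightarrow> (c, p) \<in> keys (word_monomial neg_rank (Suc i) (phi_word i xs))"
proof -
  have 1: "c \<le> m" if "c \<in> fst ` set (min_psi_word i xs)"
    using that assms(1) by (induction xs) (auto simp: color_range_def)
  have 2: "c > m" if "c \<in> fst ` set (phi_word i xs)"
    using that assms(1) by (induction xs) (auto simp: color_range_def)
  from assms(2) have "(c, p) \<in> keys (word_monomial int i (min_psi_word i xs)) \<or> (c, p) \<in> keys (word_monomial neg_rank (Suc i) (phi_word i xs))"
    by (auto simp: leading_monomial_def keys_add_nat)
  with 1 2 keys_word_monomial
  show "c \<le> m \<Longrightarrow> (c, p) \<in> keys (word_monomial int i (min_psi_word i xs))"
    and "m < c \<Longrightarrow> (c, p) \<in> keys (word_monomial neg_rank (Suc i) (phi_word i xs))"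
    by fastforce+
qed

text \<open>
  Since \<open>r + (l - s) \<le> l\<close>, this orders factors by degree first, then by
  \<open>r - s\<close>.
\<close>

definition particle_value :: "nat \<Rightarrow> particle \<Rightarrow> nat" where
  "particle_value l = (\<lambda>(r, s, n). n * Suc l + (r + (l - s)))"

definition same_content :: "particle list \<Rightarrow> particle list \<Rightarrow> bool" where
  "same_content xs ys \<longleftrightarrow> mset (map fst xs) = mset (map fst ys) \<and>
     mset (map (fst \<circ> snd) xs) = mset (map (fst \<circ> snd) ys)"

lemma same_content_count:
  assumes "same_content xs ys"
  shows "rcount i r xs = rcount i r ys" "scount i s xs = scount i s ys"
  using assms unfolding same_content_def rcount_def scount_def by (metis count_mset)+

lemma insertion_list_poly_Cons:
  assumes "color_range l m (r, s, n)"
  shows "insertion (split_var m) (list_poly l i ((r, s, n) # ys)) =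
    (\<Sum>\<beta>\<le>nat (list_degree i ys). if gap i (r, s, n) ys + int \<beta> < 0 then 0 else
       (\<Sum>p\<le>nat (gap i (r, s, n) ys + int \<beta>).
          h_var r p * h_var (Suc s) (nat (gap i (r, s, n) ys + int \<beta>) - p) *
          insertion (split_var m) (annih_exp l (color r s) \<beta> (list_poly l i ys))))"
  using assms
  by (auto simp: color_range_def vertex_def insertion_sum insertion_mult schurz_def insertion_schur sum_distrib_right intro!: sum.cong)

text \<open>
  If the product of \<open>h\<^bsub>r,p\<^esub> h\<^bsub>s+1,q\<^esub>\<close> with some \<open>g\<close>
  contains the leading monomial of \<open>X # xs\<close>, then \<open>word_monomial_bound\<close> limits
  \<open>p\<close> and \<open>q\<close> by the two heights of \<open>X\<close>. Their sum is
  \<open>n + \<beta>\<close> minus letter counts that agree for both lists. So \<open>(r, s, n)\<close>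
  cannot exceed \<open>X\<close>, and in case of equality everything is forced, in particular
  \<open>\<beta> = 0\<close>.
\<close>

lemma leading_bound:
  assumes admissible: "admissible l m i (X # xs)" and Y: "color_range l m (r, s, n)"
    and same: "same_content (X # xs) ((r, s, n) # ys)"
    and nz: "lookup (h_var r p * h_var (Suc s) q * g) (leading_monomial i (X # xs)) \<noteq> 0"
    and pq: "int p + int q = gap i (r, s, n) ys + int \<beta>"
  shows "particle_value l (r, s, n) < particle_value l X \<or>
    X = (r, s, n) \<and> \<beta> = 0 \<and> p + rcount i r xs = min_height i (X # xs) \<and> q + scount i s xs = n - min_height i (X # xs)"
proof -
  obtain r0 s0 n0 where X: "X = (r0, s0, n0)" by (metis prod_cases3)
  have rs: "1 \<le> r" "r \<le> m" "m \<le> s" "s \<le> l" using Y by (auto simp: color_range_def)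
  have rs0: "1 \<le> r0" "r0 \<le> m" "m \<le> s0" "s0 \<le> l" using admissible X by (auto simp: color_range_def)
  have h: "min_height i (X # xs) \<le> n0" using min_height_le[OF admissible] X by simp
  have k: "p = 0 \<or> (r, p) \<in> keys (leading_monomial i (X # xs))" "q = 0 \<or> (Suc s, q) \<in> keys (leading_monomial i (X # xs))"
    using lookup_h_var_h_var_nonzero[OF nz] by auto
  have "p = 0 \<or> (r, p) \<in> keys (word_monomial int i (min_psi_word i (X # xs)))"
    using k(1) keys_leading_monomial(1)[OF admissible] rs by auto
  from word_monomial_bound[OF valid_word_min_psi_word this]
  have p: "p + rcount i r (X # xs) \<le> min_height i (X # xs) + descent int r0 r"
    unfolding rcount_eq word_top_min_psi_word by (simp add: X)
  have "q = 0 \<or> (Suc s, q) \<in> keys (word_monomial neg_rank (Suc i) (phi_word i (X # xs)))"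
    using k(2) keys_leading_monomial(2)[OF admissible] rs by auto
  from word_monomial_bound[OF valid_word_phi_word[OF admissible] this]
  have q: "q + scount i s (X # xs) \<le> (n0 - min_height i (X # xs)) + descent neg_rank (Suc s0) (Suc s)"
    unfolding scount_eq word_top_phi_word by (simp add: X)
  have c: "rcount i r (X # xs) = Suc (rcount i r ys)" "scount i s (X # xs) = Suc (scount i s ys)"
    unfolding same_content_count[OF same] by (simp_all add: rcount_def scount_def)
  have st: "descent int r0 r = (if r \<le> r0 then 1 else 0)" "descent neg_rank (Suc s0) (Suc s) = (if s0 \<le> s then 1 else 0)"
    by (simp_all add: descent_def)
  have sum: "int p + int q + int (rcount i r ys) + int (scount i s ys) = int n + int \<beta>"
    using pq by (simp add: gap_def)
  have n: "n + \<beta> \<le> n0" using p q c h sum st by (auto split: if_splits)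
  show ?thesis
  proof (cases "n < n0")
    case True
    then have "Suc n * Suc l \<le> n0 * Suc l" by (intro mult_right_mono) auto
    moreover have "r + (l - s) < Suc l" using rs by auto
    ultimately show ?thesis unfolding X particle_value_def by simp
  next
    case False
    then have e: "n = n0" "\<beta> = 0" using n by auto
    have le: "r \<le> r0" "s0 \<le> s" using p q c h sum st e by (auto split: if_splits)
    show ?thesis
    proof (cases "r = r0 \<and> s = s0")
      case True
      then have "rcount i r (X # xs) = Suc (rcount i r xs)" "scount i s (X # xs) = Suc (scount i s xs)"
        using X by (simp_all add: rcount_def scount_def)
      then show ?thesis using True X e p q c h sum st by auto
    next
      case False
      then have "r + (l - s) < r0 + (l - s0)" using le rs rs0 by auto
      then show ?thesis unfolding X particle_value_def using e by simp
    qed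
  qed
qed

lemma leading_monomial_Cons:
  "leading_monomial i ((r, s, n) # xs) = h_exponent r (min_height i ((r, s, n) # xs) - rcount i r xs) +
     h_exponent (Suc s) (n - min_height i ((r, s, n) # xs) - scount i s xs) + leading_monomial i xs"
  by (simp add: leading_monomial_def rcount_eq scount_eq ac_simps)

lemma leading_coefficient_Cons:
  assumes admissible: "admissible l m i (X # xs)" and Y: "color_range l m (r, s, n)"
    and same: "same_content (X # xs) ((r, s, n) # ys)"
    and nz: "lookup (insertion (split_var m) (list_poly l i ((r, s, n) # ys))) (leading_monomial i (X # xs)) \<noteq> 0"
  shows "particle_value l (r, s, n) < particle_value l X \<or> X = (r, s, n)"
proof -
  let ?A = "gap i (r, s, n) ys"
  let ?g = "\<lambda>\<beta>. insertion (split_var m) (annih_exp l (color r s) \<beta> (list_poly l i ys))"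
  from nz obtain \<beta> where "lookup (if ?A + int \<beta> < 0 then 0 else
       (\<Sum>p\<le>nat (?A + int \<beta>). h_var r p * h_var (Suc s) (nat (?A + int \<beta>) - p) * ?g \<beta>)) (leading_monomial i (X # xs)) \<noteq> 0"
    unfolding insertion_list_poly_Cons[OF Y] lookup_sum by (rule sum.not_neutral_contains_not_neutral)
  then have \<beta>: "?A + int \<beta> \<ge> 0" and
    "(\<Sum>p\<le>nat (?A + int \<beta>). lookup (h_var r p * h_var (Suc s) (nat (?A + int \<beta>) - p) * ?g \<beta>) (leading_monomial i (X # xs))) \<noteq> 0"
    by (auto simp: lookup_sum split: if_splits)
  then obtain p where p: "p \<le> nat (?A + int \<beta>)"
     "lookup (h_var r p * h_var (Suc s) (nat (?A + int \<beta>) - p) * ?g \<beta>) (leading_monomial i (X # xs)) \<noteq> 0"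
    by (meson sum.not_neutral_contains_not_neutral atMost_iff)
  have "int p + int (nat (?A + int \<beta>) - p) = ?A + int \<beta>" using p(1) \<beta> by simp
  from leading_bound[OF admissible Y same p(2) this] show ?thesis by auto
qed

text \<open>
  When the outermost factors agree, only the term with \<open>\<beta> = 0\<close> contributes, so the
  annihilation part of the outer operator is invisible and the coefficient is that of the tails.
\<close>

lemma leading_coefficient_Cons_eq:
  assumes admissible: "admissible l m i ((r, s, n) # xs)"
    and same: "same_content xs ys"
  shows "lookup (insertion (split_var m) (list_poly l i ((r, s, n) # ys))) (leading_monomial i ((r, s, n) # xs)) =
         lookup (insertion (split_var m) (list_poly l i ys)) (leading_monomial i xs)"
proof (cases "0 \<le> list_degree i ys")
  case True
  let ?X = "(r, s, n)"
  let ?A = "gap i ?X ys"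
  let ?g = "\<lambda>\<beta>. insertion (split_var m) (annih_exp l (color r s) \<beta> (list_poly l i ys))"
  let ?u = "leading_monomial i (?X # xs)"
  define p0 q0 where "p0 = min_height i (?X # xs) - rcount i r xs" and "q0 = n - min_height i (?X # xs) - scount i s xs"
  have Y: "color_range l m ?X" and adm': "admissible l m i xs" using admissible by auto
  have same': "same_content (?X # xs) (?X # ys)" using same by (simp add: same_content_def)
  have h: "min_height i (?X # xs) \<le> n" using min_height_le[OF admissible] by simp
  have c1: "rcount i r xs \<le> min_height i (?X # xs)"
    using word_count_le[OF valid_word_min_psi_word[of i xs], of r] by (simp add: rcount_eq word_top_min_psi_word)
  have c2: "scount i s xs \<le> n - min_height i (?X # xs)"
    using word_count_le[OF valid_word_phi_word[OF adm'], of "Suc s"] valid_word_phi_word[OF admissible] by (simp add: scount_eq word_top_phi_word)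
  have A: "?A = int p0 + int q0"
    using h c1 c2 same_content_count[OF same, of i] by (simp add: gap_def p0_def q0_def)
  have z: "lookup (h_var r p * h_var (Suc s) (nat (?A + int \<beta>) - p) * ?g \<beta>) ?u =
      (if \<beta> = 0 \<and> p = p0 then lookup (?g 0) (leading_monomial i xs) else 0)"
    if p: "p \<le> nat (?A + int \<beta>)" for \<beta> p
  proof (cases "\<beta> = 0 \<and> p = p0")
    case True
    then have "nat (?A + int \<beta>) - p = q0" using A by auto
    then show ?thesis using True unfolding leading_monomial_Cons p0_def[symmetric] q0_def[symmetric]
      by (simp add: lookup_h_var_h_var)
  next
    case False
    have "int p + int (nat (?A + int \<beta>) - p) = ?A + int \<beta>" using p A by simp
    note pq = this
    have "lookup (h_var r p * h_var (Suc s) (nat (?A + int \<beta>) - p) * ?g \<beta>) ?u = 0"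
    proof (rule ccontr)
      assume "lookup (h_var r p * h_var (Suc s) (nat (?A + int \<beta>) - p) * ?g \<beta>) ?u \<noteq> 0"
      from leading_bound[OF admissible Y same' this pq] False c1 show False by (auto simp: p0_def)
    qed
    then show ?thesis unfolding if_not_P[OF False] .
  qed
  have "lookup (insertion (split_var m) (list_poly l i (?X # ys))) ?u =
     (\<Sum>\<beta>\<le>nat (list_degree i ys). \<Sum>p\<le>nat (?A + int \<beta>). (if \<beta> = 0 \<and> p = p0 then lookup (?g 0) (leading_monomial i xs) else 0))"
    unfolding insertion_list_poly_Cons[OF Y] lookup_sum
  proof (intro sum.cong refl)
    fix \<beta>
    have "\<not> ?A + int \<beta> < 0" using A by simp
    show "lookup (if ?A + int \<beta> < 0 then 0 else
        (\<Sum>p\<le>nat (?A + int \<beta>). h_var r p * h_var (Suc s) (nat (?A + int \<beta>) - p) * ?g \<beta>)) ?u =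
      (\<Sum>p\<le>nat (?A + int \<beta>). (if \<beta> = 0 \<and> p = p0 then lookup (?g 0) (leading_monomial i xs) else 0))"
      unfolding if_not_P[OF \<open>\<not> ?A + int \<beta> < 0\<close>] lookup_sum by (intro sum.cong refl z) simp
  qed
  also have "\<dots> = (\<Sum>\<beta>\<le>nat (list_degree i ys). if \<beta> = 0 then lookup (?g 0) (leading_monomial i xs) else 0)"
    using A by (intro sum.cong refl) (auto)
  also have "\<dots> = lookup (?g 0) (leading_monomial i xs)" by simp
  finally show ?thesis by simp
next
  case False
  then have "list_poly l i ys = 0" using homog_neg[OF homog_list_poly] by auto
  then show ?thesis by simp
qed

lemma leading_coefficient_self:
  assumes "admissible l m i xs"
  shows "lookup (insertion (split_var m) (list_poly l i xs)) (leading_monomial i xs) = 1"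
  using assms
proof (induction xs)
  case Nil
  show ?case by (simp add: leading_monomial_def)
next
  case (Cons x xs)
  obtain r s n where x: "x = (r, s, n)" by (metis prod_cases3)
  have "same_content xs xs" by (simp add: same_content_def)
  then show ?case using Cons leading_coefficient_Cons_eq[of l m i r s n xs xs] unfolding x by auto
qed

lemma leading_coefficient_triangular:
  assumes "admissible l m i xs" "\<forall>y\<in>set ys. color_range l m y" "same_content xs ys"
    and "lookup (insertion (split_var m) (list_poly l i ys)) (leading_monomial i xs) \<noteq> 0"
  shows "ys = xs \<or> (map (particle_value l) ys, map (particle_value l) xs) \<in> lenlex less_than"
  using assms
proof (induction xs arbitrary: ys)
  case Nil
  then show ?case by (simp add: same_content_def)
next
  case (Cons X xs)
  then have "ys \<noteq> []" by (auto simp: same_content_def)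
  then obtain r s n ys' where ys: "ys = (r, s, n) # ys'" by (metis list.exhaust prod_cases3)
  have len: "length xs = length ys'"
    using arg_cong[of _ _ size, OF conjunct1[OF Cons.prems(3)[unfolded same_content_def]]] ys by simp
  have Y: "color_range l m (r, s, n)" using Cons.prems(2) ys by simp
  from leading_coefficient_Cons[OF Cons.prems(1) Y Cons.prems(3)[unfolded ys] Cons.prems(4)[unfolded ys]]
  show ?case
  proof
    assume "particle_value l (r, s, n) < particle_value l X"
    then show ?thesis using ys len by (simp add: Cons_lenlex_iff)
  next
    assume X: "X = (r, s, n)"
    have same: "same_content xs ys'" using Cons.prems(3) ys X by (simp add: same_content_def)
    have "lookup (insertion (split_var m) (list_poly l i ys')) (leading_monomial i xs) \<noteq> 0"
      using Cons.prems(4) leading_coefficient_Cons_eq[OF Cons.prems(1)[unfolded X] same] ys X by simp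
    then have "ys' = xs \<or> (map (particle_value l) ys', map (particle_value l) xs) \<in> lenlex less_than"
      using Cons.IH[of ys'] Cons.prems same ys by auto
    then show ?thesis using ys X by (auto simp: Cons_lenlex_iff)
  qed
qed

lemma same_content_if_list_weight_eq:
  assumes xs: "\<forall>x\<in>set xs. color_range l m x" and ys: "\<forall>x\<in>set ys. color_range l m x"
    and eq: "list_weight l i xs = list_weight l i ys"
  shows "same_content xs ys"
proof -
  have *: "count_list (map fst zs) k = 0" if "\<forall>x\<in>set zs. color_range l m x" "k > m" for zs k
    using that by (force simp: count_list_0_iff color_range_def)
  have **: "count_list (map (Suc \<circ> fst \<circ> snd) zs) k = 0" if "\<forall>x\<in>set zs. color_range l m x" "k \<le> m" for zs k
    using that by (force simp: count_list_0_iff color_range_def)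
  have e: "of_nat (count_list (map fst xs) k) - of_nat (count_list (map (Suc \<circ> fst \<circ> snd) xs) k) =
    (of_nat (count_list (map fst ys) k) - of_nat (count_list (map (Suc \<circ> fst \<circ> snd) ys) k) :: complex)" for k
    using arg_cong[OF eq, of "\<lambda>z. lookup z k"] unfolding lookup_list_weight[OF xs] lookup_list_weight[OF ys] by simp
  have "count_list (map fst xs) k = count_list (map fst ys) k" for k
    using e[of k] *[OF xs] *[OF ys] **[OF xs, of k] **[OF ys, of k] by (cases "k > m") auto
  moreover have "count_list (map (Suc \<circ> fst \<circ> snd) xs) k = count_list (map (Suc \<circ> fst \<circ> snd) ys) k" for k
    using e[of k] *[OF xs, of k] *[OF ys, of k] **[OF xs, of k] **[OF ys, of k] by (cases "k > m") auto
  moreover have "count_list (map (Suc \<circ> fst \<circ> snd) zs) (Suc k) = count_list (map (fst \<circ> snd) zs) k"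
    for zs :: "particle list" and k
    using count_list_map_inj[of Suc "map (fst \<circ> snd) zs" k] by (simp add: comp_assoc)
  then have "count_list (map (fst \<circ> snd) xs) k = count_list (map (fst \<circ> snd) ys) k" for k
    using calculation(2)[of "Suc k"] by simp
  ultimately show ?thesis
    unfolding same_content_def by (intro conjI multiset_eqI) (simp_all only: count_mset)
qed

text \<open>
  In a vanishing combination, consider the list with nonzero coefficient that is smallest in the
  length-lexicographic order of its values: its leading monomial occurs in no other term.
\<close>

theorem list_poly_independent:
  assumes F: "finite F" "\<And>xs. xs \<in> F \<Longrightarrow> admissible l m i xs \<and> list_weight l i xs = \<kappa>"
    and zero: "(\<Sum>xs\<in>F. cst (c xs) * list_poly l i xs) = 0" and "xs \<in> F"
  shows "c xs = 0"
proof (rule ccontr)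
  assume "c xs \<noteq> 0"
  define N where "N = map (particle_value l) ` {ys \<in> F. c ys \<noteq> 0}"
  have "map (particle_value l) xs \<in> N" using \<open>xs \<in> F\<close> \<open>c xs \<noteq> 0\<close> by (auto simp: N_def)
  then obtain z where z: "z \<in> N" "\<And>y. (y, z) \<in> lenlex less_than \<Longrightarrow> y \<notin> N"
    using wfE_min[OF wf_lenlex[OF wf_less_than]] by metis
  then obtain zs where zs: "zs \<in> F" "c zs \<noteq> 0" "z = map (particle_value l) zs" by (auto simp: N_def)
  have admissible: "admissible l m i zs" using F(2) zs by auto
  have *: "c ys * lookup (insertion (split_var m) (list_poly l i ys)) (leading_monomial i zs) = (if ys = zs then c zs else 0)"
    if "ys \<in> F" for ys
  proof (cases "ys = zs")
    case True
    then show ?thesis using leading_coefficient_self[OF admissible] by simp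
  next
    case False
    have "c ys = 0" if "lookup (insertion (split_var m) (list_poly l i ys)) (leading_monomial i zs) \<noteq> 0"
    proof (rule ccontr)
      assume "c ys \<noteq> 0"
      have r: "\<forall>y\<in>set ys. color_range l m y" "\<forall>y\<in>set zs. color_range l m y"
        using F(2) \<open>ys \<in> F\<close> admissible admissible_color_range by blast+
      then have "same_content zs ys"
        using F(2)[OF \<open>ys \<in> F\<close>] F(2)[OF zs(1)] by (intro same_content_if_list_weight_eq) auto
      then have "(map (particle_value l) ys, z) \<in> lenlex less_than"
        using leading_coefficient_triangular[OF admissible r(1) _ that] False zs(3) by auto
      then show False using z(2) \<open>ys \<in> F\<close> \<open>c ys \<noteq> 0\<close> by (auto simp: N_def)
    qed
    then show ?thesis using False by auto
  qed
  have "0 = lookup (insertion (split_var m) (\<Sum>ys\<in>F. cst (c ys) * list_poly l i ys)) (leading_monomial i zs)"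
    unfolding zero by simp
  also have "\<dots> = (\<Sum>ys\<in>F. c ys * lookup (insertion (split_var m) (list_poly l i ys)) (leading_monomial i zs))"
    by (simp add: insertion_sum insertion_mult lookup_sum)
  also have "\<dots> = (\<Sum>ys\<in>F. if ys = zs then c zs else 0)"
    by (intro sum.cong) (auto simp: *)
  also have "\<dots> = c zs" using F(1) zs(1) by simp
  finally show False using zs(2) by simp
qed


section \<open>Realizing every exponent by a pair of words\<close>

definition num_parts :: "exponent \<Rightarrow> nat \<Rightarrow> nat" where
  "num_parts u c = (\<Sum>x\<in>keys u. if fst x = c then lookup u x else 0)"

lemma num_parts_superset:
  "finite A \<Longrightarrow> keys u \<subseteq> A \<Longrightarrow> num_parts u c = (\<Sum>x\<in>A. if fst x = c then lookup u x else 0)"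
  unfolding num_parts_def by (intro sum.mono_neutral_left) (auto simp: in_keys_iff)

lemma num_parts_add: "num_parts (u + v) c = num_parts u c + num_parts v c"
proof -
  have "finite (keys u \<union> keys v)" by simp
  note * = num_parts_superset[OF this]
  show ?thesis
    by (subst (1 2 3) *)
       (auto simp: keys_add_nat lookup_add sum.distrib[symmetric] intro!: sum.cong)
qed

lemma num_parts_h_exponent: "num_parts (h_exponent c p) c' = (if c = c' \<and> p \<noteq> 0 then 1 else 0)"
  by (auto simp: num_parts_def h_exponent_def)

lemma num_parts_eq_0_iff: "num_parts u c = 0 \<longleftrightarrow> (\<forall>p. (c, p) \<notin> keys u)"
  by (force simp: num_parts_def in_keys_iff split: if_splits)

text \<open>
  The top entry is the one that maximizes the height (largest part plus ground state height), with ties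
  broken by the rank. Removing it leaves a word that it may legitimately follow, which allows induction
  on the number of letters.
\<close>

lemma ex_word:
  assumes "inj rk" "finite C" "keys U \<subseteq> C \<times> {1..}" "\<And>c. c \<in> C \<Longrightarrow> num_parts U c \<le> k c"
  shows "\<exists>w. valid_word rk a0 w \<and> fst ` set w \<subseteq> C \<and> (\<forall>c\<in>C. count_list (map fst w) c = k c) \<and> word_monomial rk a0 w = U"
  using assms(3,4)
proof (induction "sum k C" arbitrary: k U)
  case 0
  then have k: "k c = 0" if "c \<in> C" for c using that assms(2) by simp
  then have "num_parts U c = 0" if "c \<in> C" for c using that 0(3)[of c] by simp
  then have "x \<notin> keys U" for x
    using 0(2) by (cases x) (auto simp: num_parts_eq_0_iff)
  then have "keys U = {}" by blast
  then have "U = 0" by simp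
  then show ?case using k by (intro exI[of _ "[]"]) auto
next
  case (Suc t)
  define S where "S = {c \<in> C. k c > 0}"
  define mx where "mx = (\<lambda>c. Max (insert 0 {p. (c, p) \<in> keys U}))"
  \<comment> \<open>\<open>H c\<close> is the height that the topmost letter \<open>c\<close> must have.\<close>
  define H where "H = (\<lambda>c. mx c + descent rk a0 c + k c - 1)"
  have fin: "finite {p. (c, p) \<in> keys U}" for c
    by (rule finite_subset[of _ "snd ` keys U"]) force+
  have mx: "mx c = 0 \<or> (c, mx c) \<in> keys U" for c
    using Max_in[of "insert 0 {p. (c, p) \<in> keys U}"] fin by (auto simp: mx_def)
  have mx_ge: "p \<le> mx c" if "p = 0 \<or> (c, p) \<in> keys U" for c p
    unfolding mx_def using that fin by (intro Max_ge) auto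
  have S: "finite S" "S \<noteq> {}"
  proof -
    show "finite S" using assms(2) by (simp add: S_def)
    show "S \<noteq> {}"
    proof
      assume "S = {}"
      then have "sum k C = 0" by (auto simp: S_def intro!: sum.neutral)
      then show False using Suc(2) by simp
    qed
  qed
  \<comment> \<open>Among the letters of maximal height the one of maximal rank is the top.\<close>
  define S' where "S' = {c \<in> S. H c = Max (H ` S)}"
  have S': "finite S'" "S' \<noteq> {}"
  proof -
    have "Max (H ` S) \<in> H ` S" using S by (intro Max_in) auto
    then obtain c where "c \<in> S" "H c = Max (H ` S)" by (metis imageE)
    then show "finite S'" "S' \<noteq> {}" using S by (auto simp: S'_def)
  qed
  obtain c0 where c0: "c0 \<in> S'" "rk c0 = Max (rk ` S')"
  proof -
    have "Max (rk ` S') \<in> rk ` S'" using S' by (intro Max_in) auto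
    then show ?thesis using that by (metis imageE)
  qed
  have c0S: "c0 \<in> S" "c0 \<in> C" "k c0 > 0" using c0 by (auto simp: S'_def S_def)
  have top: "H c < H c0 \<or> H c = H c0 \<and> rk c \<le> rk c0" if "c \<in> S" for c
  proof -
    have "H c \<le> H c0" using that c0 S by (auto simp: S'_def)
    moreover have "rk c \<le> rk c0" if "H c = H c0"
      using that \<open>c \<in> S\<close> c0 S' unfolding c0(2) by (intro Max_ge) (auto simp: S'_def)
    ultimately show ?thesis by linarith
  qed
  define U' where "U' = U - h_exponent c0 (mx c0)"
  have U: "U = h_exponent c0 (mx c0) + U'"
    using mx[of c0]
    by (intro poly_mapping_eqI) (auto simp: U'_def lookup_add lookup_minus h_exponent_def lookup_single when_def in_keys_iff)
  define k' where "k' = k(c0 := k c0 - 1)"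
  have "sum k C = k c0 + sum k (C - {c0})" "sum k' C = k' c0 + sum k' (C - {c0})"
    using c0S assms(2) by (simp_all add: sum.remove)
  moreover have "sum k' (C - {c0}) = sum k (C - {c0})" by (intro sum.cong) (auto simp: k'_def)
  ultimately have t: "t = sum k' C" using Suc(2) c0S by (simp add: k'_def)
  have "keys U' \<subseteq> C \<times> {1..}" using Suc(3) U by (simp add: keys_add_nat)
  moreover have "num_parts U' c \<le> k' c" if "c \<in> C" for c
  proof (cases "c = c0")
    case True
    show ?thesis
    proof (cases "mx c0 = 0")
      case m: True
      then have "(c0, p) \<notin> keys U" for p
        using mx_ge[of p c0] Suc(3) by fastforce
      then have "num_parts U c0 = 0" by (simp add: num_parts_eq_0_iff)
      then show ?thesis using U num_parts_add[of "h_exponent c0 (mx c0)" U' c0] True by simp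
    next
      case False
      then show ?thesis using U num_parts_add[of "h_exponent c0 (mx c0)" U' c0] True Suc(4)[OF that]
        by (simp add: num_parts_h_exponent k'_def)
    qed
  next
    case False
    then show ?thesis using U num_parts_add[of "h_exponent c0 (mx c0)" U' c] Suc(4)[OF that]
      by (simp add: k'_def)
  qed
  ultimately obtain w where w: "valid_word rk a0 w" "fst ` set w \<subseteq> C"
    "\<forall>c\<in>C. count_list (map fst w) c = k' c" "word_monomial rk a0 w = U'"
    using Suc(1)[OF t] by metis
  have cnt: "word_count rk a0 c0 w = descent rk a0 c0 + (k c0 - 1)"
    using w(3) c0S by (simp add: word_count_def k'_def)
  have "snd (word_top a0 w) + descent rk (fst (word_top a0 w)) c0 \<le> H c0"
  proof (cases w)
    case Nil
    then show ?thesis using c0S by (simp add: H_def)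
  next
    case (Cons x w')
    obtain c1 h1 where x: "x = (c1, h1)" by force
    have c1: "c1 \<in> C" using w(2) Cons x by auto
    have "h1 - word_count rk a0 c1 w' = 0 \<or> (c1, h1 - word_count rk a0 c1 w') \<in> keys U"
      using w(4) U unfolding Cons x by (auto simp: keys_add_nat keys_h_exponent)
    then have "h1 - word_count rk a0 c1 w' \<le> mx c1" by (rule mx_ge)
    moreover have "word_count rk a0 c1 w' + 1 = descent rk a0 c1 + k' c1"
      using w(3) c1 unfolding Cons x by (auto simp: word_count_def)
    ultimately have h1: "h1 + 1 \<le> mx c1 + descent rk a0 c1 + k' c1" by linarith
    show ?thesis
    proof (cases "c1 = c0")
      case True
      then show ?thesis using h1 c0S Cons x by (simp add: H_def k'_def descent_def)
    next
      case False
      have "k c1 > 0" using w(3) c1 False unfolding Cons x by (fastforce simp: k'_def)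
      then have "c1 \<in> S" using c1 by (simp add: S_def)
      have "h1 \<le> H c1" using h1 False \<open>k c1 > 0\<close> by (simp add: H_def k'_def)
      moreover have "rk c1 \<noteq> rk c0" using False assms(1) by (auto dest: injD)
      ultimately show ?thesis using top[OF \<open>c1 \<in> S\<close>] Cons x by (auto simp: descent_def)
    qed
  qed
  moreover have "H c0 - word_count rk a0 c0 w = mx c0"
    unfolding cnt H_def using c0S by simp
  ultimately show ?case
    using w U c0S by (intro exI[of _ "(c0, H c0) # w"]) (auto simp: k'_def)
qed

text \<open>
  The list \<open>as\<close> contains the excess of the heights of the letters \<open>r\<close> over the
  minimal ones.
\<close>

fun psi_word :: "nat \<Rightarrow> particle list \<Rightarrow> nat list \<Rightarrow> (nat \<times> nat) list" where
  "psi_word i (x # xs) (a # as) = (fst x, min_height i (x # xs) + a) # psi_word i xs as"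
| "psi_word i xs as = []"

definition excited_monomial :: "nat \<Rightarrow> particle list \<Rightarrow> nat list \<Rightarrow> exponent" where
  "excited_monomial i xs as = word_monomial int i (psi_word i xs as) + word_monomial neg_rank (Suc i) (phi_word i xs)"

lemma map_fst_psi_word: "length as = length xs \<Longrightarrow> map fst (psi_word i xs as) = map fst xs"
  by (induction i xs as rule: psi_word.induct) auto

lemma map_fst_phi_word: "map fst (phi_word i xs) = map (Suc \<circ> fst \<circ> snd) xs"
  by (induction xs) auto

text \<open>
  A pair of valid words of the same length is turned into a list by adding their heights after the first
  word has been lowered to minimal heights; what is subtracted is a weakly decreasing sequence.
\<close>

lemma ex_list_of_words:
  assumes "length w = length v" "valid_word int i w" "valid_word neg_rank (Suc i) v"
    and "fst ` set w \<subseteq> {1..m}" "fst ` set v \<subseteq> {m+1..l+1}"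
  shows "\<exists>xs as. admissible l m i xs \<and> length as = length xs \<and> sorted_wrt (\<ge>) as \<and> psi_word i xs as = w \<and> phi_word i xs = v"
  using assms
proof (induction w v rule: list_induct2)
  case Nil
  show ?case by (intro exI[of _ "[]"]) auto
next
  case (Cons x w y v)
  obtain r h b j where xy: "x = (r, h)" "y = (b, j)" by force
  obtain xs as where xs: "admissible l m i xs" "length as = length xs" "sorted_wrt (\<ge>) as" "psi_word i xs as = w" "phi_word i xs = v"
    using Cons xy by auto
  obtain s where s: "b = Suc s" using Cons.prems(4) xy by (cases b) auto
  obtain r1 s1 n1 where t: "list_top i xs = (r1, s1, n1)" by (metis prod_cases3)
  define h0 where "h0 = min_height i xs + descent int r1 r"
  have tv: "word_top (Suc i) v = (Suc s1, n1 - min_height i xs)" using word_top_phi_word[of i xs] xs(5) t by simp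
  have tw: "word_top i w = (r1, min_height i xs + (case as of [] \<Rightarrow> 0 | a # _ \<Rightarrow> a))"
    using xs(2,4) t by (cases xs; cases as) auto
  have hm: "min_height i xs \<le> n1" using min_height_le[OF xs(1)] t by simp
  have vj: "n1 - min_height i xs + descent neg_rank (Suc s1) (Suc s) \<le> j" using Cons.prems(2) xy tv s by simp
  have wh: "min_height i xs + (case as of [] \<Rightarrow> 0 | a # _ \<Rightarrow> a) + descent int r1 r \<le> h" using Cons.prems(1) xy tw by simp
  let ?X = "(r, s, h0 + j)"
  have "admissible l m i (?X # xs)"
    using xs(1) t hm vj Cons.prems(3,4) xy s
    by (auto simp: color_range_def precedes_def h0_def descent_def split: if_splits)
  moreover have "sorted_wrt (\<ge>) ((h - h0) # as)"
    using xs(3) wh by (cases as) (auto simp: h0_def)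
  moreover have "min_height i (?X # xs) = h0" using t by (simp add: h0_def)
  then have "psi_word i (?X # xs) ((h - h0) # as) = x # w" "phi_word i (?X # xs) = y # v"
    using xs xy s wh by (auto simp: h0_def split: list.splits)
  ultimately show ?case using xs(2) by (intro exI[of _ "?X # xs"] exI[of _ "(h - h0) # as"]) auto
qed

lemma weight_h_exponent [simp]: "weight (h_exponent c p) = p"
  by (simp add: h_exponent_def)

lemma weight_excited_monomial:
  assumes "admissible l m i xs" "length as = length xs"
  shows "int (weight (excited_monomial i xs as)) = list_degree i xs + int (sum_list as)"
  using assms
proof (induction xs arbitrary: as)
  case (Cons x xs)
  obtain r s n where x: "x = (r, s, n)" by (metis prod_cases3)
  obtain a as' where as: "as = a # as'" "length as' = length xs" using Cons.prems by (cases as) auto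
  let ?h = "min_height i (x # xs)"
  have h: "?h \<le> n" using min_height_le[OF Cons.prems(1)] x by simp
  have c1: "rcount i r xs \<le> ?h"
    using word_count_le[OF valid_word_min_psi_word[of i xs], of r] x by (simp add: rcount_eq word_top_min_psi_word)
  have c2: "scount i s xs \<le> n - ?h"
    using word_count_le[OF valid_word_phi_word[of l m i xs], of "Suc s"] valid_word_phi_word[OF Cons.prems(1)] Cons.prems(1) x
    by (simp add: scount_eq word_top_phi_word)
  have c3: "word_count int i r (psi_word i xs as') = rcount i r xs"
    using as(2) by (simp add: word_count_def rcount_def descent_def map_fst_psi_word)
  have "excited_monomial i (x # xs) as = h_exponent r (?h + a - rcount i r xs) + h_exponent (Suc s) (n - ?h - scount i s xs) + excited_monomial i xs as'"
    using x as c3 by (simp add: excited_monomial_def scount_eq ac_simps)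
  then have "int (weight (excited_monomial i (x # xs) as)) = int (?h + a - rcount i r xs) + int (n - ?h - scount i s xs) + int (weight (excited_monomial i xs as'))"
    by (simp only: weight_add weight_h_exponent of_nat_add)
  also have "\<dots> = gap i x xs + int a + int (weight (excited_monomial i xs as'))"
    using h c1 c2 x by (simp add: gap_def of_nat_diff)
  finally show ?case using Cons.IH[of as'] Cons.prems as by simp
qed (simp add: excited_monomial_def)

lemma list_degree_nonneg: "admissible l m i xs \<Longrightarrow> 0 \<le> list_degree i xs"
  using weight_excited_monomial[of l m i xs "replicate (length xs) 0"] by (simp add: sum_list_replicate)

text \<open>
  The letter \<open>c\<close> occurs \<open>k c\<close> times in lists of lattice weight
  \<open>\<kappa>\<close>.
\<close>

definition has_content :: "nat \<Rightarrow> nat \<Rightarrow> nat \<Rightarrow> (nat \<Rightarrow> nat) \<Rightarrow> hvec \<Rightarrow> bool" where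
  "has_content l m i k \<kappa> \<longleftrightarrow> keys \<kappa> \<subseteq> {1..l+1} \<and> (\<Sum>c=1..m. k c) = (\<Sum>c=m+1..l+1. k c) \<and>
     (\<forall>c\<in>{1..l+1}. lookup \<kappa> c = lookup (fund_weight l i) c + (if c \<le> m then of_nat (k c) else - of_nat (k c)))"

lemma ex_excited_monomial:
  assumes m: "m \<in> {1..l}" and i: "i \<le> l" and k: "has_content l m i k \<kappa>"
    and U: "keys U \<subseteq> {1..l+1} \<times> {1..}" "\<And>c. c \<in> {1..l+1} \<Longrightarrow> num_parts U c \<le> k c"
  shows "\<exists>xs as. admissible l m i xs \<and> list_weight l i xs = \<kappa> \<and> length as = (\<Sum>c=1..m. k c) \<and> length as = length xs \<and>
     sorted_wrt (\<ge>) as \<and> excited_monomial i xs as = U"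
proof -
  \<comment> \<open>\<open>V P\<close> is the part of \<open>U\<close> in the letters that satisfy \<open>P\<close>.\<close>
  define V where "V = (\<lambda>P. Poly_Mapping.mapp (\<lambda>x v. if P (fst x) then v else 0) U)"
  have lookup_V: "lookup (V P) x = (if P (fst x) then lookup U x else 0)" for P x
    by (auto simp: V_def lookup_mapp when_def in_keys_iff)
  have keys_V: "keys (V P) = {x \<in> keys U. P (fst x)}" for P
    by (auto simp: in_keys_iff lookup_V split: if_splits)
  have U_eq: "U = V (\<lambda>c. c \<le> m) + V (\<lambda>c. m < c)"
    by (intro poly_mapping_eqI) (auto simp: lookup_add lookup_V)
  have p: "num_parts (V P) c \<le> num_parts U c" for P c
  proof -
    have "num_parts (V P) c = (\<Sum>x\<in>keys U. if fst x = c then lookup (V P) x else 0)"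
      by (rule num_parts_superset) (auto simp: keys_V)
    also have "\<dots> \<le> num_parts U c"
      unfolding num_parts_def by (intro sum_mono) (auto simp: lookup_V)
    finally show ?thesis .
  qed
  have "keys (V (\<lambda>c. c \<le> m)) \<subseteq> {1..m} \<times> {1..}" "keys (V (\<lambda>c. m < c)) \<subseteq> {m+1..l+1} \<times> {1..}"
    using U(1) by (auto simp: keys_V)
  moreover have "num_parts (V P) c \<le> k c" if "c \<in> {1..l+1}" for c P using U(2)[OF that] p le_trans by blast
  ultimately obtain w v where
    w: "valid_word int i w" "fst ` set w \<subseteq> {1..m}" "\<forall>c\<in>{1..m}. count_list (map fst w) c = k c" "word_monomial int i w = V (\<lambda>c. c \<le> m)" and
    v: "valid_word neg_rank (Suc i) v" "fst ` set v \<subseteq> {m+1..l+1}" "\<forall>c\<in>{m+1..l+1}. count_list (map fst v) c = k c" "word_monomial neg_rank (Suc i) v = V (\<lambda>c. m < c)"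
    using ex_word[of int "{1..m}" "V (\<lambda>c. c \<le> m)" k i] ex_word[of neg_rank "{m+1..l+1}" "V (\<lambda>c. m < c)" k "Suc i"] m
    by (auto simp: inj_def)
  have lw: "length w = (\<Sum>c=1..m. k c)"
    using sum_count_set[of "map fst w" "{1..m}"] w by simp
  have "length v = (\<Sum>c=m+1..l+1. k c)"
    using sum_count_set[of "map fst v" "{m+1..l+1}"] v by simp
  then have len: "length w = length v" using lw k by (simp add: has_content_def)
  obtain xs as where xs: "admissible l m i xs" "length as = length xs" "sorted_wrt (\<ge>) as" "psi_word i xs as = w" "phi_word i xs = v"
    using ex_list_of_words[OF len w(1) v(1) w(2) v(2)] by auto
  have "map fst w = map fst xs" "map fst v = map (Suc \<circ> fst \<circ> snd) xs"
    using map_fst_psi_word[OF xs(2), of i] map_fst_phi_word[of i xs] xs by auto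
  note mp = this
  have "length as = length w" using mp(1) xs(2) by (metis length_map)
  have "list_weight l i xs = \<kappa>"
  proof (rule poly_mapping_eqI)
    fix c
    have *: "count_list (map fst w) c = (if c \<in> {1..m} then k c else 0)"
            "count_list (map fst v) c = (if c \<in> {m+1..l+1} then k c else 0)"
      using w v by (auto simp: count_list_0_iff)
    show "lookup (list_weight l i xs) c = lookup \<kappa> c"
    proof (cases "c \<in> {1..l+1}")
      case True
      then show ?thesis
        using k m unfolding has_content_def lookup_list_weight[OF admissible_color_range[OF xs(1)]] mp[symmetric] * by auto
    next
      case False
      then have "lookup \<kappa> c = 0" using k by (auto simp: has_content_def in_keys_iff)
      then show ?thesis
        using False m i unfolding lookup_list_weight[OF admissible_color_range[OF xs(1)]] mp[symmetric] * by (auto simp: lookup_fund_weight)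
    qed
  qed
  moreover have "excited_monomial i xs as = U" using xs w v U_eq by (simp add: excited_monomial_def)
  ultimately show ?thesis using xs \<open>length as = length w\<close> lw by metis
qed

section \<open>Counting admissible lists\<close>

text \<open>
  Multipartitions of \<open>d\<close> indexed by \<open>C\<close>: the exponent of \<open>(c, p)\<close>
  is the multiplicity of \<open>p\<close> in the component \<open>c\<close>.
\<close>

definition exponents :: "nat set \<Rightarrow> nat \<Rightarrow> exponent set" where
  "exponents C d = {u. keys u \<subseteq> C \<times> {1..} \<and> weight u = d}"

lemma exponents_le:
  assumes "u \<in> exponents C d" "(c, p) \<in> keys u"
  shows "c \<in> C" "1 \<le> p" "p \<le> d" "lookup u (c, p) \<le> d"
proof -
  show cp: "c \<in> C" "1 \<le> p" using assms by (auto simp: exponents_def)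
  have "lookup u (c, p) * p \<le> weight u"
    unfolding weight_def using member_le_sum[of "(c, p)" "keys u" "\<lambda>x. lookup u x * snd x"] assms by simp
  then have "lookup u (c, p) * p \<le> d" using assms by (simp add: exponents_def)
  moreover have "lookup u (c, p) \<ge> 1" using assms by (simp add: in_keys_iff Suc_le_eq)
  ultimately show "p \<le> d" "lookup u (c, p) \<le> d"
    using cp mult_le_mono[of 1 "lookup u (c, p)" p p] mult_le_mono[of "lookup u (c, p)" "lookup u (c, p)" 1 p] by linarith+
qed

lemma finite_exponents:
  assumes "finite C"
  shows "finite (exponents C d)"
proof -
  have "lookup ` exponents C d \<subseteq> {f. \<forall>x. (x \<in> C \<times> {1..d} \<longrightarrow> f x \<in> {..d}) \<and> (x \<notin> C \<times> {1..d} \<longrightarrow> f x = 0)}"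
  proof (intro subsetI CollectI allI conjI impI)
    fix f :: "nat \<times> nat \<Rightarrow> nat" and x :: "nat \<times> nat" assume "f \<in> lookup ` exponents C d"
    then obtain u where u: "u \<in> exponents C d" "f = lookup u" by blast
    obtain c p where x: "x = (c, p)" by force
    show "f x \<in> {..d}"
      using exponents_le(4)[OF u(1), of c p] u(2) x by (cases "(c, p) \<in> keys u") (auto simp: in_keys_iff)
    show "f x = 0" if "x \<notin> C \<times> {1..d}"
      using exponents_le(1-3)[OF u(1), of c p] that u(2) x by (auto simp: in_keys_iff)
  qed
  moreover have "finite {f. \<forall>x. (x \<in> C \<times> {1..d} \<longrightarrow> f x \<in> {..d}) \<and> (x \<notin> C \<times> {1..d} \<longrightarrow> f x = (0::nat))}"
    using assms by (intro finite_set_of_finite_funs) auto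
  ultimately have fin: "finite (lookup ` exponents C d)" by (rule finite_subset)
  have "inj_on lookup (exponents C d)"
  proof (rule inj_onI)
    fix u v :: "exponent" assume "lookup u = lookup v"
    then show "u = v" by (intro poly_mapping_eqI) (rule fun_cong)
  qed
  with fin show ?thesis by (rule finite_imageD)
qed

lemma num_parts_le_weight:
  assumes "keys u \<subseteq> C \<times> {1..}"
  shows "num_parts u c \<le> weight u"
  unfolding num_parts_def weight_def using assms by (intro sum_mono) auto

lemma lookup_exponents: "u \<in> exponents C d \<Longrightarrow> fst x \<notin> C \<Longrightarrow> lookup u x = 0"
  using exponents_le(1)[of u C d "fst x" "snd x"] by (auto simp: in_keys_iff)

lemma sum_card_exponents_le:
  assumes "finite C" "c \<notin> C"
  shows "(\<Sum>e\<le>d. card (exponents C e) * card (exponents {c} (d - e))) \<le> card (exponents (insert c C) d)"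
proof -
  let ?S = "SIGMA e:{..d}. exponents C e \<times> exponents {c} (d - e)"
  have fin: "finite ?S"
    using assms(1) by (intro finite_SigmaI finite_cartesian_product finite_exponents) auto
  have "inj_on (\<lambda>(e, u, v). u + v) ?S"
  proof (rule inj_onI, clarsimp)
    fix e u v e' u' v'
    assume a: "u \<in> exponents C e" "v \<in> exponents {c} (d - e)" "u' \<in> exponents C e'" "v' \<in> exponents {c} (d - e')" "u + v = u' + v'"
    have z: "lookup u x = 0" "lookup u' x = 0" if "fst x = c" for x
      using a(1,3) that assms(2) by (auto intro: lookup_exponents)
    have z': "lookup v x = 0" "lookup v' x = 0" if "fst x \<noteq> c" for x
      using a(2,4) that by (auto intro: lookup_exponents)
    have s: "lookup u x + lookup v x = lookup u' x + lookup v' x" for x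
      using a(5) by (metis lookup_add)
    have "u = u'"
      by (rule poly_mapping_eqI, metis s z z' add_0_right)
    then show "e = e' \<and> u = u' \<and> v = v'" using a by (auto simp: exponents_def)
  qed
  then have "card ?S = card ((\<lambda>(e, u, v). u + v) ` ?S)" by (simp add: card_image)
  also have "\<dots> \<le> card (exponents (insert c C) d)"
    using assms by (intro card_mono finite_exponents) (auto simp: exponents_def keys_add_nat weight_add)
  finally show ?thesis using fin assms by (simp add: card_SigmaI card_cartesian_product finite_exponents)
qed

definition descending_lists :: "nat \<Rightarrow> nat \<Rightarrow> nat list set" where
  "descending_lists t e = {as. length as = t \<and> sorted_wrt (\<ge>) as \<and> sum_list as = e}"

text \<open>
  A weakly decreasing list of fixed length is determined by the multiplicities of its positive entries.
\<close>

lemma card_descending_lists_le: "finite (descending_lists t e) \<and> card (descending_lists t e) \<le> card (exponents {c} e)"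
proof -
  \<comment> \<open>The multiplicity of \<open>0\<close> is recovered from the length.\<close>
  let ?E = "\<lambda>as. sum_list (map (h_exponent c) as)"
  have lk: "lookup (?E as) (c, p) = count_list as p" if "p > 0" for as p
    using that by (induction as) (auto simp: lookup_add h_exponent_def lookup_single)
  have "inj_on ?E (descending_lists t e)"
  proof (rule inj_onI)
    fix as bs assume a: "as \<in> descending_lists t e" "bs \<in> descending_lists t e" "?E as = ?E bs"
    have c: "count_list as p = count_list bs p" if "p > 0" for p
      using lk[OF that] a(3) by metis
    define B where "B = Max (set (0 # as @ bs))"
    have B: "set as \<subseteq> {..B}" "set bs \<subseteq> {..B}"
      unfolding B_def by auto
    have "sum (count_list as) {..B} = sum (count_list bs) {..B}"
      using sum_count_set[OF B(1)] sum_count_set[OF B(2)] a by (simp add: descending_lists_def)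
    moreover have "sum (count_list zs) {..B} = count_list zs 0 + sum (count_list zs) {1..B}" for zs
      by (simp add: atMost_atLeast0 sum.atLeast_Suc_atMost)
    moreover have "sum (count_list as) {1..B} = sum (count_list bs) {1..B}"
      using c by (intro sum.cong) auto
    ultimately have "count_list as 0 = count_list bs 0" by simp
    then have "mset as = mset bs"
      using c by (intro multiset_eqI) (metis count_mset gr0I)
    moreover have "sorted (rev as)" "sorted (rev bs)"
      using a by (auto simp: descending_lists_def sorted_wrt_rev)
    ultimately have "rev as = rev bs" by (metis mset_rev properties_for_sort)
    then show "as = bs" by simp
  qed
  moreover have "?E as \<in> exponents {c} (sum_list as)" for as
    by (induction as) (auto simp: exponents_def keys_add_nat weight_add keys_h_exponent)
  then have "?E ` descending_lists t e \<subseteq> exponents {c} e" by (auto simp: descending_lists_def)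
  ultimately show ?thesis using finite_exponents[of "{c}" e] by (meson card_inj_on_le finite.emptyI finite.insertI inj_on_finite)
qed

lemma independent_family:
  fixes f :: "'a \<Rightarrow> vspace"
  assumes "\<And>F c x. finite F \<Longrightarrow> F \<subseteq> I \<Longrightarrow> (\<Sum>x\<in>F. vscale (c x) (f x)) = 0 \<Longrightarrow> x \<in> F \<Longrightarrow> c x = 0"
  shows "inj_on f I" "VP.independent (f ` I)"
proof -
  show inj: "inj_on f I"
  proof (rule inj_onI, rule ccontr)
    fix x y assume xy: "x \<in> I" "y \<in> I" "f x = f y" "x \<noteq> y"
    let ?c = "\<lambda>z. if z = x then 1 else - 1 :: complex"
    have "(\<Sum>z\<in>{x, y}. vscale (?c z) (f z)) = 0"
      using xy by (simp add: VP.scale_minus_left)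
    from assms[OF _ _ this, of x] xy show False by simp
  qed
  show "VP.independent (f ` I)"
    unfolding VP.independent_explicit_module
  proof (intro allI impI)
    fix t u v assume t: "finite t" "t \<subseteq> f ` I" "(\<Sum>v\<in>t. vscale (u v) v) = 0" "v \<in> t"
    then obtain F where F: "F \<subseteq> I" "finite F" "t = f ` F"
      using finite_subset_image[OF t(1,2)] by blast
    then have "(\<Sum>x\<in>F. vscale (u (f x)) (f x)) = 0"
      using t(3) inj by (simp add: sum.reindex inj_on_subset)
    then show "u v = 0" using assms[of F "\<lambda>x. u (f x)"] F t(4) by auto
  qed
qed

definition admissible_lists :: "nat \<Rightarrow> nat \<Rightarrow> nat \<Rightarrow> hvec \<Rightarrow> nat \<Rightarrow> particle list set" where
  "admissible_lists l m i \<kappa> d = {xs. admissible l m i xs \<and> list_weight l i xs = \<kappa> \<and> list_degree i xs = int d}"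

lemma homog_list_poly_admissible_lists: "xs \<in> admissible_lists l m i \<kappa> d \<Longrightarrow> list_poly l i xs \<in> homog l (int d)"
  using homog_list_poly[of l i xs] by (simp add: admissible_lists_def)

lemma span_monomials:
  "VP.span ((\<lambda>u. single \<kappa> (single u 1)) ` exponents {1..l} d) = single \<kappa> ` homog l (int d)"
proof
  show "VP.span ((\<lambda>u. single \<kappa> (single u 1)) ` exponents {1..l} d) \<subseteq> single \<kappa> ` homog l (int d)"
  proof (rule VP.span_minimal)
    show "VP.subspace (single \<kappa> ` homog l (int d))"
    proof (rule VP.subspaceI)
      show "0 \<in> single \<kappa> ` homog l (int d)" by (rule image_eqI[of _ _ 0]) simp_all
    qed (auto simp: vscale_single intro: homog_cst_mult homog_add simp flip: single_add)
  qed (auto simp: exponents_def homog_iff)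
  show "single \<kappa> ` homog l (int d) \<subseteq> VP.span ((\<lambda>u. single \<kappa> (single u 1)) ` exponents {1..l} d)"
  proof clarify
    fix f assume f: "f \<in> homog l (int d)"
    have "f = (\<Sum>u\<in>keys f. cst (lookup f u) * single u 1)"
      by (intro poly_mapping_eqI)
         (auto simp: lookup_sum lookup_single when_def in_keys_iff if_distrib[of "\<lambda>x. _ * x"] cong: if_cong)
    then have "single \<kappa> f = (\<Sum>u\<in>keys f. vscale (lookup f u) (single \<kappa> (single u 1)))"
      by (metis (no_types, lifting) single_sum vscale_single sum.cong)
    also have "\<dots> \<in> VP.span ((\<lambda>u. single \<kappa> (single u 1)) ` exponents {1..l} d)"
      using f by (intro VP.span_sum VP.span_scale VP.span_base) (auto simp: exponents_def homog_iff)
    finally show "single \<kappa> f \<in> VP.span ((\<lambda>u. single \<kappa> (single u 1)) ` exponents {1..l} d)" .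
  qed
qed

lemma admissible_lists_independent:
  fixes s :: "particle list \<Rightarrow> complex"
  assumes "\<And>xs. xs \<in> admissible_lists l m i \<kappa> d \<Longrightarrow> s xs \<noteq> 0"
  shows "inj_on (\<lambda>xs. single \<nu> (cst (s xs) * list_poly l i xs)) (admissible_lists l m i \<kappa> d)"
    "VP.independent ((\<lambda>xs. single \<nu> (cst (s xs) * list_poly l i xs)) ` admissible_lists l m i \<kappa> d)"
proof -
  have *: "c x = 0" if "finite F" "F \<subseteq> admissible_lists l m i \<kappa> d"
    "(\<Sum>x\<in>F. vscale (c x) (single \<nu> (cst (s x) * list_poly l i x))) = 0" "x \<in> F" for F c x
  proof -
    have sz: "single \<nu> (\<Sum>x\<in>F. cst (c x * s x) * list_poly l i x) = 0"
      using that(3) by (simp add: vscale_single single_sum cst_mult_left)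
    have "(\<Sum>x\<in>F. cst (c x * s x) * list_poly l i x) = 0"
      using arg_cong[OF sz, of "\<lambda>v. lookup v \<nu>"] by simp
    then have "c x * s x = 0"
      using that by (intro list_poly_independent[of F l m i \<kappa>]) (auto simp: admissible_lists_def)
    then show ?thesis using assms that by auto
  qed
  show "inj_on (\<lambda>xs. single \<nu> (cst (s xs) * list_poly l i xs)) (admissible_lists l m i \<kappa> d)"
    by (rule independent_family(1)) (rule *)
  show "VP.independent ((\<lambda>xs. single \<nu> (cst (s xs) * list_poly l i xs)) ` admissible_lists l m i \<kappa> d)"
    by (rule independent_family(2)) (rule *)
qed

lemma card_admissible_lists_le:
  "finite (admissible_lists l m i \<kappa> d) \<and> card (admissible_lists l m i \<kappa> d) \<le> card (exponents {1..l} d)"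
proof -
  let ?f = "\<lambda>xs. single \<kappa> (cst 1 * list_poly l i xs)" and ?g = "\<lambda>u. single \<kappa> (single u 1) :: vspace"
  note ind = admissible_lists_independent[of l m i \<kappa> d "\<lambda>_. 1" \<kappa>, OF one_neq_zero]
  have "finite (?f ` admissible_lists l m i \<kappa> d) \<and> card (?f ` admissible_lists l m i \<kappa> d) \<le> card (?g ` exponents {1..l} d)"
  proof (rule VP.independent_span_bound)
    show "?f ` admissible_lists l m i \<kappa> d \<subseteq> VP.span (?g ` exponents {1..l} d)"
      unfolding span_monomials by (auto intro!: imageI homog_cst_mult homog_list_poly_admissible_lists)
  qed (use finite_exponents ind(2) in auto)
  moreover have "card (?g ` exponents {1..l} d) \<le> card (exponents {1..l} d)"
    by (intro card_image_le finite_exponents) simp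
  ultimately show ?thesis
    using ind(1) by (auto simp: card_image dest: finite_imageD)
qed

text \<open>
  Equality in \<open>card_admissible_lists_le\<close> follows from a lower bound for the convolution with
  the number of partitions. Frequent letters guarantee that every multipartition of \<open>d\<close> has
  few enough parts to come from a pair of words.
\<close>

lemma card_admissible_lists:
  assumes m: "m \<in> {1..l}" and i: "i \<le> l" and k: "has_content l m i k \<kappa>"
    and d: "\<And>c. c \<in> {1..l+1} \<Longrightarrow> d \<le> k c"
  shows "card (admissible_lists l m i \<kappa> d) = card (exponents {1..l} d)"
proof -
  let ?a = "\<lambda>e. card (admissible_lists l m i \<kappa> e)" and ?b = "\<lambda>e. card (exponents {1..l} e)"
    and ?p = "\<lambda>e. card (exponents {l+1} e)"
  define t where "t = (\<Sum>c=1..m. k c)"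
  let ?S = "SIGMA e:{..d}. admissible_lists l m i \<kappa> e \<times> descending_lists t (d - e)"
  have fin: "finite ?S"
    by (intro finite_SigmaI finite_cartesian_product)
       (auto simp: card_admissible_lists_le[THEN conjunct1] card_descending_lists_le[THEN conjunct1])
  have "exponents {1..l+1} d \<subseteq> (\<lambda>(e, xs, as). excited_monomial i xs as) ` ?S"
  proof
    fix U assume U: "U \<in> exponents {1..l+1} d"
    then have keys: "keys U \<subseteq> {1..l+1} \<times> {1..}" and weight: "weight U = d" by (auto simp: exponents_def)
    obtain xs as where xs: "admissible l m i xs" "list_weight l i xs = \<kappa>" "length as = t" "length as = length xs"
        "sorted_wrt (\<ge>) as" "excited_monomial i xs as = U"
      using ex_excited_monomial[OF m i k keys] d num_parts_le_weight[OF keys] weight unfolding t_def by (metis le_trans)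
    have "int d = list_degree i xs + int (sum_list as)" using weight_excited_monomial[OF xs(1,4)] xs(6) weight by simp
    moreover obtain e where e: "list_degree i xs = int e" using list_degree_nonneg[OF xs(1)] nonneg_int_cases by blast
    ultimately have "(e, xs, as) \<in> ?S" using xs by (auto simp: admissible_lists_def descending_lists_def)
    then show "U \<in> (\<lambda>(e, xs, as). excited_monomial i xs as) ` ?S" using xs(6) by force
  qed
  then have "card (exponents {1..l+1} d) \<le> card ?S"
    using fin surj_card_le by blast
  also have "\<dots> = (\<Sum>e\<le>d. ?a e * card (descending_lists t (d - e)))"
    using card_admissible_lists_le card_descending_lists_le by (subst card_SigmaI) (auto simp: card_cartesian_product)
  also have "\<dots> \<le> (\<Sum>e\<le>d. ?a e * ?p (d - e))"
    using card_descending_lists_le by (intro sum_mono mult_le_mono) auto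
  finally have ge: "(\<Sum>e\<le>d. ?b e * ?p (d - e)) \<le> (\<Sum>e\<le>d. ?a e * ?p (d - e))"
    using sum_card_exponents_le[of "{1..l}" "l+1" d] by (simp add: atLeastAtMostSuc_conv)
  have le: "?a e \<le> ?b e" for e using card_admissible_lists_le by blast
  show ?thesis
  proof (rule ccontr)
    assume "?a d \<noteq> ?b d"
    then have "?a d < ?b d" using le[of d] by simp
    moreover have "0 \<in> exponents {l+1} 0" by (simp add: exponents_def)
    then have "?p 0 > 0" using finite_exponents[of "{l+1}" 0] by (auto simp: card_gt_0_iff)
    ultimately have "(\<Sum>e\<le>d. ?a e * ?p (d - e)) < (\<Sum>e\<le>d. ?b e * ?p (d - e))"
      using le by (intro sum_strict_mono_ex1) (auto intro!: bexI[of _ d])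
    then show False using ge by simp
  qed
qed

lemma admissible_lists_span:
  fixes s :: "particle list \<Rightarrow> complex"
  assumes "m \<in> {1..l}" "i \<le> l" "has_content l m i k \<kappa>" "\<And>c. c \<in> {1..l+1} \<Longrightarrow> d \<le> k c"
    and s: "\<And>xs. xs \<in> admissible_lists l m i \<kappa> d \<Longrightarrow> s xs \<noteq> 0"
  shows "VP.span ((\<lambda>xs. single \<nu> (cst (s xs) * list_poly l i xs)) ` admissible_lists l m i \<kappa> d) = single \<nu> ` homog l (int d)"
proof
  let ?f = "\<lambda>xs. single \<nu> (cst (s xs) * list_poly l i xs)" and ?g = "\<lambda>u. single \<nu> (single u 1) :: vspace"
  let ?B = "?f ` admissible_lists l m i \<kappa> d"
  note ind = admissible_lists_independent[of l m i \<kappa> d s \<nu>, OF s]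
  have B: "?B \<subseteq> single \<nu> ` homog l (int d)"
    by (auto intro!: imageI homog_cst_mult homog_list_poly_admissible_lists)
  then show "VP.span ?B \<subseteq> single \<nu> ` homog l (int d)"
    unfolding span_monomials[symmetric] by (intro VP.span_minimal VP.subspace_span)
  show "single \<nu> ` homog l (int d) \<subseteq> VP.span ?B"
  proof (rule ccontr)
    assume "\<not> ?thesis"
    then obtain v where v: "v \<in> single \<nu> ` homog l (int d)" "v \<notin> VP.span ?B" by blast
    have "VP.independent (insert v ?B)" using v(2) ind(2) by (rule VP.independent_insertI)
    moreover have "insert v ?B \<subseteq> VP.span (?g ` exponents {1..l} d)"
      unfolding span_monomials using v(1) B by blast
    ultimately have "finite (insert v ?B) \<and> card (insert v ?B) \<le> card (?g ` exponents {1..l} d)"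
      by (intro VP.independent_span_bound finite_imageI finite_exponents) simp_all
    moreover have "card (?g ` exponents {1..l} d) \<le> card (exponents {1..l} d)"
      by (intro card_image_le finite_exponents) simp
    moreover have "card (insert v ?B) = Suc (card ?B)"
    proof (rule card_insert_disjoint)
      show "finite ?B" using card_admissible_lists_le by blast
      show "v \<notin> ?B" using v(2) VP.span_base[of v ?B] by argo
    qed
    moreover have "card ?B = card (exponents {1..l} d)"
      using card_admissible_lists[OF assms(1-4)] ind(1) by (simp add: card_image)
    ultimately show False by linarith
  qed
qed


section \<open>Admissible monomials as admissible lists\<close>

lemma precedes_trans: "precedes x y \<Longrightarrow> precedes y z \<Longrightarrow> precedes x z"
  by (auto simp: precedes_def split: prod.splits if_splits)

lemma admissible_precedes:
  assumes "admissible l m i (x # xs)"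
  shows "precedes (i, i, 0) x" "y \<in> set xs \<Longrightarrow> precedes y x"
proof -
  have "precedes (i, i, 0) x \<and> (\<forall>y\<in>set xs. precedes y x)" using assms
  proof (induction xs arbitrary: x)
    case (Cons y ys)
    then have "precedes y x" by simp
    moreover have "precedes (i, i, 0) y" "\<forall>z\<in>set ys. precedes z y" using Cons by auto
    ultimately show ?case unfolding list.set by (blast intro: precedes_trans)
  qed simp
  then show "precedes (i, i, 0) x" "y \<in> set xs \<Longrightarrow> precedes y x" by auto
qed

lemma admissible_precedes_vacuum: "admissible l m i xs \<Longrightarrow> x \<in> set xs \<Longrightarrow> precedes (i, i, 0) x"
  by (induction xs) (auto dest: admissible_precedes(1) intro: admissible_precedes(1)[of l m i _ "[]"] simp del: admissible.simps(2),
      (auto)[1])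

text \<open>
  Stated with a multiset inclusion so that it also excludes repeated factors.
\<close>

lemma admissible_comparable:
  assumes "admissible l m i xs" "{#x, y#} \<subseteq># mset xs"
  shows "precedes x y \<or> precedes y x"
  using assms
proof (induction xs)
  case (Cons z xs)
  consider "z = x" | "z = y" | "{#x, y#} \<subseteq># mset xs"
  proof (cases "z = x \<or> z = y")
    case False
    have "count {#x, y#} a \<le> count (mset xs) a" for a
      using mset_subset_eq_count[OF Cons.prems(2), of a] False by (auto split: if_splits)
    then show ?thesis using that(3) by (simp add: subseteq_mset_def)
  qed (use that in auto)
  then show ?case
  proof cases
    case 1
    then have "y \<in> set xs" using Cons.prems(2) by (simp add: add_mset_commute)
    then show ?thesis using admissible_precedes(2)[OF Cons.prems(1)] 1 by auto
  next
    case 2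
    then have "{#y, x#} \<subseteq># add_mset y (mset xs)" using Cons.prems(2) by (simp add: add_mset_commute)
    then have "x \<in> set xs" by simp
    then show ?thesis using admissible_precedes(2)[OF Cons.prems(1)] 2 by auto
  qed (use Cons in auto)
qed simp

lemma x_op_hw_vector_nonzero:
  assumes "cocycle l \<epsilon>" "i \<le> l" "color_range l m (r, s, 1)"
  shows "x_op l \<epsilon> (color r s) (-1) (hw_vector l i) \<noteq> 0 \<longleftrightarrow> \<not> (r \<le> i \<and> i \<le> s)"
proof -
  obtain c where c: "c \<noteq> 0" "foldr (x_factor l \<epsilon>) [(r, s, 1)] (hw_vector l i) =
      single (list_weight l i [(r, s, 1)]) (cst c * list_poly l i [(r, s, 1)])"
    using foldr_x_factor[OF assms(1) _ assms(2), of "[(r, s, 1)]" m] assms(3) by auto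
  have "list_poly l i [(r, s, 1)] = schurz l (color r s) (gap i (r, s, 1) [])"
    by (simp add: vertex_def)
  moreover have "gap i (r, s, 1) [] = (if r \<le> i \<and> i \<le> s then - 1 else 0)"
    using assms(3) by (auto simp: gap_def rcount_def scount_def color_range_def)
  ultimately have "list_poly l i [(r, s, 1)] = (if r \<le> i \<and> i \<le> s then 0 else 1)"
    by (simp add: schurz_def)
  then have "x_op l \<epsilon> (color r s) (-1) (hw_vector l i) = single (list_weight l i [(r, s, 1)]) (if r \<le> i \<and> i \<le> s then 0 else cst c)"
    using c(2) by simp
  moreover have "single \<kappa> f = 0 \<longleftrightarrow> f = 0" for \<kappa> :: hvec and f :: fock
    by (metis lookup_single_eq lookup_zero single_zero)
  ultimately show ?thesis using c(1) cst_mult_eq_0_iff[of c 1] by simp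
qed

definition admissible_mset :: "nat \<Rightarrow> nat \<Rightarrow> nat \<Rightarrow> monomial \<Rightarrow> bool" where
  "admissible_mset l m i \<pi> \<longleftrightarrow> is_monomial l m \<pi> \<and> difference_conditions \<pi> \<and>
     (\<forall>r s. (r, s, 1) \<in># \<pi> \<longrightarrow> \<not> (r \<le> i \<and> i \<le> s))"

lemma admissible_mset_iff:
  assumes "cocycle l \<epsilon>" "i \<le> l"
  shows "admissible_mset l m i \<pi> \<longleftrightarrow> is_monomial l m \<pi> \<and> initial_conditions l \<epsilon> i \<pi> \<and> difference_conditions \<pi>"
proof -
  have "initial_conditions l \<epsilon> i \<pi> \<longleftrightarrow> (\<forall>r s. (r, s, 1) \<in># \<pi> \<longrightarrow> \<not> (r \<le> i \<and> i \<le> s))" if "is_monomial l m \<pi>"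
  proof -
    have "color_range l m (r, s, 1)" if "(r, s, 1) \<in># \<pi>" for r s
      using that \<open>is_monomial l m \<pi>\<close> by (auto simp: is_monomial_def color_range_def)
    then show ?thesis
      unfolding initial_conditions_def using x_op_hw_vector_nonzero[OF assms] by blast
  qed
  then show ?thesis unfolding admissible_mset_def by blast
qed

lemma admissible_mset_of_admissible:
  assumes "admissible l m i xs"
  shows "admissible_mset l m i (mset xs)"
proof -
  have c: "color_range l m x" if "x \<in> set xs" for x using admissible_color_range[OF assms] that by blast
  have v: "precedes (i, i, 0) x" if "x \<in> set xs" for x using admissible_precedes_vacuum[OF assms that] .
  have "is_monomial l m (mset xs)"
    unfolding is_monomial_def
  proof clarify
    fix r s n assume "(r, s, n) \<in># mset xs"
    then have "color_range l m (r, s, n)" "precedes (i, i, 0) (r, s, n)" using c v by auto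
    then show "1 \<le> r \<and> r \<le> m \<and> m \<le> s \<and> s \<le> l \<and> 1 \<le> n"
      by (auto simp: color_range_def precedes_def split: if_splits)
  qed
  moreover have "difference_conditions (mset xs)"
    unfolding difference_conditions_def
  proof (intro conjI allI impI)
    fix r s r' s' j assume "{#(r, s, j), (r', s', j)#} \<subseteq># mset xs"
    from admissible_comparable[OF assms this] show "r < r' \<and> s > s' \<or> r > r' \<and> s < s'"
      by (auto simp: precedes_def split: if_splits)
  next
    fix r s r' s' j assume a: "(r, s, j) \<in># mset xs \<and> (r', s', j + 1) \<in># mset xs"
    then have "{#(r, s, j), (r', s', j + 1)#} \<subseteq># mset xs"
      by (auto simp: subseteq_mset_def Suc_le_eq)
    from admissible_comparable[OF assms this] show "r' > r \<or> s' < s"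
      by (auto simp: precedes_def split: if_splits)
  qed
  moreover have "\<not> (r \<le> i \<and> i \<le> s)" if "(r, s, 1) \<in># mset xs" for r s
    using v[of "(r, s, 1)"] that by (auto simp: precedes_def)
  ultimately show ?thesis by (auto simp: admissible_mset_def)
qed

text \<open>
  A sorting key that breaks ties between equal degrees by \<open>r\<close>; factors of equal degree have
  distinct \<open>r\<close>.
\<close>

definition particle_key :: "nat \<Rightarrow> particle \<Rightarrow> nat" where
  "particle_key m = (\<lambda>(r, s, n). n * Suc m + r)"

lemma admissible_mset_submset:
  assumes "admissible_mset l m i (add_mset x \<pi>)"
  shows "admissible_mset l m i \<pi>"
proof -
  have sub: "A \<subseteq># add_mset x \<pi>" if "A \<subseteq># \<pi>" for A
    using that by (metis mset_subset_eq_add_right subset_mset.order_trans add_mset_add_single union_commute)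
  have mem: "y \<in># add_mset x \<pi>" if "y \<in># \<pi>" for y
    using that by simp
  have d: "difference_conditions (add_mset x \<pi>)" and "is_monomial l m (add_mset x \<pi>)"
    and "\<forall>r s. (r, s, 1) \<in># add_mset x \<pi> \<longrightarrow> \<not> (r \<le> i \<and> i \<le> s)"
    using assms by (auto simp: admissible_mset_def)
  moreover have "difference_conditions \<pi>"
    unfolding difference_conditions_def
  proof (intro conjI allI impI)
    fix r s r' s' j assume "{#(r, s, j), (r', s', j)#} \<subseteq># \<pi>"
    from sub[OF this] d show "r < r' \<and> s > s' \<or> r > r' \<and> s < s'"
      unfolding difference_conditions_def by blast
  next
    fix r s r' s' j assume "(r, s, j) \<in># \<pi> \<and> (r', s', j + 1) \<in># \<pi>"
    then have "(r, s, j) \<in># add_mset x \<pi> \<and> (r', s', j + 1) \<in># add_mset x \<pi>" using mem by blast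
    with d show "r' > r \<or> s' < s"
      unfolding difference_conditions_def by blast
  qed
  ultimately show ?thesis
    unfolding admissible_mset_def is_monomial_def using mem by blast
qed

lemma admissible_of_sorted:
  assumes "sorted_wrt (\<lambda>x y. particle_key m y \<le> particle_key m x) xs" "admissible_mset l m i (mset xs)"
  shows "admissible l m i xs"
  using assms
proof (induction xs)
  case (Cons x xs)
  obtain r s n where x: "x = (r, s, n)" by (metis prod_cases3)
  have IH: "admissible l m i xs" using Cons admissible_mset_submset[of l m i x "mset xs"] by simp
  have rs: "1 \<le> r" "r \<le> m" "m \<le> s" "s \<le> l" "1 \<le> n"
    using Cons.prems(2) x by (auto simp: admissible_mset_def is_monomial_def)
  have "precedes (list_top i xs) x"
  proof (cases xs)
    case Nil
    have "n \<noteq> 1 \<or> \<not> (r \<le> i \<and> i \<le> s)" using Cons.prems(2) x by (auto simp: admissible_mset_def)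
    then show ?thesis using Nil x rs by (auto simp: precedes_def)
  next
    case (Cons y ys)
    obtain r1 s1 n1 where y: "y = (r1, s1, n1)" by (metis prod_cases3)
    have "r1 \<le> m"
      using Cons.prems(2) x y Cons by (auto simp: admissible_mset_def is_monomial_def)
    have key: "n1 * Suc m + r1 \<le> n * Suc m + r"
      using Cons.prems(1) x y Cons by (simp add: particle_key_def)
    have "n1 \<le> n"
    proof (rule ccontr)
      assume "\<not> n1 \<le> n"
      then have "Suc n * Suc m \<le> n1 * Suc m" by (intro mult_right_mono) auto
      then show False using key rs by simp
    qed
    have d: "difference_conditions (mset (x # xs))" using Cons.prems(2) by (simp add: admissible_mset_def)
    consider "n1 = n" | "n = n1 + 1" | "n \<ge> n1 + 2" using \<open>n1 \<le> n\<close> by linarith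
    then show ?thesis
    proof cases
      case 1
      have "{#(r1, s1, n), (r, s, n)#} \<subseteq># mset (x # xs)"
        using Cons x y 1 by (simp add: add_mset_commute)
      then have "r1 < r \<and> s1 > s \<or> r1 > r \<and> s1 < s"
        using d unfolding difference_conditions_def by blast
      then show ?thesis using key 1 Cons x y by (auto simp: precedes_def)
    next
      case 2
      have "(r1, s1, n1) \<in># mset (x # xs) \<and> (r, s, n1 + 1) \<in># mset (x # xs)"
        using Cons x y 2 by simp
      then have "r > r1 \<or> s < s1"
        using d unfolding difference_conditions_def by blast
      then show ?thesis using 2 Cons x y by (auto simp: precedes_def)
    next
      case 3
      then show ?thesis using Cons x y by (auto simp: precedes_def)
    qed
  qed
  then show ?case using IH rs x by (simp add: color_range_def)
qed simp

lemma ex_admissible_list: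
  assumes "admissible_mset l m i \<pi>"
  shows "\<exists>xs. admissible l m i xs \<and> mset xs = \<pi>"
proof -
  obtain ys where ys: "mset ys = \<pi>" using ex_mset by blast
  let ?xs = "rev (sort_key (particle_key m) ys)"
  have "sorted_wrt (\<lambda>x y. particle_key m y \<le> particle_key m x) ?xs"
    using sorted_sort_key[of "particle_key m" ys] by (simp add: sorted_wrt_rev sorted_map)
  moreover have "mset ?xs = \<pi>" using ys by simp
  ultimately show ?thesis using admissible_of_sorted assms by metis
qed

section \<open>Weight subspaces\<close>

lemma lookup_vscale: "lookup (vscale c v) \<kappa> = cst c * lookup v \<kappa>"
  using lookup_single_mult_add[of 0 "single 0 c" v \<kappa>] by (simp add: vscale_def cst_def)

lemma lookup_heis_0: "lookup (heis l h 0 v) \<kappa> = cst (tform h \<kappa>) * lookup v \<kappa>"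
  by (auto simp: heis_def lookup_mapp fscale_def cst_def when_def in_keys_iff)

lemma lookup_deg_op:
  "lookup (lookup (deg_op v) \<kappa>) u = (- of_nat (weight u) - tform \<kappa> \<kappa> / 2) * lookup (lookup v \<kappa>) u"
proof -
  have w: "(\<Sum>(i, n)\<in>keys u. of_nat (lookup u (i, n) * n)) = (of_nat (weight u) :: complex)" for u
    by (auto simp: weight_def intro!: sum.cong)
  have s: "cst a * single u b = single u (a * b)" for a b u
    by (simp add: cst_def mult_single)
  let ?e = "\<lambda>\<kappa> u. - of_nat (weight u) - tform \<kappa> \<kappa> / 2"
  let ?i = "\<lambda>\<kappa>. \<Sum>u\<in>keys (lookup v \<kappa>). single u (?e \<kappa> u * lookup (lookup v \<kappa>) u)"
  have "deg_op v = (\<Sum>\<kappa>\<in>keys v. single \<kappa> (?i \<kappa>))"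
    unfolding deg_op_def w vscale_single s by (simp add: single_sum)
  then have "lookup (deg_op v) \<kappa> = (\<Sum>\<kappa>'\<in>keys v. if \<kappa>' = \<kappa> then ?i \<kappa> else 0)"
    by (auto simp: lookup_sum lookup_single when_def intro!: sum.cong)
  also have "\<dots> = (if \<kappa> \<in> keys v then ?i \<kappa> else 0)" by simp
  finally have "lookup (lookup (deg_op v) \<kappa>) u =
      (if \<kappa> \<in> keys v then (\<Sum>u'\<in>keys (lookup v \<kappa>). if u' = u then ?e \<kappa> u * lookup (lookup v \<kappa>) u else 0) else 0)"
    by (auto simp: lookup_sum lookup_single when_def intro!: sum.cong)
  also have "\<dots> = ?e \<kappa> u * lookup (lookup v \<kappa>) u"
    by (auto simp: in_keys_iff)
  finally show ?thesis .
qed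

text \<open>
  The eigenvalue on the monomial with exponent \<open>u\<close> in the component \<open>\<kappa>\<close>.
\<close>

definition eigen :: "hvec \<Rightarrow> exponent \<Rightarrow> hvec \<times> complex \<times> complex \<Rightarrow> complex" where
  "eigen \<kappa> u = (\<lambda>(h, a, b). tform h \<kappa> + a + b * (- of_nat (weight u) - tform \<kappa> \<kappa> / 2))"

lemma lookup_cartan_act:
  "lookup (lookup (cartan_act l x v) \<kappa>) u = eigen \<kappa> u x * lookup (lookup v \<kappa>) u"
  by (cases x) (simp add: cartan_act_def eigen_def lookup_add lookup_heis_0 lookup_vscale lookup_deg_op distrib_right)

lemma weight_subspace_iff:
  "v \<in> weight_subspace l i \<mu> \<longleftrightarrow> v \<in> L_module l i \<and>
     (\<forall>x\<in>cartan l \<times> UNIV. \<forall>\<kappa> u. u \<in> keys (lookup v \<kappa>) \<longrightarrow> eigen \<kappa> u x = \<mu> x)"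
proof -
  have "cartan_act l x v = vscale (\<mu> x) v \<longleftrightarrow> (\<forall>\<kappa> u. u \<in> keys (lookup v \<kappa>) \<longrightarrow> eigen \<kappa> u x = \<mu> x)" for x
  proof -
    have "cartan_act l x v = vscale (\<mu> x) v \<longleftrightarrow>
       (\<forall>\<kappa> u. lookup (lookup (cartan_act l x v) \<kappa>) u = lookup (lookup (vscale (\<mu> x) v) \<kappa>) u)"
      by (simp add: poly_mapping_eq_iff fun_eq_iff)
    then show ?thesis by (simp add: lookup_cartan_act lookup_vscale in_keys_iff) blast
  qed
  then show ?thesis by (auto simp: weight_subspace_def)
qed

lemma root_lattice_diff: "a \<in> root_lattice l \<Longrightarrow> b \<in> root_lattice l \<Longrightarrow> a - b \<in> root_lattice l"
proof -
  assume a: "a \<in> root_lattice l" "b \<in> root_lattice l"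
  have "a - b = a + hscale (of_int (- 1)) b"
    by (intro poly_mapping_eqI) (simp add: lookup_add lookup_minus)
  then show ?thesis using root_lattice_closed(1)[OF a(1) root_lattice_closed(2)[OF a(2), of "- 1"]] by (simp only:)
qed

lemma root_lattice_coords:
  assumes "q \<in> root_lattice l"
  shows "keys q \<subseteq> {1..l+1}" "\<exists>z. \<forall>c. lookup q c = of_int (z c)" "(\<Sum>c=1..l+1. lookup q c) = 0"
proof -
  obtain c where c: "q = (\<Sum>i=1..l. hscale (of_int (c i)) (simple_root i))"
    using assms unfolding root_lattice_def by blast
  have lk: "lookup q k = (\<Sum>i=1..l. of_int (c i * ((if k = i then 1 else 0) - (if k = Suc i then 1 else 0))))" for k
    unfolding c by (auto simp: lookup_sum simple_root_def lookup_minus lookup_single when_def intro!: sum.cong)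
  show "keys q \<subseteq> {1..l+1}"
  proof
    fix k assume "k \<in> keys q"
    then have "lookup q k \<noteq> 0" by (simp add: in_keys_iff)
    then obtain i where "i \<in> {1..l}" "(of_int (c i * ((if k = i then 1 else 0) - (if k = Suc i then 1 else 0))) :: complex) \<noteq> 0"
      unfolding lk by (rule sum.not_neutral_contains_not_neutral)
    then show "k \<in> {1..l+1}" by (auto split: if_splits)
  qed
  show "\<exists>z. \<forall>c. lookup q c = of_int (z c)"
    unfolding lk of_int_sum[symmetric] by (rule exI, rule allI, rule refl)
  have "(\<Sum>k=1..l+1. lookup q k) = (\<Sum>i=1..l. \<Sum>k=1..l+1. of_int (c i * ((if k = i then 1 else 0) - (if k = Suc i then 1 else 0))))"
    unfolding lk by (rule sum.swap)
  also have "\<dots> = (\<Sum>i=1..l. of_int (c i) * ((\<Sum>k=1..l+1. if k = i then 1 else 0) - (\<Sum>k=1..l+1. if k = Suc i then 1 else 0)))"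
    unfolding sum_subtractf[symmetric] sum_distrib_left by (intro sum.cong refl) simp
  also have "\<dots> = 0" by (intro sum.neutral) auto
  finally show "(\<Sum>c=1..l+1. lookup q c) = 0" .
qed

lemma L_module_iff:
  "v \<in> L_module l i \<longleftrightarrow> (\<forall>\<kappa>\<in>keys v. \<kappa> - fund_weight l i \<in> root_lattice l) \<and> (\<forall>\<kappa>. lookup v \<kappa> \<in> fock_module l)"
proof -
  let ?w = "fund_weight l i"
  have lk: "lookup (emult \<nu> v) \<kappa> = lookup v (\<kappa> - \<nu>)" for \<nu> v \<kappa>
    using lookup_single_mult_add[of \<nu> 1 v "\<kappa> - \<nu>"] by (simp add: emult_def)
  show ?thesis
  proof
    assume "v \<in> L_module l i"
    then obtain v' where "v = emult ?w v'" "v' \<in> lattice_module l (root_lattice l)"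
      unfolding L_module_def by blast
    then show "(\<forall>\<kappa>\<in>keys v. \<kappa> - ?w \<in> root_lattice l) \<and> (\<forall>\<kappa>. lookup v \<kappa> \<in> fock_module l)"
      by (auto simp: lattice_module_def lk in_keys_iff subset_iff)
  next
    assume a: "(\<forall>\<kappa>\<in>keys v. \<kappa> - ?w \<in> root_lattice l) \<and> (\<forall>\<kappa>. lookup v \<kappa> \<in> fock_module l)"
    have "emult (- ?w) v \<in> lattice_module l (root_lattice l)"
      unfolding lattice_module_def
    proof (intro CollectI conjI subsetI allI)
      fix \<kappa> assume "\<kappa> \<in> keys (emult (- ?w) v)"
      then have "\<kappa> + ?w \<in> keys v" by (simp add: in_keys_iff lk)
      with a have "\<kappa> + ?w - ?w \<in> root_lattice l" by blast
      then show "\<kappa> \<in> root_lattice l" by simp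
    qed (use a in \<open>simp add: lk\<close>)
    moreover have v: "v = emult ?w (emult (- ?w) v)"
      by (rule poly_mapping_eqI) (simp add: lk)
    ultimately show "v \<in> L_module l i" unfolding L_module_def by (rule image_eqI[rotated])
  qed
qed

text \<open>
  The Cartan subalgebra separates the weights of one coset of the root lattice, and the degree operator
  then separates the degrees. If \<open>\<mu>\<close> is not a weight, the space is zero.
\<close>

lemma weight_subspace_cases:
  obtains "weight_subspace l i \<mu> = {0}"
  | \<kappa> d where "\<kappa> - fund_weight l i \<in> root_lattice l" "weight_subspace l i \<mu> = single \<kappa> ` homog l (int d)"
proof (cases "\<exists>v \<in> weight_subspace l i \<mu>. v \<noteq> 0")
  case False
  moreover have "0 \<in> weight_subspace l i \<mu>"
    by (simp add: weight_subspace_iff L_module_iff fock_module_def)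
  ultimately show ?thesis using that(1) by blast
next
  case True
  then obtain v where v: "v \<in> weight_subspace l i \<mu>" "v \<noteq> 0" by blast
  then obtain \<kappa> where "\<kappa> \<in> keys v" by fastforce
  then have \<kappa>: "\<kappa> - fund_weight l i \<in> root_lattice l"
    using v(1) by (simp add: weight_subspace_iff L_module_iff)
  have "lookup v \<kappa> \<noteq> 0" using \<open>\<kappa> \<in> keys v\<close> by (simp add: in_keys_iff)
  then have "keys (lookup v \<kappa>) \<noteq> {}" by simp
  then obtain u where u: "u \<in> keys (lookup v \<kappa>)" by blast
  have \<mu>: "\<mu> x = eigen \<kappa> u x" if "x \<in> cartan l \<times> UNIV" for x
    using v(1) u that by (auto simp: weight_subspace_iff)
  have uniq: "\<kappa>' = \<kappa> \<and> weight u' = weight u"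
    if e: "\<And>x. x \<in> cartan l \<times> UNIV \<Longrightarrow> eigen \<kappa>' u' x = eigen \<kappa> u x"
      and q: "\<kappa>' - fund_weight l i \<in> root_lattice l" for \<kappa>' u'
  proof -
    have "\<kappa>' - fund_weight l i - (\<kappa> - fund_weight l i) \<in> root_lattice l"
      by (rule root_lattice_diff[OF q \<kappa>])
    then have Q: "\<kappa>' - \<kappa> \<in> root_lattice l" by simp
    have eq: "lookup (\<kappa>' - \<kappa>) a = lookup (\<kappa>' - \<kappa>) 1" if a: "a \<in> {1..l+1}" for a
    proof (cases "a = 1")
      case False
      let ?h = "single a 1 - single 1 1 :: hvec"
      have "keys ?h \<subseteq> {1..l+1}" using a keys_diff[of "single a 1" "single 1 1 :: hvec"] by auto
      moreover have "(\<Sum>k=1..l+1. lookup ?h k) = 0"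
        using a by (simp add: lookup_minus lookup_single when_def sum_subtractf del: sum.cl_ivl_Suc)
      ultimately have "(?h, 0, 0) \<in> cartan l \<times> UNIV" by (simp add: cartan_def)
      from e[OF this] have "tform ?h \<kappa>' = tform ?h \<kappa>" by (simp add: eigen_def)
      then show ?thesis using False by (simp add: tform_root lookup_minus algebra_simps)
    qed simp
    have "(\<Sum>k=1..l+1. lookup (\<kappa>' - \<kappa>) k) = (\<Sum>k=1..l+1. lookup (\<kappa>' - \<kappa>) 1)"
      by (intro sum.cong refl eq)
    then have "of_nat (l + 1) * lookup (\<kappa>' - \<kappa>) 1 = 0"
      using root_lattice_coords(3)[OF Q] by simp
    then have z: "lookup (\<kappa>' - \<kappa>) 1 = 0" by (simp del: of_nat_Suc of_nat_add)
    have "lookup (\<kappa>' - \<kappa>) a = 0" for a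
    proof (cases "a \<in> {1..l+1}")
      case True
      then show ?thesis using trans[OF eq z] by blast
    next
      case False
      then show ?thesis using root_lattice_coords(1)[OF Q] by (meson in_keys_iff subsetD)
    qed
    then have "\<kappa>' - \<kappa> = 0" by (intro poly_mapping_eqI) simp
    then have \<kappa>': "\<kappa>' = \<kappa>" by simp
    have "(0, 0, 1) \<in> cartan l \<times> UNIV" by (simp add: cartan_def)
    from e[OF this] \<kappa>' show ?thesis by (simp add: eigen_def)
  qed
  have "weight_subspace l i \<mu> = single \<kappa> ` homog l (int (weight u))"
  proof (intro equalityI subsetI)
    fix w assume w: "w \<in> weight_subspace l i \<mu>"
    have c: "\<kappa>' = \<kappa> \<and> weight u' = weight u" if "u' \<in> keys (lookup w \<kappa>')" for \<kappa>' u'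
    proof (rule uniq)
      fix x :: "hvec \<times> complex \<times> complex" assume "x \<in> cartan l \<times> UNIV"
      then show "eigen \<kappa>' u' x = eigen \<kappa> u x" using w that \<mu> by (auto simp: weight_subspace_iff)
    next
      have "\<kappa>' \<in> keys w" using that by (auto simp: in_keys_iff)
      then show "\<kappa>' - fund_weight l i \<in> root_lattice l"
        using w by (simp add: weight_subspace_iff L_module_iff)
    qed
    have "w = single \<kappa> (lookup w \<kappa>)"
    proof (rule poly_mapping_eqI)
      fix \<kappa>'
      have "lookup w \<kappa>' = 0" if "\<kappa>' \<noteq> \<kappa>"
        using c that by (metis ex_in_conv keys_eq_empty)
      then show "lookup w \<kappa>' = lookup (single \<kappa> (lookup w \<kappa>)) \<kappa>'"
        by (auto simp: lookup_single when_def)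
    qed
    moreover have "lookup w \<kappa> \<in> homog l (int (weight u))"
      using c w by (auto simp: homog_def weight_subspace_iff L_module_iff)
    ultimately show "w \<in> single \<kappa> ` homog l (int (weight u))" by blast
  next
    fix w assume "w \<in> single \<kappa> ` homog l (int (weight u))"
    then obtain f where f: "w = single \<kappa> f" "f \<in> homog l (int (weight u))" by blast
    have "eigen \<kappa>' u' x = \<mu> x" if "x \<in> cartan l \<times> UNIV" "u' \<in> keys (lookup w \<kappa>')" for x \<kappa>' u'
    proof -
      have "\<kappa>' = \<kappa>" "weight u' = weight u"
        using that(2) f by (auto simp: lookup_single when_def homog_def split: if_splits)
      then show ?thesis using \<mu>[OF that(1)] by (simp add: eigen_def)
    qed
    moreover have "w \<in> L_module l i"
      using f \<kappa> by (auto simp: L_module_iff lookup_single when_def homog_def fock_module_def)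
    ultimately show "w \<in> weight_subspace l i \<mu>" by (simp add: weight_subspace_iff)
  qed
  then show ?thesis using that(2)[OF \<kappa>] by blast
qed


section \<open>The translation operator\<close>

definition color_sum :: "nat \<Rightarrow> nat \<Rightarrow> hvec" where
  "color_sum l m = (\<Sum>\<gamma>\<in>colors l m. \<gamma>)"

lemma lookup_color_sum:
  assumes m: "m \<in> {1..l}"
  shows "lookup (color_sum l m) c = (if c \<in> {1..m} then of_nat (l + 1 - m) else if c \<in> {m+1..l+1} then - of_nat m else 0)"
proof -
  have inj: "inj_on (\<lambda>(r, s). color r s) ({1..m} \<times> {m..l})"
  proof (rule inj_onI, clarify)
    fix r s r' s' assume a: "r \<in> {1..m}" "s \<in> {m..l}" "r' \<in> {1..m}" "s' \<in> {m..l}" "color r s = color r' s'"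
    have e: "lookup (color r s) k = lookup (color r' s') k" for k using a(5) by simp
    show "r = r' \<and> s = s'"
      using a(1-4) e[of r] e[of "Suc s"] by (auto simp: lookup_color split: if_splits)
  qed
  have "colors l m = (\<lambda>(r, s). color r s) ` ({1..m} \<times> {m..l})"
    unfolding colors_eq[OF m] by force
  then have "color_sum l m = (\<Sum>(r, s)\<in>{1..m} \<times> {m..l}. color r s)"
    unfolding color_sum_def using inj by (simp add: sum.reindex case_prod_unfold)
  then have "lookup (color_sum l m) c = (\<Sum>r=1..m. \<Sum>s=m..l. lookup (color r s) c)"
    by (simp add: lookup_sum sum.cartesian_product case_prod_unfold)
  also have "\<dots> = (\<Sum>r=1..m. \<Sum>s=m..l. (if c = r then 1 else 0) - (if c = Suc s then 1 else 0))"
    by (intro sum.cong refl) (auto simp: lookup_color)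
  also have "\<dots> = (\<Sum>r=1..m. if c = r then of_nat (l + 1 - m) else 0) - (\<Sum>r=1..m. if c \<in> {m+1..l+1} then 1 else 0)"
  proof -
    have "(\<Sum>s=m..l. (if c = Suc s then 1 else 0) :: complex) = (if c \<in> {m+1..l+1} then 1 else 0)"
      by (cases c) auto
    moreover have "(\<Sum>s=m..l. (if c = r then 1 else 0) :: complex) = (if c = r then of_nat (l + 1 - m) else 0)" for r
      using m by auto
    ultimately show ?thesis by (simp add: sum_subtractf)
  qed
  finally show ?thesis by auto
qed

lemma e_power_single: "e_power l m n (single \<kappa> f) = single (hscale (of_int n) (color_sum l m) + \<kappa>) f"
  by (simp add: e_power_def emult_single color_sum_def)

lemma mon_vector_admissible:
  assumes "cocycle l \<epsilon>" "i \<le> l"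
  shows "\<exists>s. (\<forall>xs. admissible l m i xs \<longrightarrow> s xs \<noteq> 0) \<and>
    (\<forall>xs n. admissible l m i xs \<longrightarrow> mon_vector l m \<epsilon> i n (mset xs) =
       single (hscale (of_int n) (color_sum l m) + list_weight l i xs) (cst (s xs) * list_poly l i xs))"
proof -
  have "\<forall>xs. \<exists>c. admissible l m i xs \<longrightarrow> c \<noteq> 0 \<and>
     mon_op l \<epsilon> (mset xs) (hw_vector l i) = single (list_weight l i xs) (cst c * list_poly l i xs)"
    using foldr_x_factor[OF assms(1) admissible_color_range assms(2)] mon_op_mset[OF assms(1) admissible_color_range assms(2)]
    by metis
  then obtain s where "\<forall>xs. admissible l m i xs \<longrightarrow> s xs \<noteq> 0 \<and>
     mon_op l \<epsilon> (mset xs) (hw_vector l i) = single (list_weight l i xs) (cst (s xs) * list_poly l i xs)"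
    by metis
  then show ?thesis by (intro exI[of _ s]) (auto simp: mon_vector_def e_power_single)
qed

lemma list_poly_nonzero:
  assumes "admissible l m i xs"
  shows "list_poly l i xs \<noteq> 0"
  using leading_coefficient_self[OF assms] by auto

lemma homog_unique: "f \<in> homog l d \<Longrightarrow> f \<in> homog l d' \<Longrightarrow> f \<noteq> 0 \<Longrightarrow> d = d'"
  by (metis homog_iff keys_eq_empty ex_in_conv)

lemma basis_index_eq:
  assumes \<epsilon>: "cocycle l \<epsilon>" and i: "i \<le> l" and W: "weight_subspace l i \<mu> = single \<kappa> ` homog l (int d)"
  shows "basis_index l m \<epsilon> i \<mu> n = mset ` admissible_lists l m i (\<kappa> - hscale (of_int n) (color_sum l m)) d"
proof -
  obtain s where s: "\<And>xs. admissible l m i xs \<Longrightarrow> s xs \<noteq> 0"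
    "\<And>xs n. admissible l m i xs \<Longrightarrow> mon_vector l m \<epsilon> i n (mset xs) =
       single (hscale (of_int n) (color_sum l m) + list_weight l i xs) (cst (s xs) * list_poly l i xs)"
    using mon_vector_admissible[OF \<epsilon> i, where m = m] by blast
  have *: "mon_vector l m \<epsilon> i n (mset xs) \<in> weight_subspace l i \<mu> \<longleftrightarrow>
      xs \<in> admissible_lists l m i (\<kappa> - hscale (of_int n) (color_sum l m)) d" if admissible: "admissible l m i xs" for xs
  proof -
    let ?f = "cst (s xs) * list_poly l i xs"
    have nz: "?f \<noteq> 0"
      using s(1)[OF admissible] list_poly_nonzero[OF admissible] by (simp add: cst_mult_eq_0_iff)
    have h: "?f \<in> homog l (list_degree i xs)" by (intro homog_cst_mult homog_list_poly)
    have "single \<nu> ?f \<in> single \<kappa> ` homog l (int d) \<longleftrightarrow> \<nu> = \<kappa> \<and> list_degree i xs = int d" for \<nu>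
    proof
      assume "single \<nu> ?f \<in> single \<kappa> ` homog l (int d)"
      then obtain g where g: "single \<nu> ?f = single \<kappa> g" "g \<in> homog l (int d)" by blast
      then have "lookup (single \<nu> ?f) \<nu> = lookup (single \<kappa> g) \<nu>" by simp
      then have "\<nu> = \<kappa> \<and> ?f = g" using nz by (auto simp: lookup_single when_def split: if_splits)
      then show "\<nu> = \<kappa> \<and> list_degree i xs = int d" using homog_unique[OF h _ nz] g by auto
    qed (use h in auto)
    then show ?thesis
      unfolding W s(2)[OF admissible] using admissible by (auto simp: admissible_lists_def)
  qed
  show ?thesis
  proof (intro equalityI subsetI)
    fix \<pi> assume \<pi>: "\<pi> \<in> basis_index l m \<epsilon> i \<mu> n"
    then have "admissible_mset l m i \<pi>" using admissible_mset_iff[OF \<epsilon> i] by (auto simp: basis_index_def)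
    then obtain xs where "admissible l m i xs" "mset xs = \<pi>" using ex_admissible_list by blast
    then show "\<pi> \<in> mset ` admissible_lists l m i (\<kappa> - hscale (of_int n) (color_sum l m)) d"
      using \<pi> * by (auto simp: basis_index_def)
  next
    fix \<pi> assume "\<pi> \<in> mset ` admissible_lists l m i (\<kappa> - hscale (of_int n) (color_sum l m)) d"
    then obtain xs where xs: "xs \<in> admissible_lists l m i (\<kappa> - hscale (of_int n) (color_sum l m)) d" "\<pi> = mset xs" by blast
    then have "admissible l m i xs" by (simp add: admissible_lists_def)
    then show "\<pi> \<in> basis_index l m \<epsilon> i \<mu> n"
      using xs * admissible_mset_of_admissible admissible_mset_iff[OF \<epsilon> i, of m \<pi>] by (auto simp: basis_index_def)
  qed
qed

text \<open>
  Multiplication by \<open>e\<^sup>-\<^sup>n\<close> adds \<open>-n(l + 1 - m)\<close> occurrences of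
  each letter up to \<open>m\<close> and \<open>-nm\<close> occurrences of each larger letter.
\<close>

lemma ex_content:
  assumes m: "m \<in> {1..l}" and i: "i \<le> l" and \<kappa>: "\<kappa> - fund_weight l i \<in> root_lattice l"
  shows "\<exists>n\<^sub>0::int. \<forall>n\<le>n\<^sub>0.
     \<exists>k. has_content l m i k (\<kappa> - hscale (of_int n) (color_sum l m)) \<and> (\<forall>c\<in>{1..l+1}. d \<le> k c)"
proof -
  obtain z where z: "lookup (\<kappa> - fund_weight l i) c = of_int (z c)" for c
    using root_lattice_coords(2)[OF \<kappa>] by blast
  have z0: "(\<Sum>c=1..l+1. z c) = 0"
    using root_lattice_coords(3)[OF \<kappa>] unfolding z of_int_sum[symmetric] of_int_eq_0_iff .
  \<comment> \<open>Each letter must occur at least \<open>d\<close> times even after the bounded contribution \<open>z c\<close>.\<close>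
  define B where "B = int d + (\<Sum>c=1..l+1. \<bar>z c\<bar>)"
  have zB: "\<bar>z c\<bar> + int d \<le> B" if "c \<in> {1..l+1}" for c
    unfolding B_def using member_le_sum[OF that, of "\<lambda>c. \<bar>z c\<bar>"] by simp
  have "B \<ge> 0" unfolding B_def by (simp add: sum_nonneg)
  have "\<exists>k. has_content l m i k (\<kappa> - hscale (of_int n) (color_sum l m)) \<and> (\<forall>c\<in>{1..l+1}. d \<le> k c)"
    if n: "n \<le> - B" for n
  proof -
    define K where "K = (\<lambda>c. if c \<le> m then z c - n * int (l + 1 - m) else - z c - n * int m)"
    have K: "int d \<le> K c" if c: "c \<in> {1..l+1}" for c
    proof -
      have B: "B * 1 \<le> (- n) * int p" if "p \<ge> 1" for p
        using that n \<open>B \<ge> 0\<close> by (intro mult_mono) auto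
      have "B \<le> (- n) * int (l + 1 - m)" "B \<le> (- n) * int m"
        using B[of "l + 1 - m", unfolded mult_1_right] B[of m, unfolded mult_1_right] m
        by (auto simp del: of_nat_diff)
      then show ?thesis
        using zB[OF c] unfolding K_def mult_minus_left by (auto simp del: of_nat_diff)
    qed
    have K0: "K c = int (nat (K c))" if "c \<in> {1..l+1}" for c using K[OF that] by simp
    \<comment> \<open>Both halves receive the same number of letters because the coordinates of \<open>\<kappa> - \<omega>\<^sub>i\<close> sum to zero.\<close>
    have split: "{1..l+1} = {1..m} \<union> {m+1..l+1}" using m by auto
    have "(\<Sum>c=1..m. K c) = (\<Sum>c=m+1..l+1. K c)"
    proof -
      have "(\<Sum>c=1..m. z c) + (\<Sum>c=m+1..l+1. z c) = 0"
        using z0 unfolding split by (subst (asm) sum.union_disjoint) auto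
      moreover have "(\<Sum>c=1..m. K c) = (\<Sum>c=1..m. z c) - int m * (n * int (l + 1 - m))"
        by (simp add: K_def sum_subtractf)
      moreover have "(\<Sum>c=m+1..l+1. K c) = (\<Sum>c=m+1..l+1. - z c - n * int m)"
        by (intro sum.cong) (auto simp: K_def)
      then have "(\<Sum>c=m+1..l+1. K c) = - (\<Sum>c=m+1..l+1. z c) - int (l + 1 - m) * (n * int m)"
        by (simp add: sum_subtractf sum_negf)
      ultimately show ?thesis by (simp add: algebra_simps)
    qed
    moreover have "(\<Sum>c=1..m. K c) = int (\<Sum>c=1..m. nat (K c))"
      using m by (simp only: of_nat_sum) (intro sum.cong refl K0, auto)
    moreover have "(\<Sum>c=m+1..l+1. K c) = int (\<Sum>c=m+1..l+1. nat (K c))"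
      using m by (simp only: of_nat_sum) (intro sum.cong refl K0, auto)
    ultimately have sums: "(\<Sum>c=1..m. nat (K c)) = (\<Sum>c=m+1..l+1. nat (K c))" by linarith
    have lk: "lookup \<kappa> c = lookup (fund_weight l i) c + of_int (z c)" for c
      using z[of c] by (simp add: lookup_minus algebra_simps)
    have "has_content l m i (\<lambda>c. nat (K c)) (\<kappa> - hscale (of_int n) (color_sum l m))"
      unfolding has_content_def
    proof (intro conjI sums ballI subsetI)
      fix c assume c: "c \<in> keys (\<kappa> - hscale (of_int n) (color_sum l m))"
      show "c \<in> {1..l+1}"
      proof (rule ccontr)
        assume c': "c \<notin> {1..l+1}"
        then have "lookup (\<kappa> - fund_weight l i) c = 0"
          using root_lattice_coords(1)[OF \<kappa>] by (meson in_keys_iff subsetD)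
        then have "z c = 0" using z[of c] by simp
        then show False using c c' m i
          by (auto simp: in_keys_iff lookup_minus lk lookup_color_sum[OF m] lookup_fund_weight)
      qed
    next
      fix c assume c: "c \<in> {1..l+1}"
      have "(of_nat (nat (K c)) :: complex) = of_int (K c)"
        using K0[OF c] by (metis of_int_of_nat_eq)
      then show "lookup (\<kappa> - hscale (of_int n) (color_sum l m)) c = lookup (fund_weight l i) c +
          (if c \<le> m then of_nat (nat (K c)) else - of_nat (nat (K c)))"
        using c m by (auto simp: lookup_minus lk lookup_color_sum[OF m] K_def)
    qed
    moreover have "\<forall>c\<in>{1..l+1}. d \<le> nat (K c)" using K by force
    ultimately show ?thesis by blast
  qed
  then show ?thesis by blast
qed

section \<open>Translating admissible lists\<close>

text \<open>
  The list of \<open>\<pi>\<^sub>0\<close>, obtained from empty partitions: its vector has the weight of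
  \<open>e v\<^sub>i\<close> and degree \<open>0\<close>, so it is a multiple of
  \<open>e v\<^sub>i\<close>.
\<close>

lemma ex_ground_list:
  assumes m: "m \<in> {1..l}" and i: "i \<le> l"
  obtains x0 where "admissible l m i x0" "list_weight l i x0 = fund_weight l i + color_sum l m" "list_degree i x0 = 0"
proof -
  define k where "k = (\<lambda>c. if c \<le> m then l + 1 - m else m)"
  have "has_content l m i k (fund_weight l i + color_sum l m)"
    unfolding has_content_def
  proof (intro conjI ballI)
    show "keys (fund_weight l i + color_sum l m) \<subseteq> {1..l+1}"
      using m i by (auto simp: in_keys_iff lookup_add lookup_fund_weight lookup_color_sum[OF m] split: if_splits)
    have "(\<Sum>c=m+1..l+1. k c) = (\<Sum>c=m+1..l+1. m)" by (intro sum.cong) (auto simp: k_def)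
    then show "(\<Sum>c=1..m. k c) = (\<Sum>c=m+1..l+1. k c)" by (simp add: k_def)
  qed (use m in \<open>auto simp: lookup_add lookup_color_sum[OF m] k_def\<close>)
  from ex_excited_monomial[OF m i this, of 0] obtain xs as where xs: "admissible l m i xs" "list_weight l i xs = fund_weight l i + color_sum l m"
      "length as = length xs" "excited_monomial i xs as = 0"
    by (auto simp: num_parts_def)
  have "list_degree i xs + int (sum_list as) = 0" using weight_excited_monomial[OF xs(1,3)] xs(4) by simp
  then have "list_degree i xs = 0" using list_degree_nonneg[OF xs(1)] by simp
  then show ?thesis using that xs by blast
qed

definition raise :: "nat \<Rightarrow> particle \<Rightarrow> particle" where
  "raise L = (\<lambda>(r, s, n). (r, s, n + L))"

locale ground =
  fixes l m i :: nat and x0 :: "particle list"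
  assumes m: "m \<in> {1..l}" and i: "i \<le> l"
    and adm0: "admissible l m i x0" and lwt0: "list_weight l i x0 = fund_weight l i + color_sum l m" and ldeg0: "list_degree i x0 = 0"
begin

lemma count0:
  assumes "1 \<le> r" "r \<le> m" "m \<le> s" "s \<le> l"
  shows "rcount i r x0 = (if r \<le> i then 1 else 0) + (l + 1 - m)" "scount i s x0 = (if i \<le> s then 1 else 0) + m"
proof -
  note lk = lookup_list_weight[OF admissible_color_range[OF adm0], of i, unfolded lwt0 lookup_add]
  have r0: "\<forall>x\<in>set x0. color_range l m x" by (rule admissible_color_range[OF adm0])
  have "count_list (map (Suc \<circ> fst \<circ> snd) x0) r = 0"
    using r0 assms by (force simp: count_list_0_iff color_range_def)
  then have "(of_nat (count_list (map fst x0) r) :: complex) = of_nat (l + 1 - m)"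
    using lk[of r] assms unfolding lookup_color_sum[OF m] by simp
  then show "rcount i r x0 = (if r \<le> i then 1 else 0) + (l + 1 - m)"
    unfolding rcount_def of_nat_eq_iff by simp
  have "count_list (map fst x0) (Suc s) = 0"
    using r0 assms by (force simp: count_list_0_iff color_range_def)
  then have "(of_nat (count_list (map (Suc \<circ> fst \<circ> snd) x0) (Suc s)) :: complex) = of_nat m"
    using lk[of "Suc s"] assms unfolding lookup_color_sum[OF m] by simp
  then have "count_list (map (Suc \<circ> fst \<circ> snd) x0) (Suc s) = m"
    unfolding of_nat_eq_iff .
  then have "count_list (map (fst \<circ> snd) x0) s = m"
    using count_list_map_inj[of Suc "map (fst \<circ> snd) x0" s] by (simp add: comp_assoc)
  then show "scount i s x0 = (if i \<le> s then 1 else 0) + m"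
    by (simp add: scount_def)
qed

text \<open>
  On vectors this is multiplication by \<open>e\<close>, up to a scalar: \<open>x0\<close> produces
  \<open>e v\<^sub>i\<close>, and moving \<open>e\<close> to the right of a factor changes its degree by
  \<open>l + 1\<close>.
\<close>

definition translate :: "particle list \<Rightarrow> particle list" where
  "translate xs = map (raise (l + 1)) xs @ x0"

lemma precedes_raise: "precedes x y \<Longrightarrow> precedes (raise L x) (raise L y)"
  by (auto simp: precedes_def raise_def split: prod.splits if_splits)

text \<open>
  No factor of the ground list exceeds the virtual factor raised by \<open>l + 1\<close>. Its top has
  degree at most \<open>l - 1 + [r0 \<le> i] + [i \<le> s0]\<close> because \<open>gap\<close> is not
  positive there.
\<close>

lemma precedes_ground:
  assumes "color_range l m x" "precedes (i, i, 0) x"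
  shows "precedes (list_top i x0) (raise (l + 1) x)"
proof (cases x0)
  case Nil
  then show ?thesis using assms(2) by (auto simp: precedes_def raise_def split: prod.splits)
next
  case (Cons y ys)
  obtain r0 s0 n0 where y: "y = (r0, s0, n0)" by (metis prod_cases3)
  obtain r s n where x: "x = (r, s, n)" by (metis prod_cases3)
  have rs0: "1 \<le> r0" "r0 \<le> m" "m \<le> s0" "s0 \<le> l"
    using admissible_color_range[OF adm0] Cons y by (auto simp: color_range_def)
  have "gap i y ys \<le> 0" using ldeg0 list_degree_nonneg[of l m i ys] adm0 Cons by simp
  moreover have "rcount i r0 x0 = Suc (rcount i r0 ys)" "scount i s0 x0 = Suc (scount i s0 ys)"
    using Cons y by (simp_all add: rcount_def scount_def)
  ultimately have "n0 + 2 \<le> (if r0 \<le> i then 1 else 0) + (if i \<le> s0 then 1 else 0) + (l + 1)"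
    using count0[OF rs0] y m by (simp add: gap_def)
  then show ?thesis
    using assms(2) Cons x y by (auto simp: precedes_def raise_def split: if_splits)
qed

lemma admissible_translate: "admissible l m i xs \<Longrightarrow> admissible l m i (translate xs)"
proof (induction xs)
  case Nil
  then show ?case by (simp add: translate_def adm0)
next
  case (Cons x xs)
  have c: "color_range l m x" "precedes (list_top i xs) x" using Cons.prems by auto
  have "precedes (list_top i (translate xs)) (raise (l + 1) x)"
  proof (cases xs)
    case Nil
    then show ?thesis using precedes_ground[OF c(1)] c(2) by (simp add: translate_def)
  next
    case (Cons y ys)
    then show ?thesis using precedes_raise[OF c(2)] by (simp add: translate_def)
  qed
  moreover have "color_range l m (raise (l + 1) x)"
    using c(1) by (auto simp: color_range_def raise_def)
  ultimately show ?case using Cons by (simp add: translate_def)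
qed

lemma list_weight_translate: "list_weight l i (translate xs) = list_weight l i xs + color_sum l m"
proof (induction xs)
  case (Cons x xs)
  then show ?case by (cases x) (simp add: translate_def raise_def add.assoc)
qed (simp add: translate_def lwt0)

lemma gap_translate:
  assumes "color_range l m x"
  shows "gap i (raise (l + 1) x) (translate xs) = gap i x xs"
proof -
  obtain r s n where x: "x = (r, s, n)" by (metis prod_cases3)
  have rs: "1 \<le> r" "r \<le> m" "m \<le> s" "s \<le> l" using assms x by (auto simp: color_range_def)
  have e: "map fst (map (raise (l + 1)) xs) = map fst xs" "map (fst \<circ> snd) (map (raise (l + 1)) xs) = map (fst \<circ> snd) xs"
    by (auto simp: raise_def split: prod.splits)
  have "rcount i r (translate xs) = rcount i r xs + (l + 1 - m)" "scount i s (translate xs) = scount i s xs + m"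
    using count0[OF rs] unfolding rcount_def scount_def translate_def map_append count_list_append e by simp_all
  then show ?thesis using m x by (simp add: gap_def raise_def)
qed

lemma list_degree_translate: "admissible l m i xs \<Longrightarrow> list_degree i (translate xs) = list_degree i xs"
proof (induction xs)
  case (Cons x xs)
  then show ?case using gap_translate[of x xs] by (simp add: translate_def)
qed (simp add: translate_def ldeg0)

text \<open>
  Raising degrees by \<open>l + 1\<close> compensates the letters of the ground list in every
  \<open>gap\<close>, so the same operators act on a constant instead of \<open>1\<close>.
\<close>

lemma list_poly_translate:
  assumes "admissible l m i xs"
  shows "list_poly l i (translate xs) = cst (lookup (list_poly l i x0) 0) * list_poly l i xs"
  using assms
proof (induction xs)
  case Nil
  have "u = 0" if "u \<in> keys (list_poly l i x0)" for u
  proof -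
    have "u \<in> exponents {1..l} 0"
      using homog_list_poly[of l i x0] that ldeg0 by (auto simp: homog_iff exponents_def)
    then have "keys u = {}" using exponents_le(2,3)[of u "{1..l}" 0] by (metis ex_in_conv le_zero_eq not_one_le_zero surj_pair)
    then show ?thesis by simp
  qed
  then have "list_poly l i x0 = cst (lookup (list_poly l i x0) 0)"
    by (intro poly_mapping_eqI) (auto simp: cst_def lookup_single when_def in_keys_iff)
  then show ?case by (simp add: translate_def)
next
  case (Cons x xs)
  obtain r s n where x: "x = (r, s, n)" by (metis prod_cases3)
  have admissible: "admissible l m i xs" "color_range l m (r, s, n)" using Cons.prems x by auto
  have t: "translate (x # xs) = (r, s, n + (l + 1)) # translate xs" by (simp add: translate_def x raise_def)
  show ?case
    using gap_translate[OF admissible(2), of xs] list_degree_translate[OF admissible(1)] Cons.IH[OF admissible(1)]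
    unfolding x t[unfolded x] by (simp add: raise_def vertex_cst_mult)
qed

lemma ground_constant_nonzero: "lookup (list_poly l i x0) 0 \<noteq> 0"
  using list_poly_translate[of "[]"] list_poly_nonzero[OF adm0] by (auto simp: translate_def)

lemma inj_translate: "inj translate"
proof (rule injI)
  fix xs ys assume "translate xs = translate ys"
  then have "map (raise (l + 1)) xs = map (raise (l + 1)) ys" by (simp add: translate_def)
  moreover have "inj (raise (l + 1))" by (auto simp: inj_def raise_def)
  ultimately show "xs = ys" by (simp add: inj_map_eq_map)
qed

end

section \<open>Bases of weight subspaces\<close>

lemma diagonally_connected_refl: "diagonally_connected f I f I"
  unfolding diagonally_connected_def
  by (rule exI[of _ id]) (auto intro!: exI[of _ 1] simp: VP.scale_one)

lemma diagonally_connected_sym: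
  assumes "diagonally_connected f I g J"
  shows "diagonally_connected g J f I"
proof -
  obtain \<sigma> where \<sigma>: "bij_betw \<sigma> I J" "\<And>x. x \<in> I \<Longrightarrow> \<exists>c. c \<noteq> 0 \<and> g (\<sigma> x) = vscale c (f x)"
    using assms unfolding diagonally_connected_def by blast
  have "\<exists>c. c \<noteq> 0 \<and> f (the_inv_into I \<sigma> y) = vscale c (g y)" if "y \<in> J" for y
  proof -
    let ?x = "the_inv_into I \<sigma> y"
    have x: "?x \<in> I" "\<sigma> ?x = y"
      using \<sigma>(1) that by (auto simp: bij_betw_def the_inv_into_into f_the_inv_into_f)
    obtain c where c: "c \<noteq> 0" "g y = vscale c (f ?x)" using \<sigma>(2)[OF x(1)] x(2) by auto
    then have "f ?x = vscale (1 / c) (g y)" by (simp add: VP.scale_scale)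
    then show ?thesis using c(1) by (intro exI[of _ "1 / c"]) simp
  qed
  moreover have "bij_betw (the_inv_into I \<sigma>) J I" by (rule bij_betw_the_inv_into[OF \<sigma>(1)])
  ultimately show ?thesis unfolding diagonally_connected_def by blast
qed

lemma diagonally_connected_trans:
  assumes "diagonally_connected f I g J" "diagonally_connected g J h K"
  shows "diagonally_connected f I h K"
proof -
  obtain \<sigma> where \<sigma>: "bij_betw \<sigma> I J" "\<And>x. x \<in> I \<Longrightarrow> \<exists>c. c \<noteq> 0 \<and> g (\<sigma> x) = vscale c (f x)"
    using assms(1) unfolding diagonally_connected_def by blast
  obtain \<tau> where \<tau>: "bij_betw \<tau> J K" "\<And>x. x \<in> J \<Longrightarrow> \<exists>c. c \<noteq> 0 \<and> h (\<tau> x) = vscale c (g x)"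
    using assms(2) unfolding diagonally_connected_def by blast
  have "\<exists>c. c \<noteq> 0 \<and> h ((\<tau> \<circ> \<sigma>) x) = vscale c (f x)" if x: "x \<in> I" for x
  proof -
    obtain c d where "c \<noteq> 0" "g (\<sigma> x) = vscale c (f x)" "d \<noteq> 0" "h (\<tau> (\<sigma> x)) = vscale d (g (\<sigma> x))"
      using \<sigma>(2)[OF x] \<tau>(2)[of "\<sigma> x"] bij_betwE[OF \<sigma>(1)] x by blast
    then show ?thesis by (intro exI[of _ "d * c"]) (simp add: VP.scale_scale)
  qed
  then show ?thesis
    unfolding diagonally_connected_def using bij_betw_trans[OF \<sigma>(1) \<tau>(1)] by blast
qed

theorem theorem8:
  fixes l m i :: nat
    and \<epsilon> :: "hvec \<Rightarrow> hvec \<Rightarrow> complex"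
    and \<mu> :: "hvec \<times> complex \<times> complex \<Rightarrow> complex"
  assumes "1 \<le> l" and "m \<in> {1..l}" and "i \<in> {0..l}"
    and "cocycle l \<epsilon>"
  shows "\<exists>n\<^sub>0::int.
    (\<forall>n\<le>n\<^sub>0. is_basis_family (mon_vector l m \<epsilon> i n) (basis_index l m \<epsilon> i \<mu> n)
                (weight_subspace l i \<mu>)) \<and>
    (\<forall>n\<^sub>1\<le>n\<^sub>0. \<forall>n\<^sub>2\<le>n\<^sub>0.
       diagonally_connected (mon_vector l m \<epsilon> i n\<^sub>1) (basis_index l m \<epsilon> i \<mu> n\<^sub>1)
         (mon_vector l m \<epsilon> i n\<^sub>2) (basis_index l m \<epsilon> i \<mu> n\<^sub>2))"
proof -
  note m = assms(2) and \<epsilon> = assms(4)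
  have i: "i \<le> l" using assms(3) by simp
  obtain s where s: "\<And>xs. admissible l m i xs \<Longrightarrow> s xs \<noteq> 0"
    "\<And>xs n. admissible l m i xs \<Longrightarrow> mon_vector l m \<epsilon> i n (mset xs) =
       single (hscale (of_int n) (color_sum l m) + list_weight l i xs) (cst (s xs) * list_poly l i xs)"
    using mon_vector_admissible[OF \<epsilon> i, where m = m] by blast
  show ?thesis
  proof (rule weight_subspace_cases[of l i \<mu>])
    assume W: "weight_subspace l i \<mu> = {0}"
    have "\<pi> \<notin> basis_index l m \<epsilon> i \<mu> n" for \<pi> n
    proof
      assume \<pi>: "\<pi> \<in> basis_index l m \<epsilon> i \<mu> n"
      then have "admissible_mset l m i \<pi>" using admissible_mset_iff[OF \<epsilon> i] by (auto simp: basis_index_def)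
      then obtain xs where xs: "admissible l m i xs" "mset xs = \<pi>" using ex_admissible_list by blast
      then have "mon_vector l m \<epsilon> i n (mset xs) = 0" using \<pi> W by (auto simp: basis_index_def)
      then have "lookup (mon_vector l m \<epsilon> i n (mset xs)) (hscale (of_int n) (color_sum l m) + list_weight l i xs) = 0" by simp
      then have "cst (s xs) * list_poly l i xs = 0" unfolding s(2)[OF xs(1)] by simp
      then show False using s(1)[OF xs(1)] list_poly_nonzero[OF xs(1)] by (simp add: cst_mult_eq_0_iff)
    qed
    then have "basis_index l m \<epsilon> i \<mu> n = {}" for n by blast
    then show ?thesis
      by (intro exI[of _ 0]) (auto simp: is_basis_family_def W diagonally_connected_def VP.independent_empty)
  next
    fix \<kappa> d assume \<kappa>: "\<kappa> - fund_weight l i \<in> root_lattice l"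
      and W: "weight_subspace l i \<mu> = single \<kappa> ` homog l (int d)"
    define \<nu> where "\<nu> = (\<lambda>n::int. \<kappa> - hscale (of_int n) (color_sum l m))"
    define L where "L = (\<lambda>n. admissible_lists l m i (\<nu> n) d)"
    have index: "basis_index l m \<epsilon> i \<mu> n = mset ` L n" for n
      unfolding L_def \<nu>_def by (rule basis_index_eq[OF \<epsilon> i W])
    have admissible_L: "admissible l m i xs" if "xs \<in> L n" for xs n using that by (simp add: L_def admissible_lists_def)
    have vec: "mon_vector l m \<epsilon> i n (mset xs) = single \<kappa> (cst (s xs) * list_poly l i xs)" if "xs \<in> L n" for xs n
      using that s(2)[OF admissible_L[OF that]] by (simp add: L_def admissible_lists_def \<nu>_def)
    have inj: "inj_on (\<lambda>xs. single \<kappa> (cst (s xs) * list_poly l i xs)) (L n)"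
      and ind: "VP.independent ((\<lambda>xs. single \<kappa> (cst (s xs) * list_poly l i xs)) ` L n)" for n
      unfolding L_def using admissible_lists_independent[of l m i "\<nu> n" d s \<kappa>] s(1) by (auto simp: admissible_lists_def)
    have inj_mset: "inj_on mset (L n)" for n
    proof (rule inj_onI)
      fix xs ys assume a: "xs \<in> L n" "ys \<in> L n" "mset xs = mset ys"
      then have "single \<kappa> (cst (s xs) * list_poly l i xs) = single \<kappa> (cst (s ys) * list_poly l i ys)"
        using vec[OF a(1)] vec[OF a(2)] by simp
      then show "xs = ys" using inj_onD[OF inj] a by blast
    qed
    obtain n0 where n0: "\<And>n. n \<le> n0 \<Longrightarrow> \<exists>k. has_content l m i k (\<nu> n) \<and> (\<forall>c\<in>{1..l+1}. d \<le> k c)"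
      unfolding \<nu>_def using ex_content[OF m i \<kappa>, of d] by blast
    have basis: "is_basis_family (mon_vector l m \<epsilon> i n) (basis_index l m \<epsilon> i \<mu> n) (weight_subspace l i \<mu>)"
      if n: "n \<le> n0" for n
    proof -
      obtain k where k: "has_content l m i k (\<nu> n)" "\<And>c. c \<in> {1..l+1} \<Longrightarrow> d \<le> k c" using n0[OF n] by blast
      have img: "mon_vector l m \<epsilon> i n ` mset ` L n = (\<lambda>xs. single \<kappa> (cst (s xs) * list_poly l i xs)) ` L n"
        unfolding image_image by (intro image_cong refl vec)
      have "inj_on (mon_vector l m \<epsilon> i n) (mset ` L n)"
      proof (rule inj_onI)
        fix \<pi> \<pi>' assume a: "\<pi> \<in> mset ` L n" "\<pi>' \<in> mset ` L n" "mon_vector l m \<epsilon> i n \<pi> = mon_vector l m \<epsilon> i n \<pi>'"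
        then obtain xs ys where xs: "xs \<in> L n" "\<pi> = mset xs" and ys: "ys \<in> L n" "\<pi>' = mset ys" by blast
        then have "xs = ys" using a(3) vec[OF xs(1)] vec[OF ys(1)] inj_onD[OF inj, of xs ys n] by simp
        then show "\<pi> = \<pi>'" using xs ys by simp
      qed
      moreover have "VP.span ((\<lambda>xs. single \<kappa> (cst (s xs) * list_poly l i xs)) ` L n) = weight_subspace l i \<mu>"
        unfolding W L_def by (rule admissible_lists_span[OF m i k]) (auto simp: admissible_lists_def s(1))
      ultimately show ?thesis
        unfolding is_basis_family_def index img using ind by blast
    qed
    have card_L: "card (L n) = card (exponents {1..l} d)" if n: "n \<le> n0" for n
    proof -
      obtain k where "has_content l m i k (\<nu> n)" "\<And>c. c \<in> {1..l+1} \<Longrightarrow> d \<le> k c" using n0[OF n] by blast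
      then show ?thesis unfolding L_def by (intro card_admissible_lists[OF m i])
    qed
    obtain x0 where x0: "admissible l m i x0" "list_weight l i x0 = fund_weight l i + color_sum l m" "list_degree i x0 = 0"
      by (rule ex_ground_list[OF m i])
    interpret ground l m i x0 by unfold_locales (use m i x0 in auto)
    have step: "diagonally_connected (mon_vector l m \<epsilon> i n) (basis_index l m \<epsilon> i \<mu> n)
         (mon_vector l m \<epsilon> i (n - 1)) (basis_index l m \<epsilon> i \<mu> (n - 1))" if n: "n \<le> n0" for n
    proof -
      have sub: "translate ` L n \<subseteq> L (n - 1)"
      proof clarify
        fix xs assume xs: "xs \<in> L n"
        have "\<nu> (n - 1) = \<nu> n + color_sum l m"
          by (intro poly_mapping_eqI) (simp add: \<nu>_def lookup_minus lookup_add algebra_simps)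
        then show "translate xs \<in> L (n - 1)"
          using xs admissible_translate[OF admissible_L[OF xs]] list_degree_translate[OF admissible_L[OF xs]] list_weight_translate[of xs]
          by (simp add: L_def admissible_lists_def)
      qed
      have inj_t: "inj_on translate (L n)" using inj_translate by (rule inj_on_subset) simp
      have "card (translate ` L n) = card (L (n - 1))"
        using card_L[of n] card_L[of "n - 1"] n inj_t by (simp add: card_image)
      moreover have "finite (L (n - 1))" unfolding L_def using card_admissible_lists_le by blast
      ultimately have "translate ` L n = L (n - 1)" using sub by (metis card_subset_eq)
      then have bij_t: "bij_betw translate (L n) (L (n - 1))" using inj_t by (simp add: bij_betw_def)
      have bij_m: "bij_betw mset (L k) (mset ` L k)" for k using inj_mset by (simp add: bij_betw_def)
      let ?\<sigma> = "mset \<circ> translate \<circ> the_inv_into (L n) mset"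
      have "bij_betw ?\<sigma> (mset ` L n) (mset ` L (n - 1))"
        by (rule bij_betw_trans[OF bij_betw_the_inv_into[OF bij_m] bij_betw_trans[OF bij_t bij_m]])
      moreover have "\<exists>c. c \<noteq> 0 \<and> mon_vector l m \<epsilon> i (n - 1) (?\<sigma> \<pi>) = vscale c (mon_vector l m \<epsilon> i n \<pi>)"
        if \<pi>: "\<pi> \<in> mset ` L n" for \<pi>
      proof -
        obtain xs where xs: "xs \<in> L n" "\<pi> = mset xs" using \<pi> by blast
        have t: "translate xs \<in> L (n - 1)" using sub xs by blast
        define a where "a = lookup (list_poly l i x0) 0"
        have "?\<sigma> \<pi> = mset (translate xs)" using xs the_inv_into_f_f[OF inj_mset] by simp
        then have "mon_vector l m \<epsilon> i (n - 1) (?\<sigma> \<pi>) = single \<kappa> (cst (s (translate xs) * a) * list_poly l i xs)"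
          using vec[OF t] list_poly_translate[OF admissible_L[OF xs(1)]] by (simp add: cst_mult_left a_def)
        also have "\<dots> = vscale (s (translate xs) * a / s xs) (mon_vector l m \<epsilon> i n \<pi>)"
          using s(1)[OF admissible_L[OF xs(1)]] unfolding xs(2) vec[OF xs(1)] by (simp add: vscale_single cst_mult_left)
        finally show ?thesis
          using s(1)[OF admissible_L[OF xs(1)]] s(1)[OF admissible_L[OF t]] ground_constant_nonzero
          by (intro exI[of _ "s (translate xs) * a / s xs"]) (simp add: a_def)
      qed
      ultimately show ?thesis unfolding diagonally_connected_def index by blast
    qed
    have down: "diagonally_connected (mon_vector l m \<epsilon> i n) (basis_index l m \<epsilon> i \<mu> n)
         (mon_vector l m \<epsilon> i (n - int p)) (basis_index l m \<epsilon> i \<mu> (n - int p))" if "n \<le> n0" for n p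
    proof (induction p)
      case 0
      then show ?case by (simp add: diagonally_connected_refl)
    next
      case (Suc p)
      have e: "n - int (Suc p) = n - int p - 1" by simp
      show ?case
        unfolding e by (rule diagonally_connected_trans[OF Suc step]) (use that in simp)
    qed
    have "diagonally_connected (mon_vector l m \<epsilon> i n1) (basis_index l m \<epsilon> i \<mu> n1)
         (mon_vector l m \<epsilon> i n2) (basis_index l m \<epsilon> i \<mu> n2)" if "n1 \<le> n0" "n2 \<le> n0" for n1 n2
    proof -
      have c1: "diagonally_connected (mon_vector l m \<epsilon> i n0) (basis_index l m \<epsilon> i \<mu> n0)
         (mon_vector l m \<epsilon> i k) (basis_index l m \<epsilon> i \<mu> k)" if "k \<le> n0" for k
        using down[of n0 "nat (n0 - k)"] that by simp
      show ?thesis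
        using diagonally_connected_trans[OF diagonally_connected_sym[OF c1[OF that(1)]] c1[OF that(2)]] .
    qed
    then show ?thesis using basis by blast
  qed
qed

end
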